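(* Consider the bit-exchange protocol with $n$ nodes, $m$ positive weights and threshold $a$, where $m/n=\beta$ is a constant and $a/n=\alpha$. Let $\gamma:=\alpha+\left(\tfrac12-\beta\right)$ and let $\bar T$ be the mean stopping time. For $k\ge1$ let $\sigma_k:=\sqrt{n(1-4^{-k})/12}$, $$A(n,k,\gamma):=\frac12\left[\operatorname{erf}\left(\frac{(\gamma+2^{-(k+1)})n}{\sqrt2\,\sigma_k}\right)-\operatorname{erf}\left(\frac{(\gamma-2^{-(k+1)})n}{\sqrt2\,\sigma_k}\right)\right],$$ and define the error term $\epsilon(n,k,\gamma)$ of the central limit approximation by $\Pr[L(k)<Z(k)<U(k)]=A(n,k,\gamma)+\epsilon(n,k,\gamma)$. Then $$\lim_{n\to\infty}\bar T\;\le\;1+\lim_{n\to\infty}\sum_{k=1}^\infty \Pr[L(k)<Z(k)<U(k)]\;=\;1+\lim_{n\to\infty}\sum_{k=1}^\infty\bigl(A(n,k,\gamma)+\epsilon(n,k,\gamma)\bigr),$$ where $\lim_{n\to\infty}\sum_{k=1}^\infty\epsilon(n,k,\gamma)=0$ and $\sum_{k=1}^\infty A(n,k,\gamma)\le A(n,\gamma)$ with $$A(n,\gamma)=\begin{cases}\frac12\log_2\left(\frac{6n}{\pi}+1\right)+\sqrt{\dfrac{3}{1+\pi/(6n)}}, & \gamma=0,\\[4pt] 1+\kappa+o(1), & 0<\gamma\le \frac14,\\[2pt] 1+o(1), & \frac14<\gamma\le\frac12.\end{cases}$$ Here $o(1)\to0$ as $n\to\infty$, and $\kappa$ is the largest integer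 for which $\dfrac{(\gamma-2^{-(\kappa+1)})\,n}{\sqrt2\,\sigma_\kappa}\le-\dfrac{\sqrt\pi}{2}$; $\kappa$ is bounded in $n$. In particular, the mean stopping time grows logarithmically in $n$ when $\gamma=0$, and is bounded in $n$ otherwise.
   Context: Setting: $n\ge2$ nodes; node $i$ alone knows $X_i$, and $X_1,\dots,X_n$ are i.i.d. uniform on $[0,1)$. Weights $h_i\in\{-1,+1\}$; $\mathcal H^{+}=\{i:h_i=+1\}$, $\mathcal H^{-}=\{i:h_i=-1\}$, $m=|\mathcal H^+|$, so $|\mathcal H^-|=n-m$. For each $i$, $b(i,1),b(i,2),\dots\in\{0,1\}$ are the standard binary expansion digits of $X_i$: $X(i,1)=X_i$, $b(i,j)=\lfloor 2X(i,j)\rfloor$, $X(i,j+1)=2X(i,j)-b(i,j)$. Let $B(l)=\sum_{i\in\mathcal H^+}b(i,l)-\sum_{i\in\mathcal H^-}b(i,l)$ and $Z(j)=\sum_{l=1}^jB(l)2^{-l}$. For a real threshold $a$ let $L(j)=a-m2^{-j}$ and $U(j)=a+(n-m)2^{-j}$. The bit-exchange protocol stops after round $j$ if $Z(j)\le L(j)$ or $Z(j)\ge U(j)$, and otherwise continues. The stopping time $T$ is the smallest $j\ge1$ at which the protocol stops, and $\bar T=E[T]$. $\operatorname{erf}(x)=\frac{2}{\sqrt\pi}\int_0^xe^{-t^2}dt$. *)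

theory Defs
  imports "HOL-Probability.Probability"
begin

section \<open>Binary digits\<close>

text \<open>
  \<open>bin_rem x j\<close> is the shifted number $X(i,j)$ of the recursion for the binary digits of
  \<open>x = X_i\<close>; rounds are counted from 1, so the value at index 0 is irrelevant.
\<close>

fun bin_rem :: "real \<Rightarrow> nat \<Rightarrow> real" where
  "bin_rem x 0 = x"
| "bin_rem x (Suc 0) = x"
| "bin_rem x (Suc (Suc j)) = 2 * bin_rem x (Suc j) - real_of_int \<lfloor>2 * bin_rem x (Suc j)\<rfloor>"

definition bin_digit :: "real \<Rightarrow> nat \<Rightarrow> int" where
  "bin_digit x j = \<lfloor>2 * bin_rem x j\<rfloor>"

section \<open>The bit-exchange protocol\<close>

text \<open>
  The nodes are \<open>1, \<dots>, n\<close>, \<open>h\<close> assigns the weights, and \<open>x\<close> is a realization of the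
  node values.
\<close>

definition pos_nodes :: "nat \<Rightarrow> (nat \<Rightarrow> int) \<Rightarrow> nat set" where
  "pos_nodes n h = {i \<in> {1..n}. h i = 1}"

definition neg_nodes :: "nat \<Rightarrow> (nat \<Rightarrow> int) \<Rightarrow> nat set" where
  "neg_nodes n h = {i \<in> {1..n}. h i = -1}"

definition num_pos :: "nat \<Rightarrow> (nat \<Rightarrow> int) \<Rightarrow> nat" where
  "num_pos n h = card (pos_nodes n h)"

definition round_sum :: "nat \<Rightarrow> (nat \<Rightarrow> int) \<Rightarrow> (nat \<Rightarrow> real) \<Rightarrow> nat \<Rightarrow> int" where
  "round_sum n h x l =
     (\<Sum>i\<in>pos_nodes n h. bin_digit (x i) l) - (\<Sum>i\<in>neg_nodes n h. bin_digit (x i) l)"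

definition partial_Z :: "nat \<Rightarrow> (nat \<Rightarrow> int) \<Rightarrow> (nat \<Rightarrow> real) \<Rightarrow> nat \<Rightarrow> real" where
  "partial_Z n h x j = (\<Sum>l=1..j. real_of_int (round_sum n h x l) / 2 ^ l)"

definition lower_L :: "nat \<Rightarrow> (nat \<Rightarrow> int) \<Rightarrow> real \<Rightarrow> nat \<Rightarrow> real" where
  "lower_L n h a j = a - real (num_pos n h) / 2 ^ j"

definition upper_U :: "nat \<Rightarrow> (nat \<Rightarrow> int) \<Rightarrow> real \<Rightarrow> nat \<Rightarrow> real" where
  "upper_U n h a j = a + (real n - real (num_pos n h)) / 2 ^ j"

definition stops_at :: "nat \<Rightarrow> (nat \<Rightarrow> int) \<Rightarrow> real \<Rightarrow> (nat \<Rightarrow> real) \<Rightarrow> nat \<Rightarrow> bool" where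
  "stops_at n h a x j \<longleftrightarrow>
     partial_Z n h x j \<le> lower_L n h a j \<or> partial_Z n h x j \<ge> upper_U n h a j"

text \<open>The stopping time is \<open>\<infinity>\<close> on realizations for which the protocol never stops.\<close>

definition stopping_T :: "nat \<Rightarrow> (nat \<Rightarrow> int) \<Rightarrow> real \<Rightarrow> (nat \<Rightarrow> real) \<Rightarrow> enat" where
  "stopping_T n h a x = Inf {enat j | j. j \<ge> 1 \<and> stops_at n h a x j}"

locale bit_exchange = prob_space M for M :: "'a measure" +
  fixes n :: nat and X :: "nat \<Rightarrow> 'a \<Rightarrow> real" and h :: "nat \<Rightarrow> int"
  assumes n_ge_2: "n \<ge> 2"
    and weights: "\<And>i. i \<in> {1..n} \<Longrightarrow> h i \<in> {-1, 1}"
    and indep: "indep_vars (\<lambda>_. borel) X {1..n}"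
    and uniform: "\<And>i. i \<in> {1..n} \<Longrightarrow> distr M borel (X i) = uniform_measure lborel {0..<1}"

definition mean_T ::
  "'a measure \<Rightarrow> nat \<Rightarrow> (nat \<Rightarrow> 'a \<Rightarrow> real) \<Rightarrow> (nat \<Rightarrow> int) \<Rightarrow> real \<Rightarrow> ennreal" where
  "mean_T M n X h a = (\<integral>\<^sup>+ \<omega>. ennreal_of_enat (stopping_T n h a (\<lambda>i. X i \<omega>)) \<partial>M)"

definition prob_between ::
  "'a measure \<Rightarrow> nat \<Rightarrow> (nat \<Rightarrow> 'a \<Rightarrow> real) \<Rightarrow> (nat \<Rightarrow> int) \<Rightarrow> real \<Rightarrow> nat \<Rightarrow> real" where
  "prob_between M n X h a k =
     measure M {\<omega> \<in> space M. lower_L n h a k < partial_Z n h (\<lambda>i. X i \<omega>) k \<and>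
                              partial_Z n h (\<lambda>i. X i \<omega>) k < upper_U n h a k}"

section \<open>The central limit approximation\<close>

text \<open>The interval integral is oriented, so this is the odd error function on all of the reals.\<close>

definition erf :: "real \<Rightarrow> real" where
  "erf x = 2 / sqrt pi * (LBINT t=ereal 0..ereal x. exp (- (t ^ 2)))"

definition sigma :: "nat \<Rightarrow> nat \<Rightarrow> real" where
  "sigma n k = sqrt (real n * (1 - 1 / 4 ^ k) / 12)"

definition A_term :: "nat \<Rightarrow> nat \<Rightarrow> real \<Rightarrow> real" where
  "A_term n k \<gamma> =
     1 / 2 * (erf ((\<gamma> + 1 / 2 ^ (k + 1)) * real n / (sqrt 2 * sigma n k))
            - erf ((\<gamma> - 1 / 2 ^ (k + 1)) * real n / (sqrt 2 * sigma n k)))"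

text \<open>
  For \<open>k = 0\<close> the quotient below has denominator \<open>sigma n 0 = 0\<close> and, for \<open>\<gamma> < 1/2\<close>, a negative
  numerator; it stands for \<open>-\<infinity>\<close>, so that \<open>k = 0\<close> always qualifies (it is the value of \<open>\<kappa>\<close>
  whenever no \<open>k \<ge> 1\<close> does, for instance at \<open>\<gamma> = 1/4\<close>). In HOL the quotient would be 0, hence
  the separate disjunct.
\<close>

definition kappa_cond :: "nat \<Rightarrow> real \<Rightarrow> nat \<Rightarrow> bool" where
  "kappa_cond n \<gamma> k \<longleftrightarrow>
     k = 0 \<or> (\<gamma> - 1 / 2 ^ (k + 1)) * real n / (sqrt 2 * sigma n k) \<le> - sqrt pi / 2"

definition kappa :: "nat \<Rightarrow> real \<Rightarrow> nat" where
  "kappa n \<gamma> = (GREATEST k. kappa_cond n \<gamma> k)"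

text \<open>For positive \<open>\<gamma>\<close> the largest such integer exists.\<close>

lemma kappa_cond_bounded:
  assumes "\<gamma> > 0"
  shows "\<exists>K. \<forall>n k. kappa_cond n \<gamma> k \<longrightarrow> k \<le> K"
proof -
  obtain K where K: "(1 / 2 :: real) ^ K < \<gamma>"
    using real_arch_pow_inv[of \<gamma> "1 / 2"] assms by auto
  have "k \<le> K" if "kappa_cond n \<gamma> k" for n k
  proof (rule ccontr)
    assume "\<not> k \<le> K"
    then have "(1 / 2 :: real) ^ (k + 1) \<le> (1 / 2) ^ K"
      by (intro power_decreasing) auto
    with K have "\<gamma> - 1 / 2 ^ (k + 1) \<ge> 0"
      by (simp add: power_one_over)
    moreover have "sigma n k \<ge> 0"
      unfolding sigma_def by simp
    ultimately have "(\<gamma> - 1 / 2 ^ (k + 1)) * real n / (sqrt 2 * sigma n k) \<ge> 0"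
      by (intro divide_nonneg_nonneg mult_nonneg_nonneg) auto
    moreover have "- sqrt pi / 2 < 0"
      by simp
    ultimately show False
      using that \<open>\<not> k \<le> K\<close> unfolding kappa_cond_def by linarith
  qed
  then show ?thesis
    by blast
qed

lemma kappa_greatest:
  assumes "\<gamma> > 0"
  shows "kappa_cond n \<gamma> (kappa n \<gamma>)" and "kappa_cond n \<gamma> k \<Longrightarrow> k \<le> kappa n \<gamma>"
proof -
  obtain K where K: "\<And>j. kappa_cond n \<gamma> j \<Longrightarrow> j \<le> K"
    using kappa_cond_bounded[OF assms] by blast
  have "kappa_cond n \<gamma> 0"
    by (simp add: kappa_cond_def)
  with K show "kappa_cond n \<gamma> (kappa n \<gamma>)"
    unfolding kappa_def by (metis GreatestI_nat)
  show "k \<le> kappa n \<gamma>" if "kappa_cond n \<gamma> k"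
    using that K unfolding kappa_def by (metis Greatest_le_nat)
qed

text \<open>
  The bound $A(n,\gamma)$ for \<open>0 \<le> \<gamma> \<le> 1/2\<close>, where \<open>r\<close> is the value at \<open>n\<close> of the
  vanishing term $o(1)$.
\<close>

definition A_bound :: "real \<Rightarrow> nat \<Rightarrow> real \<Rightarrow> real" where
  "A_bound r n \<gamma> =
     (if \<gamma> = 0 then 1 / 2 * log 2 (6 * real n / pi + 1) + sqrt (3 / (1 + pi / (6 * real n)))
      else if \<gamma> \<le> 1 / 4 then 1 + real (kappa n \<gamma>) + r
      else 1 + r)"

text \<open>
  With \<open>m / n = \<beta>\<close> constant, only those \<open>n\<close> are possible for which \<open>\<beta> n\<close> is an integer;
  limits are taken along a set of such \<open>n\<close>.
\<close>

definition at_top_in :: "nat set \<Rightarrow> nat filter" where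
  "at_top_in N = inf sequentially (principal N)"

end

(* The protocol cannot restart: once a round ends outside (L, U), all later ones do. So T > k iff
   L(k) < Z(k) < U(k), and the mean of T is exactly 1 + sum_k P_k with
   P_k = Pr[L(k) < Z(k) < U(k)]. In terms of the centred sum S_k = Z(k) - E Z(k), which has variance
   sigma_k^2, the event reads |S_k - gamma n| < n / 2^(k+1).

   Each atom of S_k has mass O(2^-k / sqrt n): the last digits of the nodes determine a parity, so
   passing from k - 1 to k halves the largest atom, and for k = 1 it is a central binomial
   probability. This gives P_k = O(sqrt n / 2^k) for large k; Chebyshev's inequality gives
   1 - P_k = O(4^k / n) for gamma = 0, and P_k = O(1 / n) for the k with 2^-k <= |gamma| otherwise.
   The Gaussian probabilities A_k satisfy the same bounds. Hence |P_k - A_k| decays geometrically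
   away from a single round, uniformly in n. By Levy's continuity theorem P_k - A_k tends to 0
   uniformly in k, so the sum of the errors tends to 0. *)

theory Submission
  imports Defs
begin


section \<open>The protocol on a fixed realization\<close>

text \<open>The obstacle is to exchange the limit with the infinite sum. At offset 0 each single P_k
  tends to 1, the number of rounds that count grows like (1/2) log_2 n, and the error bounds peak at
  a round with 2 ^ k of order sqrt n, which moves to infinity. So there is no fixed summable
  majorant, and uniform smallness of the single errors alone is not enough. Two facts are combined
  instead: a geometric profile whose centre moves but whose sum does not depend on the centre, and
  uniform smallness. Splitting |d| into sqrt |d| * sqrt |d| spends one factor on each. Late rounds
  ask for intervals much shorter than the standard deviation, where that limit theorem says nothing
  summable; hence the counting of atoms. For 0 < \<gamma> \<le> 1/2 the limit of the Gaussian sums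
  is at most K + 1/2 for an integer K that is eventually at most \<kappa>. This spare 1/2 lets the
  o(1) be eventually 0.\<close>

lemma bin_rem_eq_frac:
  assumes "0 \<le> x" "x < 1"
  shows "bin_rem x (Suc j) = 2 ^ j * x - of_int \<lfloor>2 ^ j * x\<rfloor>"
proof (induction j)
  case 0
  have "\<lfloor>x\<rfloor> = 0" using assms by linarith
  then show ?case by simp
next
  case (Suc j)
  have eq: "2 * bin_rem x (Suc j) = 2 ^ Suc j * x - of_int (2 * \<lfloor>2 ^ j * x\<rfloor>)"
    using Suc by simp
  have "\<lfloor>2 ^ Suc j * x - of_int (2 * \<lfloor>2 ^ j * x\<rfloor>)\<rfloor> = \<lfloor>2 ^ Suc j * x\<rfloor> - 2 * \<lfloor>2 ^ j * x\<rfloor>"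
    by (rule floor_diff_of_int)
  then show ?case using eq by simp
qed

lemma bin_digit_eq_floor_diff:
  assumes "0 \<le> x" "x < 1"
  shows "bin_digit x (Suc j) = \<lfloor>2 ^ Suc j * x\<rfloor> - 2 * \<lfloor>2 ^ j * x\<rfloor>"
proof -
  have "2 * bin_rem x (Suc j) = 2 ^ Suc j * x - of_int (2 * \<lfloor>2 ^ j * x\<rfloor>)"
    using bin_rem_eq_frac[OF assms] by simp
  then show ?thesis unfolding bin_digit_def by (simp only: floor_diff_of_int)
qed

lemma bin_digit_cases:
  assumes "0 \<le> x" "x < 1"
  shows "bin_digit x (Suc j) = 0 \<or> bin_digit x (Suc j) = 1"
proof -
  have "0 \<le> bin_rem x (Suc j)" "bin_rem x (Suc j) < 1"
    unfolding bin_rem_eq_frac[OF assms] by linarith+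
  then show ?thesis unfolding bin_digit_def by linarith
qed

text \<open>The sum telescopes: by \<open>bin_digit_eq_floor_diff\<close> its \<open>l\<close>-th
  term is \<open>\<lfloor>2 ^ l * x\<rfloor> / 2 ^ l\<close> minus the same expression at
  \<open>l - 1\<close>, and the initial value is 0 because \<open>x\<close> lies in the unit
  interval.\<close>

lemma sum_bin_digit:
  assumes "0 \<le> x" "x < 1"
  shows "(\<Sum>l=1..j. of_int (bin_digit x l) / 2 ^ l) = of_int \<lfloor>2 ^ j * x\<rfloor> / (2 ^ j :: real)"
proof (induction j)
  case 0
  have "\<lfloor>x\<rfloor> = 0" using assms by linarith
  then show ?case by simp
next
  case (Suc j)
  then show ?case using bin_digit_eq_floor_diff[OF assms, of j]
    by (simp add: field_simps)
qed

text \<open>What the pathwise arguments need. The range condition holds only almost surely: a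
  uniform law lets \<open>X i\<close> leave the unit interval on a null set, and there the first
  digit need not be 0 or 1.\<close>

definition valid_input :: "nat \<Rightarrow> (nat \<Rightarrow> int) \<Rightarrow> (nat \<Rightarrow> real) \<Rightarrow> bool" where
  "valid_input n h x \<longleftrightarrow> (\<forall>i\<in>{1..n}. h i \<in> {-1, 1} \<and> 0 \<le> x i \<and> x i < 1)"

lemma sum_weights_split:
  fixes f :: "nat \<Rightarrow> 'b::comm_ring_1"
  assumes "\<And>i. i \<in> {1..n} \<Longrightarrow> h i \<in> {-1, 1}"
  shows "(\<Sum>i\<in>pos_nodes n h. f i) - (\<Sum>i\<in>neg_nodes n h. f i) = (\<Sum>i=1..n. of_int (h i) * f i)"
proof -
  have un: "{1..n} = pos_nodes n h \<union> neg_nodes n h"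
    unfolding pos_nodes_def neg_nodes_def using assms by force
  have "(\<Sum>i=1..n. of_int (h i) * f i) =
      (\<Sum>i\<in>pos_nodes n h. of_int (h i) * f i) + (\<Sum>i\<in>neg_nodes n h. of_int (h i) * f i)"
    unfolding un by (rule sum.union_disjoint) (auto simp: pos_nodes_def neg_nodes_def)
  also have "(\<Sum>i\<in>pos_nodes n h. of_int (h i) * f i) = (\<Sum>i\<in>pos_nodes n h. f i)"
    by (rule sum.cong) (auto simp: pos_nodes_def)
  also have "(\<Sum>i\<in>neg_nodes n h. of_int (h i) * f i) = (\<Sum>i\<in>neg_nodes n h. - f i)"
    by (rule sum.cong) (auto simp: neg_nodes_def)
  finally show ?thesis by (simp add: sum_negf)
qed

lemma card_pos_neg_nodes:
  assumes "\<And>i. i \<in> {1..n} \<Longrightarrow> h i \<in> {-1, 1}"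
  shows "card (pos_nodes n h) + card (neg_nodes n h) = n"
proof -
  have "{1..n} = pos_nodes n h \<union> neg_nodes n h"
    unfolding pos_nodes_def neg_nodes_def using assms by force
  then have "n = card (pos_nodes n h \<union> neg_nodes n h)" by (metis card_atLeastAtMost diff_Suc_1)
  also have "\<dots> = card (pos_nodes n h) + card (neg_nodes n h)"
    by (rule card_Un_disjoint) (auto simp: pos_nodes_def neg_nodes_def)
  finally show ?thesis by simp
qed

lemma partial_Z_eq_sum_floor:
  assumes "valid_input n h x"
  shows "partial_Z n h x j = (\<Sum>i=1..n. of_int (h i) * (of_int \<lfloor>2 ^ j * x i\<rfloor> / 2 ^ j))"
proof -
  have w: "\<And>i. i \<in> {1..n} \<Longrightarrow> h i \<in> {-1, 1}" using assms unfolding valid_input_def by blast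
  have r: "real_of_int (round_sum n h x l) = (\<Sum>i=1..n. of_int (h i) * of_int (bin_digit (x i) l))" for l
    unfolding round_sum_def of_int_diff of_int_sum by (rule sum_weights_split) (rule w)
  have "partial_Z n h x j = (\<Sum>l=1..j. (\<Sum>i=1..n. of_int (h i) * of_int (bin_digit (x i) l) / 2 ^ l))"
    unfolding partial_Z_def r by (simp add: sum_divide_distrib)
  also have "\<dots> = (\<Sum>i=1..n. (\<Sum>l=1..j. of_int (h i) * of_int (bin_digit (x i) l) / 2 ^ l))"
    by (rule sum.swap)
  also have "\<dots> = (\<Sum>i=1..n. of_int (h i) * (\<Sum>l=1..j. of_int (bin_digit (x i) l) / 2 ^ l))"
    by (simp add: sum_distrib_left)
  also have "\<dots> = (\<Sum>i=1..n. of_int (h i) * (of_int \<lfloor>2 ^ j * x i\<rfloor> / 2 ^ j))"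
  proof (rule sum.cong[OF refl])
    fix i assume "i \<in> {1..n}"
    then have "0 \<le> x i" "x i < 1" using assms unfolding valid_input_def by auto
    then show "of_int (h i) * (\<Sum>l=1..j. of_int (bin_digit (x i) l) / 2 ^ l) =
       real_of_int (h i) * (of_int \<lfloor>2 ^ j * x i\<rfloor> / 2 ^ j)"
      by (simp only: sum_bin_digit)
  qed
  finally show ?thesis .
qed

lemma round_sum_bounds:
  assumes "valid_input n h x"
  shows "round_sum n h x (Suc j) \<le> int (num_pos n h)"
    and "- (int n - int (num_pos n h)) \<le> round_sum n h x (Suc j)"
proof -
  have w: "\<And>i. i \<in> {1..n} \<Longrightarrow> h i \<in> {-1, 1}" using assms unfolding valid_input_def by blast
  have d: "0 \<le> bin_digit (x i) (Suc j)" "bin_digit (x i) (Suc j) \<le> 1" if "i \<in> {1..n}" for i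
    using bin_digit_cases[of "x i" j] assms that unfolding valid_input_def by force+
  have sub: "pos_nodes n h \<subseteq> {1..n}" "neg_nodes n h \<subseteq> {1..n}"
    by (auto simp: pos_nodes_def neg_nodes_def)
  have p: "(\<Sum>i\<in>pos_nodes n h. bin_digit (x i) (Suc j)) \<le> int (card (pos_nodes n h))"
    using sum_bounded_above[of "pos_nodes n h" "\<lambda>i. bin_digit (x i) (Suc j)" 1] d(2) sub(1) by fastforce
  have q: "(\<Sum>i\<in>neg_nodes n h. bin_digit (x i) (Suc j)) \<le> int (card (neg_nodes n h))"
    using sum_bounded_above[of "neg_nodes n h" "\<lambda>i. bin_digit (x i) (Suc j)" 1] d(2) sub(2) by fastforce
  have p0: "0 \<le> (\<Sum>i\<in>pos_nodes n h. bin_digit (x i) (Suc j))"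
    by (rule sum_nonneg) (use d sub in auto)
  have q0: "0 \<le> (\<Sum>i\<in>neg_nodes n h. bin_digit (x i) (Suc j))"
    by (rule sum_nonneg) (use d sub in auto)
  show "round_sum n h x (Suc j) \<le> int (num_pos n h)"
    using p q0 by (simp add: round_sum_def num_pos_def)
  show "- (int n - int (num_pos n h)) \<le> round_sum n h x (Suc j)"
    using q p0 card_pos_neg_nodes[of n h, OF w] by (simp add: round_sum_def num_pos_def)
qed

text \<open>From one round to the next, L rises by \<open>m / 2 ^ Suc j\<close>, which is the most
  that Z can rise, and U falls by \<open>(n - m) / 2 ^ Suc j\<close>, which is the most that Z can
  fall. So Z never re-enters the interval.\<close>

lemma stops_at_Suc:
  assumes "valid_input n h x" "stops_at n h a x j"
  shows "stops_at n h a x (Suc j)"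
proof -
  have Z: "partial_Z n h x (Suc j) = partial_Z n h x j + of_int (round_sum n h x (Suc j)) / 2 ^ Suc j"
    by (simp add: partial_Z_def)
  have "real_of_int (round_sum n h x (Suc j)) \<le> real (num_pos n h)"
    using round_sum_bounds(1)[OF assms(1), of j] by linarith
  then have up: "of_int (round_sum n h x (Suc j)) / 2 ^ Suc j \<le> real (num_pos n h) / 2 ^ Suc j"
    by (intro divide_right_mono) auto
  have "- (real n - real (num_pos n h)) \<le> real_of_int (round_sum n h x (Suc j))"
    using round_sum_bounds(2)[OF assms(1), of j] by linarith
  then have lo: "- (real n - real (num_pos n h)) / 2 ^ Suc j \<le> of_int (round_sum n h x (Suc j)) / 2 ^ Suc j"
    by (intro divide_right_mono) auto
  have L: "lower_L n h a (Suc j) = lower_L n h a j + real (num_pos n h) / 2 ^ Suc j"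
    by (simp add: lower_L_def field_simps)
  have U: "upper_U n h a (Suc j) = upper_U n h a j + - (real n - real (num_pos n h)) / 2 ^ Suc j"
    by (simp add: upper_U_def field_simps)
  show ?thesis using assms(2) up lo unfolding stops_at_def Z L U by linarith
qed

lemma stops_at_mono:
  assumes "valid_input n h x" "stops_at n h a x i" "i \<le> j"
  shows "stops_at n h a x j"
  using assms(3,2) by (induction rule: dec_induct) (auto intro: stops_at_Suc[OF assms(1)])

lemma less_stopping_T_iff:
  "enat k < stopping_T n h a x \<longleftrightarrow> (\<forall>j\<in>{1..k}. \<not> stops_at n h a x j)"
proof -
  have "stopping_T n h a x \<le> enat k \<longleftrightarrow> (\<exists>j\<in>{1..k}. stops_at n h a x j)"
  proof
    assume "stopping_T n h a x \<le> enat k"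
    \<comment> \<open>A strict bound by the successor yields a member of the set below it, so
      attainment of the infimum needs no discussion.\<close>
    then have "stopping_T n h a x < enat (Suc k)"
      using le_less_trans[of _ "enat k" "enat (Suc k)"] by auto
    then show "\<exists>j\<in>{1..k}. stops_at n h a x j"
      unfolding stopping_T_def Inf_less_iff by auto
  next
    assume "\<exists>j\<in>{1..k}. stops_at n h a x j"
    then obtain j where "1 \<le> j" "j \<le> k" "stops_at n h a x j" by auto
    then show "stopping_T n h a x \<le> enat k"
      unfolding stopping_T_def by (intro Inf_lower2[of "enat j"]) auto
  qed
  then show ?thesis by (metis not_le)
qed

lemma less_stopping_T_iff_valid:
  assumes "valid_input n h x" "k \<ge> 1"
  shows "enat k < stopping_T n h a x \<longleftrightarrow> \<not> stops_at n h a x k"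
  unfolding less_stopping_T_iff using assms(2) stops_at_mono[OF assms(1)] by fastforce


section \<open>Atoms of weighted sums of uniform integers\<close>

definition weighted_solutions :: "'i set \<Rightarrow> ('i \<Rightarrow> int) \<Rightarrow> int \<Rightarrow> int \<Rightarrow> ('i \<Rightarrow> int) set" where
  "weighted_solutions I h N z = {d \<in> I \<rightarrow>\<^sub>E {0..<N}. (\<Sum>i\<in>I. h i * d i) = z}"

lemma finite_weighted_solutions: "finite I \<Longrightarrow> finite (weighted_solutions I h N z)"
  unfolding weighted_solutions_def by (simp add: finite_PiE)

text \<open>Flipping the bit at one fixed index changes the signed sum by an odd number. It
  therefore injects the class into its complement, which leaves at most half of the bit
  vectors.\<close>

lemma card_parity_class:
  fixes h :: "'i \<Rightarrow> int"
  assumes I: "finite I" "i0 \<in> I" and h: "\<And>i. i \<in> I \<Longrightarrow> h i \<in> {-1, 1}"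
  shows "card {e \<in> I \<rightarrow>\<^sub>E {0..<2}. even ((\<Sum>i\<in>I. h i * e i) - z)} \<le> 2 ^ (card I - 1)"
proof -
  define P where "P = I \<rightarrow>\<^sub>E {0..<2::int}"
  define E where "E = {e \<in> P. even ((\<Sum>i\<in>I. h i * e i) - z)}"
  define flip :: "('i \<Rightarrow> int) \<Rightarrow> 'i \<Rightarrow> int" where "flip e = e(i0 := 1 - e i0)" for e
  have finP: "finite P" using I unfolding P_def by (simp add: finite_PiE)
  have cP: "card P = 2 ^ card I" using I unfolding P_def by (simp add: card_PiE)
  have s: "(\<Sum>i\<in>I. h i * e i) = h i0 * e i0 + (\<Sum>i\<in>I - {i0}. h i * e i)" for e :: "'i \<Rightarrow> int"
    using I by (simp add: sum.remove)
  have fl: "flip e \<in> P - E" if "e \<in> E" for e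
  proof -
    have e: "e \<in> P" using that E_def by simp
    have "e i0 \<in> {0..<2}" using e I unfolding P_def by auto
    then have "flip e \<in> P" using e I unfolding P_def flip_def by (auto simp: PiE_iff extensional_def)
    moreover have "(\<Sum>i\<in>I. h i * flip e i) = (\<Sum>i\<in>I. h i * e i) + h i0 * (1 - 2 * e i0)"
      unfolding s flip_def by (simp add: algebra_simps)
    moreover have "odd (h i0 * (1 - 2 * e i0))" using h[OF I(2)] by auto
    ultimately show ?thesis using that unfolding E_def by auto
  qed
  have "inj_on flip E"
  proof (rule inj_onI)
    fix x y assume xy: "flip x = flip y"
    have "x j = y j" for j
      using fun_cong[OF xy, of j] by (cases "j = i0") (auto simp: flip_def)
    then show "x = y" by auto
  qed
  then have "card E \<le> card (P - E)"
    using fl finP by (intro card_inj_on_le[of flip]) auto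
  also have "\<dots> = card P - card E"
    using finP by (intro card_Diff_subset) (auto simp: E_def)
  finally have "2 * card E \<le> 2 ^ card I" using cP by linarith
  moreover have "(2::nat) ^ card I = 2 * 2 ^ (card I - 1)"
    using I by (metis card_gt_0_iff empty_iff power_eq_if not_less_zero)
  ultimately show ?thesis unfolding E_def P_def by simp
qed

text \<open>Fixing the last binary digits of the summands determines their parity, so only half of the
  choices of last digits are compatible with a given value of the sum.\<close>

lemma card_weighted_solutions_double:
  fixes h :: "'i \<Rightarrow> int"
  assumes I: "finite I" "I \<noteq> {}" and h: "\<And>i. i \<in> I \<Longrightarrow> h i \<in> {-1, 1}"
    and B: "\<And>z. card (weighted_solutions I h N z) \<le> B"
  shows "card (weighted_solutions I h (2 * N) z) \<le> 2 ^ (card I - 1) * B"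
proof -
  obtain i0 where i0: "i0 \<in> I" using I by auto
  define E where "E = {e \<in> I \<rightarrow>\<^sub>E {0..<2}. even ((\<Sum>i\<in>I. h i * e i) - z)}"
  \<comment> \<open>Once the parities \<open>e\<close> are fixed, the halves of the summands solve
    the same equation with this right-hand side. The division is exact for \<open>e\<close> in
    \<open>E\<close>.\<close>
  define T where "T e = weighted_solutions I h N ((z - (\<Sum>i\<in>I. h i * e i)) div 2)" for e
  define f where "f d = (restrict (\<lambda>i. d i mod 2) I, restrict (\<lambda>i. d i div 2) I)" for d :: "'i \<Rightarrow> int"
  have finE: "finite E" using I unfolding E_def by (simp add: finite_PiE)
  have finT: "finite (T e)" for e unfolding T_def using I(1) by (rule finite_weighted_solutions)
  have "inj_on f (weighted_solutions I h (2 * N) z)"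
  proof (rule inj_onI)
    fix x y assume x: "x \<in> weighted_solutions I h (2 * N) z" and y: "y \<in> weighted_solutions I h (2 * N) z"
      and xy: "f x = f y"
    have "x i = y i" for i
    proof (cases "i \<in> I")
      case True
      have "x i mod 2 = y i mod 2" "x i div 2 = y i div 2"
        using xy True unfolding f_def by (auto dest!: fun_cong[of _ _ i])
      then show ?thesis by (metis div_mult_mod_eq)
    next
      case False
      then show ?thesis using x y unfolding weighted_solutions_def by (auto simp: PiE_iff extensional_def)
    qed
    then show "x = y" by auto
  qed
  moreover have "f ` weighted_solutions I h (2 * N) z \<subseteq> Sigma E T"
  proof
    fix p assume "p \<in> f ` weighted_solutions I h (2 * N) z"
    then obtain d where d: "d \<in> I \<rightarrow>\<^sub>E {0..<2 * N}" "(\<Sum>i\<in>I. h i * d i) = z" and p: "p = f d"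
      unfolding weighted_solutions_def by auto
    define e where "e = restrict (\<lambda>i. d i mod 2) I"
    define d' where "d' = restrict (\<lambda>i. d i div 2) I"
    have "z = (\<Sum>i\<in>I. h i * (2 * d' i + e i))"
      unfolding d(2)[symmetric] e_def d'_def by (intro sum.cong) auto
    also have "\<dots> = 2 * (\<Sum>i\<in>I. h i * d' i) + (\<Sum>i\<in>I. h i * e i)"
      by (simp add: algebra_simps sum.distrib sum_distrib_left)
    finally have z: "z = 2 * (\<Sum>i\<in>I. h i * d' i) + (\<Sum>i\<in>I. h i * e i)" .
    have "e \<in> E" unfolding E_def using z by (auto simp: e_def)
    moreover have "d' \<in> T e"
      unfolding T_def weighted_solutions_def using z d(1) by (fastforce simp: d'_def PiE_iff)
    ultimately show "p \<in> Sigma E T" unfolding p f_def e_def d'_def by auto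
  qed
  ultimately have "card (weighted_solutions I h (2 * N) z) \<le> card (Sigma E T)"
    using finE finT by (intro card_inj_on_le[of f]) auto
  also have "\<dots> = (\<Sum>e\<in>E. card (T e))" using finE finT by (simp add: card_SigmaI)
  also have "\<dots> \<le> card E * B" using sum_bounded_above[of E "\<lambda>e. card (T e)" B] B unfolding T_def by simp
  also have "card E \<le> 2 ^ (card I - 1)"
    unfolding E_def using I(1) i0 h by (rule card_parity_class)
  finally show ?thesis by simp
qed

text \<open>Complementing the digits of the nodes with weight \<open>-1\<close> turns the value \<open>z\<close> of the signed
  sum into the size of a subset of \<open>I\<close>.\<close>

lemma card_weighted_solutions_two:
  fixes h :: "'i \<Rightarrow> int"
  assumes I: "finite I" and h: "\<And>i. i \<in> I \<Longrightarrow> h i \<in> {-1, 1}"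
  shows "card (weighted_solutions I h 2 z) \<le> card I choose (card I div 2)"
proof -
  \<comment> \<open>The shift counts the nodes of weight -1. If the argument of \<open>nat\<close>
    is negative, there are no solutions and nothing is to be shown.\<close>
  define K where "K = nat (z + (\<Sum>i\<in>I. if h i = 1 then 0 else 1))"
  define f where "f d = {i \<in> I. (d i = 1) = (h i = 1)}" for d :: "'i \<Rightarrow> int"
  have "inj_on f (weighted_solutions I h 2 z)"
  proof (rule inj_onI)
    fix x y assume x: "x \<in> weighted_solutions I h 2 z" and y: "y \<in> weighted_solutions I h 2 z"
      and xy: "f x = f y"
    have "x i = y i" for i
    proof (cases "i \<in> I")
      case True
      then have "x i \<in> {0..<2}" "y i \<in> {0..<2}" using x y unfolding weighted_solutions_def by auto
      moreover have "(x i = 1) = (y i = 1)" using xy True unfolding f_def by blast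
      ultimately show ?thesis by auto
    next
      case False
      then show ?thesis using x y unfolding weighted_solutions_def by (auto simp: PiE_iff extensional_def)
    qed
    then show "x = y" by auto
  qed
  moreover have "f ` weighted_solutions I h 2 z \<subseteq> {A. A \<subseteq> I \<and> card A = K}"
  proof safe
    fix d i assume "d \<in> weighted_solutions I h 2 z" "i \<in> f d"
    then show "i \<in> I" unfolding f_def by auto
  next
    fix d assume "d \<in> weighted_solutions I h 2 z"
    then have d: "d \<in> I \<rightarrow>\<^sub>E {0..<2}" "(\<Sum>i\<in>I. h i * d i) = z"
      unfolding weighted_solutions_def by auto
    have "int (card (f d)) = (\<Sum>i\<in>I. if (d i = 1) = (h i = 1) then 1 else 0)"
      unfolding f_def using I by (simp add: sum.If_cases Int_def)
    also have "\<dots> = (\<Sum>i\<in>I. h i * d i + (if h i = 1 then 0 else 1))"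
    proof (rule sum.cong[OF refl])
      fix i assume i: "i \<in> I"
      then have "d i \<in> {0..<2}" using d by auto
      then have "d i = 0 \<or> d i = 1" by auto
      then show "(if (d i = 1) = (h i = 1) then 1 else 0) = h i * d i + (if h i = 1 then 0 else 1)"
        using h[OF i] by auto
    qed
    also have "\<dots> = z + (\<Sum>i\<in>I. if h i = 1 then 0 else 1)"
      using d by (simp add: sum.distrib)
    finally show "card (f d) = K" unfolding K_def by simp
  qed
  ultimately have "card (weighted_solutions I h 2 z) \<le> card {A. A \<subseteq> I \<and> card A = K}"
    using I by (intro card_inj_on_le[of f]) auto
  also have "\<dots> = card I choose K" using I by (rule n_subsets)
  also have "\<dots> \<le> card I choose (card I div 2)" by (rule binomial_maximum)
  finally show ?thesis .
qed

lemma card_weighted_solutions_power: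
  fixes h :: "'i \<Rightarrow> int"
  assumes I: "finite I" "I \<noteq> {}" and h: "\<And>i. i \<in> I \<Longrightarrow> h i \<in> {-1, 1}"
  shows "card (weighted_solutions I h (2 ^ Suc k) z) \<le>
    (2 ^ (card I - 1)) ^ k * (card I choose (card I div 2))"
proof (induction k arbitrary: z)
  case 0
  then show ?case using card_weighted_solutions_two[OF I(1), of h] h by simp
next
  case (Suc k)
  have "card (weighted_solutions I h (2 * 2 ^ Suc k) z) \<le>
    2 ^ (card I - 1) * ((2 ^ (card I - 1)) ^ k * (card I choose (card I div 2)))"
    by (rule card_weighted_solutions_double[OF I]) (use h Suc in auto)
  then show ?case by (simp add: mult.assoc)
qed

section \<open>The mass of the middle binomial coefficient\<close>

lemma central_binomial_square_le: "real ((2 * m) choose m) ^ 2 * real (2 * m + 1) \<le> (4 ^ m) ^ 2"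
proof (induction m)
  case 0
  then show ?case by simp
next
  case (Suc m)
  define c where "c = real ((2 * m) choose m)"
  have "real (Suc m) * real ((2 * Suc m) choose Suc m) = 2 * real (2 * m + 1) * c"
  proof -
    have "Suc m * ((2 * Suc m) choose Suc m) = (2 * Suc m) * ((2 * m + 1) choose m)"
      using Suc_times_binomial_eq[of "2 * m + 1" m] by (simp add: mult.commute)
    moreover have "Suc m * ((2 * m + 1) choose m) = (2 * m + 1) * ((2 * m) choose m)"
      using Suc_times_binomial_eq[of "2 * m" m] binomial_symmetric[of m "2 * m + 1"]
      by (simp add: mult.commute)
    ultimately have "Suc m * (Suc m * ((2 * Suc m) choose Suc m)) =
        Suc m * (2 * ((2 * m + 1) * ((2 * m) choose m)))"
      by (metis (no_types, lifting) mult.assoc mult.left_commute)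
    then have "Suc m * ((2 * Suc m) choose Suc m) = 2 * ((2 * m + 1) * ((2 * m) choose m))"
      by (metis mult_cancel1 nat.distinct(1))
    then have "real (Suc m * ((2 * Suc m) choose Suc m)) = real (2 * ((2 * m + 1) * ((2 * m) choose m)))"
      by presburger
    then show ?thesis unfolding c_def of_nat_mult by simp
  qed
  then have "real (Suc m) ^ 2 * (real ((2 * Suc m) choose Suc m) ^ 2 * real (2 * Suc m + 1)) =
      4 * (c ^ 2 * real (2 * m + 1)) * (real (2 * m + 1) * real (2 * m + 3))"
    by (simp add: power2_eq_square) algebra
  also have "\<dots> \<le> 4 * (4 ^ m) ^ 2 * (real (2 * m + 1) * real (2 * m + 3))"
    using Suc unfolding c_def by (intro mult_right_mono mult_left_mono) auto
  \<comment> \<open>Here (2m + 1)(2m + 3) \<le> 4 (m + 1)^2 is used. The factor 2m + 1 in the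
    statement is chosen so that exactly this closes the induction.\<close>
  also have "\<dots> \<le> 4 * (4 ^ m) ^ 2 * (4 * real (Suc m) ^ 2)"
    by (intro mult_left_mono) (auto simp: power2_eq_square algebra_simps)
  also have "\<dots> = real (Suc m) ^ 2 * (4 ^ Suc m) ^ 2"
    by (simp add: power2_eq_square)
  finally show ?case by (simp del: of_nat_Suc)
qed

lemma middle_binomial_le: "real (n choose (n div 2)) * sqrt (real n) \<le> 2 ^ n"
proof -
  have even: "real ((2 * m) choose m) * sqrt (real (2 * m + 1)) \<le> 4 ^ m" for m
  proof (rule power2_le_imp_le)
    show "(real ((2 * m) choose m) * sqrt (real (2 * m + 1)))\<^sup>2 \<le> (4 ^ m)\<^sup>2"
      using central_binomial_square_le[of m] by (simp add: power_mult_distrib)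
  qed simp
  show ?thesis
  proof (cases "even n")
    case True
    then obtain m where n: "n = 2 * m" by auto
    have "real ((2 * m) choose m) * sqrt (real (2 * m)) \<le> real ((2 * m) choose m) * sqrt (real (2 * m + 1))"
      by (intro mult_left_mono) auto
    also note even[of m]
    finally show ?thesis using n by (simp add: power_mult)
  next
    case False
    then obtain m where n: "n = 2 * m + 1" using oddE by blast
    \<comment> \<open>Odd rows are reduced to the next even row, whose central coefficient is twice
      as large.\<close>
    have "(2 * Suc m) choose Suc m = 2 * ((2 * m + 1) choose m)"
      using binomial_symmetric[of m "2 * m + 1"] by simp
    then have "2 * (real ((2 * m + 1) choose m) * sqrt (real (2 * m + 1))) =
       real ((2 * Suc m) choose Suc m) * sqrt (real (2 * m + 1))" by simp
    also have "\<dots> \<le> real ((2 * Suc m) choose Suc m) * sqrt (real (2 * Suc m + 1))"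
      by (intro mult_left_mono) auto
    also have "\<dots> \<le> 4 ^ Suc m" by (rule even)
    finally show ?thesis using n by (simp add: power_mult)
  qed
qed

text \<open>The counts become probabilities for independent uniform summands. The first digit
  contributes the mass of a middle binomial coefficient, at most \<open>1 / sqrt n\<close>, and each
  of the \<open>k\<close> doublings saves a factor 2 against the growth of the number of all
  vectors.\<close>

lemma weighted_solutions_atom_le:
  fixes h :: "'i \<Rightarrow> int"
  assumes I: "finite I" "I \<noteq> {}" and h: "\<And>i. i \<in> I \<Longrightarrow> h i \<in> {-1, 1}"
  shows "real (card (weighted_solutions I h (2 ^ Suc k) z)) / (2 ^ Suc k) ^ card I
    \<le> 1 / (2 ^ k * sqrt (card I))"
proof -
  define n where "n = card I"
  define c where "c = real (n choose (n div 2))"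
  have n: "n > 0" unfolding n_def using I by (simp add: card_gt_0_iff)
  have "real (card (weighted_solutions I h (2 ^ Suc k) z)) \<le> (2 ^ (n - 1)) ^ k * c"
    using card_weighted_solutions_power[OF I, of h k z] h unfolding n_def c_def
    by (metis (mono_tags, lifting) of_nat_le_iff of_nat_mult of_nat_numeral of_nat_power)
  moreover have "c \<le> 2 ^ n / sqrt n"
    using middle_binomial_le[of n] n unfolding c_def by (simp add: field_simps)
  ultimately have "real (card (weighted_solutions I h (2 ^ Suc k) z)) \<le> (2 ^ (n - 1)) ^ k * (2 ^ n / sqrt n)"
    by (meson order_trans mult_left_mono zero_le_power zero_le_numeral)
  then have "real (card (weighted_solutions I h (2 ^ Suc k) z)) / (2 ^ Suc k) ^ n
    \<le> (2 ^ (n - 1)) ^ k * (2 ^ n / sqrt n) / (2 ^ Suc k) ^ n"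
    by (rule divide_right_mono) simp
  also have "\<dots> = 1 / (2 ^ k * sqrt n)"
  proof -
    have a: "((2::real) ^ Suc k) ^ n = (2 ^ (n - 1)) ^ k * 2 ^ k * 2 ^ n"
    proof -
      have "Suc k * n = (n - 1) * k + k + n" using n by (cases n) auto
      then show ?thesis by (simp only: power_mult[symmetric] power_add[symmetric])
    qed
    show ?thesis unfolding a by (simp add: field_simps)
  qed
  finally show ?thesis unfolding n_def .
qed


section \<open>Truncated node values\<close>

context bit_exchange
begin

definition trunc :: "nat \<Rightarrow> nat \<Rightarrow> 'a \<Rightarrow> int" where
  "trunc k i \<omega> = \<lfloor>2 ^ k * X i \<omega>\<rfloor>"

text \<open>The subtracted constant is the mean of the truncated value: truncation to the grid of
  step \<open>1 / 2 ^ k\<close> lowers the mean 1/2 by half a step.\<close>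

definition centred :: "nat \<Rightarrow> nat \<Rightarrow> 'a \<Rightarrow> real" where
  "centred k i \<omega> = of_int (h i) * (of_int (trunc k i \<omega>) / 2 ^ k - (1 - 1 / 2 ^ k) / 2)"

definition noise :: "nat \<Rightarrow> 'a \<Rightarrow> real" where
  "noise k \<omega> = (\<Sum>i=1..n. centred k i \<omega>)"

lemma X_measurable [measurable]: "i \<in> {1..n} \<Longrightarrow> X i \<in> borel_measurable M"
  using indep unfolding indep_vars_def by simp

lemma trunc_measurable [measurable]: "i \<in> {1..n} \<Longrightarrow> trunc k i \<in> measurable M (count_space UNIV)"
  unfolding trunc_def by measurable

lemma AE_X_range: "AE \<omega> in M. \<forall>i\<in>{1..n}. 0 \<le> X i \<omega> \<and> X i \<omega> < 1"
proof (rule AE_finite_allI)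
  fix i assume i: "i \<in> {1..n}"
  have "AE x in uniform_measure lborel {0..<1::real}. x \<in> {0..<1}"
    by (rule AE_uniform_measureI) auto
  then have "AE x in distr M borel (X i). x \<in> {0..<1}" by (simp only: uniform[OF i])
  then show "AE \<omega> in M. 0 \<le> X i \<omega> \<and> X i \<omega> < 1"
    using i by (subst (asm) AE_distr_iff) auto
qed simp

lemma AE_valid_input: "AE \<omega> in M. valid_input n h (\<lambda>i. X i \<omega>)"
  using AE_X_range weights unfolding valid_input_def by auto

lemma prob_trunc_eq:
  assumes i: "i \<in> {1..n}"
  shows "prob {\<omega> \<in> space M. trunc k i \<omega> = d} = (if d \<in> {0..<2 ^ k} then 1 / 2 ^ k else 0)"
proof -
  define A where "A = {x::real. \<lfloor>2 ^ k * x\<rfloor> = d}"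
  have A: "A = {of_int d / 2 ^ k ..< (of_int d + 1) / 2 ^ k}"
    unfolding A_def by (auto simp: floor_eq_iff field_simps)
  have Ab [measurable]: "A \<in> sets borel" unfolding A by simp
  have "prob {\<omega> \<in> space M. trunc k i \<omega> = d} = measure (distr M borel (X i)) A"
    using i by (subst measure_distr) (auto simp: A_def trunc_def intro!: arg_cong[where f=prob])
  also have "\<dots> = measure (uniform_measure lborel {0..<1::real}) A" using uniform[OF i] by simp
  also have "\<dots> = measure lborel ({0..<1} \<inter> A)"
    by (subst measure_uniform_measure) auto
  also have "\<dots> = (if d \<in> {0..<2 ^ k} then 1 / 2 ^ k else 0)"
  proof (cases "d \<in> {0..<2 ^ k}")
    case True
    then have "0 \<le> d" "d + 1 \<le> 2 ^ k" by auto
    then have "real_of_int 0 \<le> real_of_int d" "real_of_int (d + 1) \<le> real_of_int (2 ^ k)"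
      by (simp_all only: of_int_le_iff)
    then have "0 \<le> real_of_int d / 2 ^ k" "(of_int d + 1) / (2 ^ k :: real) \<le> 1" by simp_all
    then have IA: "{0..<1} \<inter> A = {of_int d / 2 ^ k ..< (of_int d + 1) / 2 ^ k}"
      unfolding A by auto
    have "real_of_int d / 2 ^ k \<le> (of_int d + 1) / 2 ^ k" by (rule divide_right_mono) auto
    then have "measure lborel ({0..<1} \<inter> A) = (of_int d + 1) / 2 ^ k - of_int d / 2 ^ k"
      unfolding IA by (rule measure_lborel_Ico)
    then show ?thesis using True by (simp add: add_divide_distrib)
  next
    case False
    have "{0..<1} \<inter> A = {}"
    proof safe
      fix x :: real assume x: "x \<in> {0..<1}" "x \<in> A"
      then have "0 \<le> 2 ^ k * x" "2 ^ k * x < 2 ^ k" by auto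
      then have "0 \<le> \<lfloor>2 ^ k * x\<rfloor>" "\<lfloor>2 ^ k * x\<rfloor> < 2 ^ k" by (auto simp: floor_less_iff)
      then show "x \<in> {}" using x False unfolding A_def by auto
    qed
    then show ?thesis using False by auto
  qed
  finally show ?thesis .
qed

lemma distr_trunc:
  assumes i: "i \<in> {1..n}"
  shows "distr M (count_space UNIV) (trunc k i) = measure_pmf (pmf_of_set {0..<2 ^ k})"
proof (rule measure_eqI_countable[where A=UNIV])
  fix d :: int
  have "emeasure (distr M (count_space UNIV) (trunc k i)) {d} = prob {\<omega> \<in> space M. trunc k i \<omega> = d}"
    using i by (subst emeasure_distr) (auto simp: emeasure_eq_measure intro!: arg_cong[where f=prob])
  also have "\<dots> = emeasure (measure_pmf (pmf_of_set {0..<2 ^ k})) {d}"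
    unfolding prob_trunc_eq[OF i] emeasure_pmf_single by (simp add: indicator_def)
  finally show "emeasure (distr M (count_space UNIV) (trunc k i)) {d} =
    emeasure (measure_pmf (pmf_of_set {0..<2 ^ k})) {d}" .
qed auto

lemma expectation_trunc:
  fixes g :: "int \<Rightarrow> real"
  assumes i: "i \<in> {1..n}"
  shows "integrable M (\<lambda>\<omega>. g (trunc k i \<omega>))"
    and "expectation (\<lambda>\<omega>. g (trunc k i \<omega>)) = (\<Sum>d=0..<2 ^ k. g d) / 2 ^ k"
proof -
  have "integrable (measure_pmf (pmf_of_set {0..<2 ^ k :: int})) g"
    by (rule integrable_measure_pmf_finite) simp
  then have "integrable (distr M (count_space UNIV) (trunc k i)) g" unfolding distr_trunc[OF i] .
  then show "integrable M (\<lambda>\<omega>. g (trunc k i \<omega>))" using i by (subst (asm) integrable_distr_eq) auto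
  have "expectation (\<lambda>\<omega>. g (trunc k i \<omega>)) = integral\<^sup>L (distr M (count_space UNIV) (trunc k i)) g"
    using i by (subst integral_distr) auto
  also have "\<dots> = (\<Sum>d=0..<2 ^ k. g d) / 2 ^ k"
    unfolding distr_trunc[OF i] by (subst integral_pmf_of_set) auto
  finally show "expectation (\<lambda>\<omega>. g (trunc k i \<omega>)) = (\<Sum>d=0..<2 ^ k. g d) / 2 ^ k" .
qed

end

section \<open>Moments and independence of the centred summands\<close>

lemma sum_centred_int:
  "(\<Sum>d=0..<int N. real_of_int d - (real N - 1) / 2) = 0"
proof -
  have "(\<Sum>d=0..<int N. real_of_int d - (real N - 1) / 2) = (\<Sum>d<N. real d - (real N - 1) / 2)"
    by (rule sum.reindex_bij_witness[of _ int nat]) auto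
  \<comment> \<open>The centre is freed to a constant \<open>c\<close>, since the actual centre
    depends on the upper limit and would move during the induction.\<close>
  also have "(\<Sum>d<M. real d - c) = real M * (real M - 1) / 2 - real M * c" for M c
    by (induction M) (auto simp: field_simps)
  finally show ?thesis by simp
qed

lemma sum_centred_int_sq:
  "(\<Sum>d=0..<int N. (real_of_int d - (real N - 1) / 2)\<^sup>2) = real N * (real N ^ 2 - 1) / 12"
proof -
  have "(\<Sum>d=0..<int N. (real_of_int d - (real N - 1) / 2)\<^sup>2) = (\<Sum>d<N. (real d - (real N - 1) / 2)\<^sup>2)"
    by (rule sum.reindex_bij_witness[of _ int nat]) auto
  also have "(\<Sum>d<M. (real d - c)\<^sup>2) =
      real M * (real M - 1) * (2 * real M - 1) / 6 - c * (real M * (real M - 1)) + real M * c\<^sup>2" for M c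
    by (induction M) (auto simp: field_simps power2_eq_square)
  also have "real N * (real N - 1) * (2 * real N - 1) / 6 - (real N - 1) / 2 * (real N * (real N - 1))
      + real N * ((real N - 1) / 2)\<^sup>2 = real N * (real N ^ 2 - 1) / 12"
    by (simp add: field_simps power2_eq_square)
  finally show ?thesis .
qed

context bit_exchange
begin

lemma centred_eq:
  "centred k i \<omega> = of_int (h i) / 2 ^ k * (of_int (trunc k i \<omega>) - (2 ^ k - 1) / 2)"
  unfolding centred_def by (simp add: field_simps)

lemma weight_sq: "i \<in> {1..n} \<Longrightarrow> (real_of_int (h i))\<^sup>2 = 1" "i \<in> {1..n} \<Longrightarrow> \<bar>real_of_int (h i)\<bar> = 1"
  using weights[of i] by auto

text \<open>With N = 2 ^ k equally likely values the variance is (N^2 - 1)/12 in grid units, and the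
  grid step is 1/N. So \<open>sigma n k\<close> is the exact standard deviation of the noise in
  round \<open>k\<close>, not only its limit.\<close>

lemma centred_moments:
  assumes i: "i \<in> {1..n}"
  shows "integrable M (centred k i)" "expectation (centred k i) = 0"
    and "integrable M (\<lambda>\<omega>. (centred k i \<omega>)\<^sup>2)"
    and "expectation (\<lambda>\<omega>. (centred k i \<omega>)\<^sup>2) = (1 - 1 / 4 ^ k) / 12"
proof -
  note E1 = expectation_trunc[OF i, of "\<lambda>d. of_int (h i) / 2 ^ k * (of_int d - (2 ^ k - 1) / 2)" k]
  note E2 = expectation_trunc[OF i, of "\<lambda>d. (of_int (h i) / 2 ^ k * (of_int d - (2 ^ k - 1) / 2))\<^sup>2" k]
  show "integrable M (centred k i)" "integrable M (\<lambda>\<omega>. (centred k i \<omega>)\<^sup>2)"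
    using E1(1) E2(1) by (simp_all add: centred_eq[abs_def])
  show "expectation (centred k i) = 0"
    unfolding centred_eq[abs_def] E1(2) sum_distrib_left[symmetric]
    using sum_centred_int[of "2 ^ k"] by simp
  have q: "(\<Sum>d=0..<2 ^ k. (real_of_int d - (2 ^ k - 1) / 2)\<^sup>2) = 2 ^ k * ((2 ^ k)\<^sup>2 - 1) / 12"
    using sum_centred_int_sq[of "2 ^ k"] by simp
  have "expectation (\<lambda>\<omega>. (centred k i \<omega>)\<^sup>2) = (2 ^ k * ((2 ^ k)\<^sup>2 - 1) / 12) * (1 / (2 ^ k)\<^sup>2) / 2 ^ k"
    unfolding centred_eq[abs_def] E2(2)
    unfolding power_mult_distrib sum_distrib_left[symmetric] power_divide q weight_sq(1)[OF i] by simp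
  also have "\<dots> = (1 - 1 / (2 ^ k)\<^sup>2) / 12"
    by (simp add: field_simps)
  also have "((2::real) ^ k)\<^sup>2 = 4 ^ k" by (simp add: power2_eq_square power_mult_distrib[symmetric])
  finally show "expectation (\<lambda>\<omega>. (centred k i \<omega>)\<^sup>2) = (1 - 1 / 4 ^ k) / 12" .
qed

lemma centred_measurable [measurable]: "i \<in> {1..n} \<Longrightarrow> centred k i \<in> borel_measurable M"
  using centred_moments(1) by (rule borel_measurable_integrable)

lemma noise_measurable [measurable]: "noise k \<in> borel_measurable M"
  unfolding noise_def by measurable

text \<open>The bound is the same for all rounds. It later controls the third moments uniformly in
  \<open>k\<close>.\<close>

lemma AE_centred_bound: "i \<in> {1..n} \<Longrightarrow> AE \<omega> in M. \<bar>centred k i \<omega>\<bar> \<le> 1 / 2"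
proof -
  assume i: "i \<in> {1..n}"
  have "AE \<omega> in M. 0 \<le> X i \<omega> \<and> X i \<omega> < 1" using AE_X_range i by auto
  then show "AE \<omega> in M. \<bar>centred k i \<omega>\<bar> \<le> 1 / 2"
  proof eventually_elim
    fix \<omega> assume "0 \<le> X i \<omega> \<and> X i \<omega> < 1"
    then have "0 \<le> 2 ^ k * X i \<omega>" "2 ^ k * X i \<omega> < 2 ^ k" by auto
    then have "0 \<le> trunc k i \<omega>" "trunc k i \<omega> < 2 ^ k" unfolding trunc_def by (auto simp: floor_less_iff)
    then have "0 \<le> trunc k i \<omega>" "trunc k i \<omega> + 1 \<le> 2 ^ k" by auto
    then have "real_of_int 0 \<le> real_of_int (trunc k i \<omega>)"
      "real_of_int (trunc k i \<omega> + 1) \<le> real_of_int (2 ^ k)"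
      by (simp_all only: of_int_le_iff)
    then have "\<bar>real_of_int (trunc k i \<omega>) - (2 ^ k - 1) / 2\<bar> \<le> 2 ^ k / 2" by (simp add: abs_le_iff field_simps)
    then have "\<bar>real_of_int (trunc k i \<omega>) - (2 ^ k - 1) / 2\<bar> / 2 ^ k \<le> 1 / 2"
      by (simp add: divide_le_eq)
    then show "\<bar>centred k i \<omega>\<bar> \<le> 1 / 2"
      unfolding centred_eq using weight_sq(2)[OF i] by (simp add: abs_mult)
  qed
qed

lemma indep_trunc: "indep_vars (\<lambda>_. count_space UNIV) (trunc k) {1..n}"
  unfolding trunc_def by (rule indep_vars_compose2[OF indep]) simp

lemma indep_centred: "indep_vars (\<lambda>_. borel) (centred k) {1..n}"
  unfolding centred_def by (rule indep_vars_compose2[OF indep_trunc]) simp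

lemma noise_moments:
  shows "integrable M (noise k)" "expectation (noise k) = 0"
    and "integrable M (\<lambda>\<omega>. (noise k \<omega>)\<^sup>2)" 
    and "expectation (\<lambda>\<omega>. (noise k \<omega>)\<^sup>2) = (sigma n k)\<^sup>2"
proof -
  show "integrable M (noise k)" unfolding noise_def using centred_moments by auto
  show "expectation (noise k) = 0" unfolding noise_def using centred_moments by (subst Bochner_Integration.integral_sum) auto
  have cross: "integrable M (\<lambda>\<omega>. centred k i \<omega> * centred k j \<omega>) \<and>
      expectation (\<lambda>\<omega>. centred k i \<omega> * centred k j \<omega>) = (if i = j then (1 - 1 / 4 ^ k) / 12 else 0)"
    if ij: "i \<in> {1..n}" "j \<in> {1..n}" for i j
  proof (cases "i = j")
    case True
    then show ?thesis using centred_moments[OF ij(1), of k] by (simp add: power2_eq_square)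
  next
    case False
    \<comment> \<open>Independence of a pair is obtained by taking a one-element block as the second
      sum.\<close>
    have "indep_var borel (centred k i) borel (\<lambda>\<omega>. \<Sum>l\<in>{j}. centred k l \<omega>)"
      by (rule indep_vars_sum) (use False ij in \<open>auto intro: indep_vars_subset[OF indep_centred]\<close>)
    then have "indep_var borel (centred k i) borel (centred k j)" by simp
    then show ?thesis
      using indep_var_integrable[of "centred k i" "centred k j"] indep_var_lebesgue_integral[of "centred k i" "centred k j"]
        centred_moments[OF ij(1), of k] centred_moments[OF ij(2), of k] False by auto
  qed
  have sq: "(noise k \<omega>)\<^sup>2 = (\<Sum>i=1..n. \<Sum>j=1..n. centred k i \<omega> * centred k j \<omega>)" for \<omega>
    unfolding noise_def power2_eq_square by (simp add: sum_product)
  show "integrable M (\<lambda>\<omega>. (noise k \<omega>)\<^sup>2)" unfolding sq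
    by (intro Bochner_Integration.integrable_sum conjunct1[OF cross])
  have "expectation (\<lambda>\<omega>. (noise k \<omega>)\<^sup>2) = (\<Sum>i=1..n. \<Sum>j=1..n. if i = j then (1 - 1 / 4 ^ k) / 12 else 0)"
    unfolding sq using cross by (subst Bochner_Integration.integral_sum, force)+ (intro sum.cong, auto)
  also have "\<dots> = (sigma n k)\<^sup>2"
    by (simp add: sum.delta sigma_def)
  finally show "expectation (\<lambda>\<omega>. (noise k \<omega>)\<^sup>2) = (sigma n k)\<^sup>2" .
qed

end


text \<open>Strict inequalities at both ends matter: a closed interval of length \<open>N\<close>
  can contain \<open>N + 1\<close> integers.\<close>

lemma card_int_open_interval:
  fixes u :: real
  shows "finite {z::int. u < of_int z \<and> of_int z < u + of_nat N}"
    and "card {z::int. u < of_int z \<and> of_int z < u + of_nat N} \<le> N"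
proof -
  have eq: "{z::int. u < of_int z \<and> of_int z < u + of_nat N} = {\<lfloor>u\<rfloor> + 1 .. \<lceil>u + of_nat N\<rceil> - 1}"
    by (auto simp: floor_less_iff less_ceiling_iff) linarith+
  show "finite {z::int. u < of_int z \<and> of_int z < u + of_nat N}" unfolding eq by simp
  have "\<lceil>u + of_nat N\<rceil> = \<lceil>u\<rceil> + int N" by (metis ceiling_add_of_int of_int_of_nat_eq)
  moreover have "\<lceil>u\<rceil> - \<lfloor>u\<rfloor> \<le> 1" by linarith
  ultimately show "card {z::int. u < of_int z \<and> of_int z < u + of_nat N} \<le> N" unfolding eq by simp
qed

lemma sigma_sq: "(sigma n k)\<^sup>2 = real n * (1 - 1 / 4 ^ k) / 12"
  unfolding sigma_def by (rule real_sqrt_pow2) simp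

lemma sigma_sq_le: "(sigma n k)\<^sup>2 \<le> real n / 12"
  unfolding sigma_sq by (intro divide_right_mono mult_left_le) auto

section \<open>The stopping event in terms of the centred sum\<close>

context bit_exchange
begin

lemma n_pos: "n > 0"
  using n_ge_2 by simp

text \<open>This is \<gamma>, with \<alpha> = a / n and \<beta> = m / n.\<close>

definition offset :: "real \<Rightarrow> real" where
  "offset a = a / real n + (1 / 2 - real (num_pos n h) / real n)"

lemma sum_weights: "(\<Sum>i=1..n. real_of_int (h i)) = 2 * real (num_pos n h) - real n"
proof -
  have "(\<Sum>i\<in>pos_nodes n h. 1) - (\<Sum>i\<in>neg_nodes n h. 1) = (\<Sum>i=1..n. real_of_int (h i) * 1)"
    by (rule sum_weights_split) (rule weights)
  moreover have "card (pos_nodes n h) + card (neg_nodes n h) = n"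
    by (rule card_pos_neg_nodes) (rule weights)
  ultimately show ?thesis by (simp add: num_pos_def)
qed

lemma noise_eq:
  "noise k \<omega> = (\<Sum>i=1..n. of_int (h i) * (of_int (trunc k i \<omega>) / 2 ^ k))
     - (2 * real (num_pos n h) - real n) * ((1 - 1 / 2 ^ k) / 2)"
  unfolding noise_def centred_def right_diff_distrib sum_subtractf sum_weights[symmetric]
    sum_distrib_right[symmetric] ..

text \<open>The midpoint of (L, U) is a + (n/2 - m) / 2^k and the mean of Z is (m - n/2)(1 - 1/2^k).
  Both move with \<open>k\<close>, but their difference is the constant \<open>offset a * n\<close>.
  Hence only the width of the interval shrinks.\<close>

lemma between_iff:
  assumes "valid_input n h (\<lambda>i. X i \<omega>)"
  shows "lower_L n h a k < partial_Z n h (\<lambda>i. X i \<omega>) k \<and> partial_Z n h (\<lambda>i. X i \<omega>) k < upper_U n h a k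
    \<longleftrightarrow> (offset a - 1 / 2 ^ (k + 1)) * n < noise k \<omega> \<and> noise k \<omega> < (offset a + 1 / 2 ^ (k + 1)) * n"
proof -
  have Z: "partial_Z n h (\<lambda>i. X i \<omega>) k = noise k \<omega> + (2 * real (num_pos n h) - real n) * ((1 - 1 / 2 ^ k) / 2)"
    unfolding partial_Z_eq_sum_floor[OF assms] noise_eq trunc_def by simp
  have o: "offset a * n = a + n / 2 - num_pos n h"
    using n_pos by (simp add: offset_def field_simps)
  define r where "r = 1 / (2 ^ k :: real)"
  have d: "x / 2 ^ k = x * r" "1 / 2 ^ (k + 1) = r / 2" for x :: real by (simp_all add: r_def)
  have L: "lower_L n h a k = (offset a - r / 2) * n + (2 * real (num_pos n h) - real n) * ((1 - r) / 2)"
    unfolding lower_L_def left_diff_distrib[of "offset a"] o d by (simp add: algebra_simps add_divide_distrib diff_divide_distrib)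
  have U: "upper_U n h a k = (offset a + r / 2) * n + (2 * real (num_pos n h) - real n) * ((1 - r) / 2)"
    unfolding upper_U_def distrib_right[of "offset a"] o d by (simp add: algebra_simps add_divide_distrib diff_divide_distrib)
  show ?thesis unfolding Z L U d by auto
qed

lemma not_stops_at_iff:
  "\<not> stops_at n h a x k \<longleftrightarrow> lower_L n h a k < partial_Z n h x k \<and> partial_Z n h x k < upper_U n h a k"
  unfolding stops_at_def by auto

lemma bin_rem_measurable [measurable]: "(\<lambda>x. bin_rem x j) \<in> borel_measurable borel"
proof (induction j)
  case 0
  then show ?case by simp
next
  case (Suc j)
  then show ?case by (cases j) simp_all
qed

lemma bin_digit_measurable [measurable]: "(\<lambda>x. bin_digit x j) \<in> measurable borel (count_space UNIV)"
  unfolding bin_digit_def by measurable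

lemma partial_Z_measurable [measurable]: "(\<lambda>\<omega>. partial_Z n h (\<lambda>i. X i \<omega>) j) \<in> borel_measurable M"
proof -
  have [measurable]: "i \<in> pos_nodes n h \<Longrightarrow> X i \<in> borel_measurable M"
    "i \<in> neg_nodes n h \<Longrightarrow> X i \<in> borel_measurable M" for i
    by (auto simp: pos_nodes_def neg_nodes_def)
  show ?thesis unfolding partial_Z_def round_sum_def of_int_diff of_int_sum by measurable
qed

lemma prob_between_eq:
  "prob_between M n X h a k = prob {\<omega> \<in> space M.
     (offset a - 1 / 2 ^ (k + 1)) * n < noise k \<omega> \<and> noise k \<omega> < (offset a + 1 / 2 ^ (k + 1)) * n}"
  unfolding prob_between_def
proof (rule finite_measure_eq_AE)
  show "AE \<omega> in M. \<omega> \<in> {\<omega> \<in> space M. lower_L n h a k < partial_Z n h (\<lambda>i. X i \<omega>) k \<and>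
      partial_Z n h (\<lambda>i. X i \<omega>) k < upper_U n h a k} \<longleftrightarrow> \<omega> \<in> {\<omega> \<in> space M.
      (offset a - 1 / 2 ^ (k + 1)) * n < noise k \<omega> \<and> noise k \<omega> < (offset a + 1 / 2 ^ (k + 1)) * n}"
    using AE_valid_input by eventually_elim (simp add: between_iff)
qed measurable

lemma mean_T_eq:
  "mean_T M n X h a = 1 + (\<Sum>k. ennreal (prob_between M n X h a (Suc k)))"
proof -
  define T where "T \<omega> = stopping_T n h a (\<lambda>i. X i \<omega>)" for \<omega>
  have stop_meas [measurable]: "Measurable.pred M (\<lambda>\<omega>. stops_at n h a (\<lambda>i. X i \<omega>) j)" for j
    unfolding stops_at_def by measurable
  have less_meas [measurable]: "Measurable.pred M (\<lambda>\<omega>. enat k < T \<omega>)" for k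
    unfolding T_def less_stopping_T_iff by measurable
  have "T \<in> measurable M (count_space UNIV)"
  \<comment> \<open>As \<open>enat\<close> is countable, it suffices to measure the fibres. Each of
    them, including the one over infinity, is described by the events
    \<open>enat k < T \<omega>\<close>.\<close>
  proof (rule measurable_count_space_eq2_countable[THEN iffD2])
    have "T -` {t} \<inter> space M \<in> sets M" for t
    proof (cases t)
      case (enat m)
      have "T -` {t} \<inter> space M = {\<omega> \<in> space M. \<not> enat m < T \<omega> \<and> (\<forall>k\<in>{..<m}. enat k < T \<omega>)}"
      proof -
        have "T \<omega> = enat m \<longleftrightarrow> \<not> enat m < T \<omega> \<and> (\<forall>k<m. enat k < T \<omega>)" for \<omega>
          by (cases "T \<omega>") (auto simp: not_less, metis le_eq_less_or_eq not_less)
        then show ?thesis by (auto simp: enat)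
      qed
      then show ?thesis by simp
    next
      case infinity
      have "T -` {t} \<inter> space M = {\<omega> \<in> space M. \<forall>k. enat k < T \<omega>}"
      proof -
        have "T \<omega> = \<infinity> \<longleftrightarrow> (\<forall>k. enat k < T \<omega>)" for \<omega> by (cases "T \<omega>") auto
        then show ?thesis by (auto simp: infinity)
      qed
      then show ?thesis by simp
    qed
    then show "T \<in> space M \<rightarrow> UNIV \<and> (\<forall>a\<in>UNIV. T -` {a} \<inter> space M \<in> sets M)" by simp
  qed
  then have "mean_T M n X h a = (\<Sum>k. emeasure M {\<omega> \<in> space M. enat k < T \<omega>})"
    unfolding mean_T_def T_def[symmetric] by (rule nn_integral_enat_function)
  also have "\<dots> = (\<Sum>k. if k = 0 then 1 else ennreal (prob_between M n X h a k))"
  proof (rule suminf_cong)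
    fix k
    show "emeasure M {\<omega> \<in> space M. enat k < T \<omega>} = (if k = 0 then 1 else ennreal (prob_between M n X h a k))"
    proof (cases "k = 0")
      case True
      \<comment> \<open>Rounds start at 1, so \<open>T\<close> exceeds 0 with certainty. This tail
        is the summand 1 of the formula and is not a value of \<open>prob_between\<close>.\<close>
      have "enat 0 < T \<omega>" for \<omega> unfolding T_def less_stopping_T_iff by simp
      then show ?thesis using True emeasure_space_1 by simp
    next
      case False
      have "emeasure M {\<omega> \<in> space M. enat k < T \<omega>} = emeasure M {\<omega> \<in> space M.
         lower_L n h a k < partial_Z n h (\<lambda>i. X i \<omega>) k \<and> partial_Z n h (\<lambda>i. X i \<omega>) k < upper_U n h a k}"
      proof (rule emeasure_eq_AE)
        show "AE \<omega> in M. \<omega> \<in> {\<omega> \<in> space M. enat k < T \<omega>} \<longleftrightarrow> \<omega> \<in> {\<omega> \<in> space M.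
           lower_L n h a k < partial_Z n h (\<lambda>i. X i \<omega>) k \<and> partial_Z n h (\<lambda>i. X i \<omega>) k < upper_U n h a k}"
          using AE_valid_input
          by eventually_elim (use False in \<open>auto simp: T_def less_stopping_T_iff_valid not_stops_at_iff\<close>)
      qed measurable
      then show ?thesis using False by (simp add: prob_between_def emeasure_eq_measure)
    qed
  qed
  also have "\<dots> = 1 + (\<Sum>k. ennreal (prob_between M n X h a (Suc k)))"
    using suminf_offset[of "\<lambda>k. if k = 0 then 1 else ennreal (prob_between M n X h a k)" 1] by simp
  finally show ?thesis .
qed

section \<open>Concentration and Chebyshev bounds\<close>

lemma weighted_trunc_event [measurable]:
  "{\<omega> \<in> space M. (\<Sum>i=1..n. h i * trunc k i \<omega>) = z} \<in> sets M"
proof -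
  have "{\<omega> \<in> space M. (\<Sum>i=1..n. h i * trunc k i \<omega>) = z} =
      {\<omega> \<in> space M. (\<Sum>i=1..n. real_of_int (h i) * real_of_int (trunc k i \<omega>)) = of_int z}"
    by (simp only: of_int_mult[symmetric] of_int_sum[symmetric] of_int_eq_iff)
  also have "\<dots> \<in> sets M" by measurable
  finally show ?thesis .
qed

lemma prob_atom_le:
  "prob {\<omega> \<in> space M. (\<Sum>i=1..n. h i * trunc (Suc k) i \<omega>) = z} \<le> 1 / (2 ^ k * sqrt n)"
proof -
  define N :: int where "N = 2 ^ Suc k"
  define S where "S = weighted_solutions {1..n} h N z"
  define A where "A d = (\<Inter>i\<in>{1..n}. trunc (Suc k) i -` {d i} \<inter> space M)" for d :: "nat \<Rightarrow> int"
  have finS: "finite S" unfolding S_def by (simp add: finite_weighted_solutions)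
  have ne: "{1..n} \<noteq> {}" using n_pos by simp
  have A_meas [measurable]: "A d \<in> sets M" for d
    unfolding A_def using ne by (intro sets.finite_INT) (auto intro!: measurable_sets[OF trunc_measurable])
  have A: "prob (A d) = 1 / (2 ^ Suc k) ^ n" if "d \<in> S" for d
  proof -
    have "prob (A d) = (\<Prod>i\<in>{1..n}. prob (trunc (Suc k) i -` {d i} \<inter> space M))"
      unfolding A_def by (rule indep_varsD_finite[OF indep_trunc ne]) auto
    also have "\<dots> = (\<Prod>i\<in>{1..n}. 1 / 2 ^ Suc k)"
    proof (rule prod.cong[OF refl])
      fix i assume i: "i \<in> {1..n}"
      have "trunc (Suc k) i -` {d i} \<inter> space M = {\<omega> \<in> space M. trunc (Suc k) i \<omega> = d i}" by auto
      moreover have "d i \<in> {0..<2 ^ Suc k}"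
        using that i unfolding S_def weighted_solutions_def N_def by auto
      ultimately show "prob (trunc (Suc k) i -` {d i} \<inter> space M) = 1 / 2 ^ Suc k"
        using prob_trunc_eq[OF i, of "Suc k" "d i"] by presburger
    qed
    finally show ?thesis by (simp add: power_one_over)
  qed
  \<comment> \<open>The events agree only almost surely, because the truncated values can leave
    \<open>{0..<N}\<close> on a null set.\<close>
  have "prob {\<omega> \<in> space M. (\<Sum>i=1..n. h i * trunc (Suc k) i \<omega>) = z} = prob (\<Union>d\<in>S. A d)"
  proof (rule finite_measure_eq_AE)
    show "AE \<omega> in M. \<omega> \<in> {\<omega> \<in> space M. (\<Sum>i=1..n. h i * trunc (Suc k) i \<omega>) = z} \<longleftrightarrow> \<omega> \<in> (\<Union>d\<in>S. A d)"
      using AE_X_range AE_space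
    proof eventually_elim
      fix \<omega> assume X: "\<forall>i\<in>{1..n}. 0 \<le> X i \<omega> \<and> X i \<omega> < 1" and sp: "\<omega> \<in> space M"
      have r: "trunc (Suc k) i \<omega> \<in> {0..<N}" if "i \<in> {1..n}" for i
      proof -
        have "0 \<le> 2 ^ Suc k * X i \<omega>" "2 ^ Suc k * X i \<omega> < 2 ^ Suc k" using X that by auto
        then show ?thesis unfolding trunc_def N_def by (auto simp: floor_less_iff)
      qed
      show "\<omega> \<in> {\<omega> \<in> space M. (\<Sum>i=1..n. h i * trunc (Suc k) i \<omega>) = z} \<longleftrightarrow> \<omega> \<in> (\<Union>d\<in>S. A d)"
      proof
        assume z: "\<omega> \<in> {\<omega> \<in> space M. (\<Sum>i=1..n. h i * trunc (Suc k) i \<omega>) = z}"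
        define d where "d = restrict (\<lambda>i. trunc (Suc k) i \<omega>) {1..n}"
        have "(\<Sum>i=1..n. h i * d i) = (\<Sum>i=1..n. h i * trunc (Suc k) i \<omega>)"
          unfolding d_def by (intro sum.cong) auto
        then have "d \<in> S" using r z unfolding S_def weighted_solutions_def by (auto simp: d_def)
        moreover have "\<omega> \<in> A d" using sp ne unfolding A_def d_def by auto
        ultimately show "\<omega> \<in> (\<Union>d\<in>S. A d)" by blast
      next
        assume "\<omega> \<in> (\<Union>d\<in>S. A d)"
        then obtain d where d: "d \<in> S" "\<omega> \<in> A d" by blast
        have "(\<Sum>i=1..n. h i * trunc (Suc k) i \<omega>) = (\<Sum>i=1..n. h i * d i)"
          using d(2) unfolding A_def by (intro sum.cong) auto
        then show "\<omega> \<in> {\<omega> \<in> space M. (\<Sum>i=1..n. h i * trunc (Suc k) i \<omega>) = z}"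
          using d(1) sp unfolding S_def weighted_solutions_def by simp
      qed
    qed
  qed (use finS weighted_trunc_event in auto)
  also have "\<dots> \<le> (\<Sum>d\<in>S. prob (A d))"
    using finS by (intro finite_measure_subadditive_finite) auto
  also have "\<dots> = real (card S) / (2 ^ Suc k) ^ n" using A by simp
  also have "\<dots> \<le> 1 / (2 ^ k * sqrt n)"
    using weighted_solutions_atom_le[of "{1..n}" h k z] ne weights unfolding S_def N_def by simp
  finally show ?thesis .
qed

text \<open>In units of \<open>1 / 2 ^ Suc k\<close> the values of Z are integers and the interval
  (L, U) is open of length \<open>n\<close>. It therefore holds at most \<open>n\<close> atoms, each
  of mass at most \<open>1 / (2 ^ k * sqrt n)\<close>.\<close>

lemma prob_between_concentration:
  "prob_between M n X h a (Suc k) \<le> sqrt n / 2 ^ k"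
proof -
  define u where "u = a * 2 ^ Suc k - num_pos n h"
  define Zs where "Zs = {z::int. u < of_int z \<and> of_int z < u + of_nat n}"
  define E where "E z = {\<omega> \<in> space M. (\<Sum>i=1..n. h i * trunc (Suc k) i \<omega>) = z}" for z
  have finZ: "finite Zs" and cZ: "card Zs \<le> n" unfolding Zs_def by (rule card_int_open_interval)+
  have E_meas [measurable]: "E z \<in> sets M" for z unfolding E_def by (rule weighted_trunc_event)
  have "prob_between M n X h a (Suc k) \<le> prob (\<Union>z\<in>Zs. E z)"
    unfolding prob_between_def
  proof (rule finite_measure_mono_AE)
    show "AE \<omega> in M. \<omega> \<in> {\<omega> \<in> space M. lower_L n h a (Suc k) < partial_Z n h (\<lambda>i. X i \<omega>) (Suc k) \<and>
        partial_Z n h (\<lambda>i. X i \<omega>) (Suc k) < upper_U n h a (Suc k)} \<longrightarrow> \<omega> \<in> (\<Union>z\<in>Zs. E z)"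
      using AE_valid_input
    proof eventually_elim
      fix \<omega> assume v: "valid_input n h (\<lambda>i. X i \<omega>)"
      define z where "z = (\<Sum>i=1..n. h i * trunc (Suc k) i \<omega>)"
      have "partial_Z n h (\<lambda>i. X i \<omega>) (Suc k) = of_int z / 2 ^ Suc k"
        unfolding partial_Z_eq_sum_floor[OF v] z_def trunc_def by (simp add: sum_divide_distrib)
      moreover have "lower_L n h a (Suc k) = u / 2 ^ Suc k"
        by (simp add: lower_L_def u_def diff_divide_distrib)
      moreover have "upper_U n h a (Suc k) = (u + real n) / 2 ^ Suc k"
        by (simp add: upper_U_def u_def diff_divide_distrib add_divide_distrib)
      ultimately have "lower_L n h a (Suc k) < partial_Z n h (\<lambda>i. X i \<omega>) (Suc k) \<and>
        partial_Z n h (\<lambda>i. X i \<omega>) (Suc k) < upper_U n h a (Suc k) \<Longrightarrow> z \<in> Zs"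
        by (simp add: Zs_def divide_less_cancel del: power_Suc)
      moreover have "\<omega> \<in> space M \<Longrightarrow> \<omega> \<in> E z" unfolding E_def z_def by simp
      ultimately show "\<omega> \<in> {\<omega> \<in> space M. lower_L n h a (Suc k) < partial_Z n h (\<lambda>i. X i \<omega>) (Suc k) \<and>
        partial_Z n h (\<lambda>i. X i \<omega>) (Suc k) < upper_U n h a (Suc k)} \<longrightarrow> \<omega> \<in> (\<Union>z\<in>Zs. E z)"
        by blast
    qed
  qed (use finZ in auto)
  also have "\<dots> \<le> (\<Sum>z\<in>Zs. prob (E z))"
    using finZ by (intro finite_measure_subadditive_finite) auto
  also have "\<dots> \<le> (\<Sum>z\<in>Zs. 1 / (2 ^ k * sqrt n))"
    unfolding E_def by (intro sum_mono prob_atom_le)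
  also have "\<dots> = real (card Zs) * (1 / (2 ^ k * sqrt n))" by simp
  also have "\<dots> \<le> real n * (1 / (2 ^ k * sqrt n))"
    using cZ by (intro mult_right_mono) auto
  also have "\<dots> = sqrt n / 2 ^ k"
    using n_pos by (simp add: field_simps)
  finally show ?thesis .
qed

lemma noise_chebyshev:
  assumes "t > 0"
  shows "prob {\<omega> \<in> space M. t \<le> \<bar>noise k \<omega>\<bar>} \<le> n / (12 * t\<^sup>2)"
proof -
  have "prob {\<omega> \<in> space M. t \<le> \<bar>noise k \<omega> - expectation (noise k)\<bar>} \<le> variance (noise k) / t\<^sup>2"
    by (rule Chebyshev_inequality) (use noise_moments assms in auto)
  then have "prob {\<omega> \<in> space M. t \<le> \<bar>noise k \<omega>\<bar>} \<le> (sigma n k)\<^sup>2 / t\<^sup>2"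
    using noise_moments[of k] by simp
  also have "\<dots> \<le> (n / 12) / t\<^sup>2"
    using sigma_sq_le by (rule divide_right_mono) simp
  finally show ?thesis by simp
qed

end


section \<open>The central limit theorem, uniformly in the round\<close>

text \<open>Uniform in the round, with equality at \<open>k = 1\<close>, where the variance of one
  summand is 1/16. Round 0 is excluded because \<open>sigma n 0\<close> vanishes.\<close>

lemma sigma_ge:
  assumes "k \<ge> 1"
  shows "sqrt (real n) / 4 \<le> sigma n k"
proof -
  have "(1::real) / 4 ^ k \<le> 1 / 4 ^ 1" using assms by (intro divide_left_mono power_increasing) auto
  then have "real n * (1 / 16) \<le> real n * ((1 - 1 / 4 ^ k) / 12)" by (intro mult_left_mono) auto
  then have "sqrt (real n / 16) \<le> sigma n k" unfolding sigma_def by (intro real_sqrt_le_mono) simp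
  then show ?thesis by (simp add: real_sqrt_divide)
qed

lemma sigma_pos: "n > 0 \<Longrightarrow> k \<ge> 1 \<Longrightarrow> sigma n k > 0"
  using sigma_ge[of k n] by (smt (verit) divide_pos_pos of_nat_0_less_iff real_sqrt_gt_zero)

context bit_exchange
begin

definition scaled_noise :: "nat \<Rightarrow> real measure" where
  "scaled_noise k = distr M borel (\<lambda>\<omega>. noise k \<omega> / sigma n k)"

lemma real_distribution_scaled_noise: "real_distribution (scaled_noise k)"
  unfolding scaled_noise_def by (intro real_distribution_distr) measurable

text \<open>The summand has variance exactly \<open>1 / n\<close> after scaling and is bounded by
  \<open>1 / (2 * sigma n k)\<close>, at most \<open>2 / sqrt n\<close>. So its third absolute
  moment is at most this bound times the variance. Neither the round nor the weights enter the
  resulting error.\<close>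

lemma char_centred_approx:
  assumes i: "i \<in> {1..n}" and k: "k \<ge> 1"
  shows "cmod (char (distr M borel (\<lambda>\<omega>. centred k i \<omega> / sigma n k)) t - complex_of_real (1 + (- (t\<^sup>2 / 2)) / n))
    \<le> \<bar>t\<bar> ^ 3 / (3 * n * sqrt n)"
proof -
  define s where "s = sigma n k"
  define Y where "Y \<omega> = centred k i \<omega> / s" for \<omega>
  have s: "s > 0" "sqrt n / 4 \<le> s" unfolding s_def using sigma_pos[OF n_pos k] sigma_ge[OF k] by auto
  have Ym [measurable]: "Y \<in> borel_measurable M" unfolding Y_def using i by measurable
  note cm = centred_moments[OF i, of k]
  have Y1: "integrable M Y" "expectation Y = 0" unfolding Y_def using cm by auto
  have Y2: "integrable M (\<lambda>\<omega>. (Y \<omega>)\<^sup>2)" unfolding Y_def power_divide using cm by auto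
  have "expectation (\<lambda>\<omega>. (Y \<omega>)\<^sup>2) = (1 - 1 / 4 ^ k) / 12 / s\<^sup>2"
    unfolding Y_def power_divide integral_divide_zero cm(4) ..
  also have "\<dots> = (s\<^sup>2 / n) / s\<^sup>2" unfolding s_def sigma_sq using n_pos by simp
  also have "\<dots> = 1 / n" using s by simp
  finally have var: "expectation (\<lambda>\<omega>. (Y \<omega>)\<^sup>2) = 1 / n" .
  have "cmod (char (distr M borel Y) t - (1 - t\<^sup>2 * (1 / n) / 2)) \<le>
     t\<^sup>2 / 6 * expectation (\<lambda>\<omega>. min (6 * (Y \<omega>)\<^sup>2) (\<bar>t\<bar> * \<bar>Y \<omega>\<bar> ^ 3))"
    using char_approx3'[OF Ym Y1(1) Y2 Y1(2) _ refl, of "1 / n" t] var Y1(2) by simp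
  also have "expectation (\<lambda>\<omega>. min (6 * (Y \<omega>)\<^sup>2) (\<bar>t\<bar> * \<bar>Y \<omega>\<bar> ^ 3)) \<le>
      expectation (\<lambda>\<omega>. \<bar>t\<bar> / (2 * s) * (Y \<omega>)\<^sup>2)"
  proof (rule integral_mono_AE)
    show "integrable M (\<lambda>\<omega>. min (6 * (Y \<omega>)\<^sup>2) (\<bar>t\<bar> * \<bar>Y \<omega>\<bar> ^ 3))"
      by (rule Bochner_Integration.integrable_bound[where f="\<lambda>\<omega>. 6 * (Y \<omega>)\<^sup>2"]) (use Y2 in auto)
    show "integrable M (\<lambda>\<omega>. \<bar>t\<bar> / (2 * s) * (Y \<omega>)\<^sup>2)" using Y2 by simp
    show "AE \<omega> in M. min (6 * (Y \<omega>)\<^sup>2) (\<bar>t\<bar> * \<bar>Y \<omega>\<bar> ^ 3) \<le> \<bar>t\<bar> / (2 * s) * (Y \<omega>)\<^sup>2"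
      using AE_centred_bound[OF i, of k]
    proof eventually_elim
      fix \<omega> assume "\<bar>centred k i \<omega>\<bar> \<le> 1 / 2"
      then have "\<bar>Y \<omega>\<bar> \<le> 1 / (2 * s)" unfolding Y_def using s by (simp add: abs_divide divide_right_mono field_simps)
      then have "\<bar>t\<bar> * (\<bar>Y \<omega>\<bar> * (Y \<omega>)\<^sup>2) \<le> \<bar>t\<bar> * (1 / (2 * s) * (Y \<omega>)\<^sup>2)"
        by (intro mult_left_mono mult_right_mono) auto
      moreover have "\<bar>Y \<omega>\<bar> ^ 3 = \<bar>Y \<omega>\<bar> * (Y \<omega>)\<^sup>2" by (simp add: power3_eq_cube power2_eq_square)
      ultimately show "min (6 * (Y \<omega>)\<^sup>2) (\<bar>t\<bar> * \<bar>Y \<omega>\<bar> ^ 3) \<le> \<bar>t\<bar> / (2 * s) * (Y \<omega>)\<^sup>2"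
        by (simp add: min_le_iff_disj)
    qed
  qed
  also have "\<dots> = \<bar>t\<bar> / (2 * s) * (1 / n)" using var by simp
  also have "\<dots> \<le> \<bar>t\<bar> / (2 * (sqrt n / 4)) * (1 / n)"
    using s n_pos by (intro mult_right_mono divide_left_mono) auto
  finally have "cmod (char (distr M borel Y) t - (1 - t\<^sup>2 * (1 / n) / 2)) \<le>
     t\<^sup>2 / 6 * (\<bar>t\<bar> / (2 * (sqrt n / 4)) * (1 / n))"
    by (simp add: mult_left_mono)
  also have "\<dots> = \<bar>t\<bar> ^ 3 / (3 * n * sqrt n)"
    using n_pos by (simp add: field_simps power3_eq_cube power2_eq_square)
  finally show ?thesis unfolding Y_def s_def by (simp add: mult.commute)
qed

text \<open>Two products of factors of modulus at most 1 differ by at most the sum of the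
  differences of the factors. The hypothesis \<open>t\<^sup>2 / 4 \<le> n\<close> keeps the
  comparison factor \<open>1 - t\<^sup>2 / (2 * n)\<close> at or above -1.\<close>

lemma char_scaled_noise_approx:
  assumes k: "k \<ge> 1" and n: "t\<^sup>2 / 4 \<le> n"
  shows "cmod (char (scaled_noise k) t - complex_of_real ((1 + (- (t\<^sup>2 / 2)) / n) ^ n)) \<le> \<bar>t\<bar> ^ 3 / (3 * sqrt n)"
proof -
  define \<psi> where "\<psi> i = char (distr M borel (\<lambda>\<omega>. centred k i \<omega> / sigma n k)) t" for i
  define w where "w = complex_of_real (1 + (- (t\<^sup>2 / 2)) / n)"
  have "char (scaled_noise k) t = (\<Prod>i=1..n. \<psi> i)"
    unfolding scaled_noise_def noise_def \<psi>_def sum_divide_distrib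
    by (rule char_distr_sum) (rule indep_vars_compose2[OF indep_centred], simp)
  moreover have "complex_of_real ((1 + (- (t\<^sup>2 / 2)) / n) ^ n) = (\<Prod>i=1..n. w)" unfolding w_def by simp
  moreover have "cmod ((\<Prod>i=1..n. \<psi> i) - (\<Prod>i=1..n. w)) \<le> (\<Sum>i=1..n. cmod (\<psi> i - w))"
  proof (rule norm_prod_diff)
    fix i assume i: "i \<in> {1..n}"
    have "real_distribution (distr M borel (\<lambda>\<omega>. centred k i \<omega> / sigma n k))"
      using i by (intro real_distribution_distr) measurable
    then show "cmod (\<psi> i) \<le> 1" unfolding \<psi>_def by (rule real_distribution.cmod_char_le_1)
    show "cmod w \<le> 1" unfolding w_def norm_of_real
      using n n_pos by (intro abs_leI) (auto simp: field_simps)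
  qed
  moreover have "(\<Sum>i=1..n. cmod (\<psi> i - w)) \<le> (\<Sum>i=1..n. \<bar>t\<bar> ^ 3 / (3 * n * sqrt n))"
    using char_centred_approx[OF _ k, of _ t] unfolding \<psi>_def w_def
    by (intro sum_mono) simp
  moreover have "(\<Sum>i=1..n. \<bar>t\<bar> ^ 3 / (3 * n * sqrt n)) = \<bar>t\<bar> ^ 3 / (3 * sqrt n)"
    using n_pos by simp
  ultimately show ?thesis by simp
qed

end

text \<open>Formulated along arbitrary sequences \<open>n j\<close> and \<open>k j\<close>, where
  only \<open>n j\<close> has to tend to infinity. The freedom in \<open>k j\<close> is what later
  gives uniformity in the round.\<close>

lemma weak_conv_scaled_noise:
  fixes M :: "nat \<Rightarrow> 'a measure"
  assumes be: "\<And>j. bit_exchange (M j) (n j) (X j) (h j)"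
    and k: "\<And>j. k j \<ge> 1" and lim: "filterlim n at_top sequentially"
  shows "weak_conv_m (\<lambda>j. bit_exchange.scaled_noise (M j) (n j) (X j) (h j) (k j)) std_normal_distribution"
proof (rule levy_continuity)
  show "real_distribution (bit_exchange.scaled_noise (M j) (n j) (X j) (h j) (k j))" for j
    using be by (rule bit_exchange.real_distribution_scaled_noise)
  show "real_distribution std_normal_distribution" by (rule real_dist_normal_dist)
next
  fix t :: real
  let ?c = "\<lambda>j. char (bit_exchange.scaled_noise (M j) (n j) (X j) (h j) (k j)) t"
  have "\<forall>\<^sub>F j in sequentially. t\<^sup>2 / 4 \<le> real (n j)"
    using filterlim_compose[OF filterlim_real_sequentially lim] unfolding filterlim_at_top by blast
  then have ev: "\<forall>\<^sub>F j in sequentially. cmod (?c j - complex_of_real ((1 + (- (t\<^sup>2 / 2)) / n j) ^ n j))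
      \<le> \<bar>t\<bar> ^ 3 / (3 * sqrt (n j))"
    by eventually_elim (rule bit_exchange.char_scaled_noise_approx[OF be k])
  have "(\<lambda>m. \<bar>t\<bar> ^ 3 / (3 * sqrt (real m))) \<longlonglongrightarrow> 0"
    by (intro tendsto_divide_0[OF tendsto_const] filterlim_at_top_imp_at_infinity
        filterlim_tendsto_pos_mult_at_top[OF tendsto_const] sqrt_at_top[THEN filterlim_compose]
        filterlim_real_sequentially) auto
  then have lim0: "(\<lambda>j. \<bar>t\<bar> ^ 3 / (3 * sqrt (n j))) \<longlonglongrightarrow> 0" using lim by (rule filterlim_compose)
  have "(\<lambda>m. complex_of_real ((1 + (- (t\<^sup>2 / 2)) / real m) ^ m)) \<longlonglongrightarrow> complex_of_real (exp (- (t\<^sup>2 / 2)))"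
    by (rule isCont_tendsto_compose [OF _ tendsto_exp_limit_sequentially]) auto
  then have "(\<lambda>j. complex_of_real ((1 + (- (t\<^sup>2 / 2)) / n j) ^ n j)) \<longlonglongrightarrow> complex_of_real (exp (- (t\<^sup>2 / 2)))"
    using lim by (rule filterlim_compose)
  then have "?c \<longlonglongrightarrow> complex_of_real (exp (- (t\<^sup>2 / 2)))"
    by (rule Lim_transform) (rule Lim_null_comparison[OF ev lim0])
  then show "?c \<longlonglongrightarrow> char std_normal_distribution t"
    by (simp add: char_std_normal_distribution)
qed

text \<open>Polya's theorem. Far out on either side both functions are close to 0 or to 1. On the
  remaining compact piece, monotonicity of \<open>F j\<close> traps each point between two
  neighbours of a finite grid, across which \<open>G\<close> hardly changes.\<close>

lemma mono_tendsto_uniform: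
  fixes F :: "nat \<Rightarrow> real \<Rightarrow> real" and G :: "real \<Rightarrow> real"
  assumes F: "\<And>j. mono (F j)" "\<And>j x. 0 \<le> F j x" "\<And>j x. F j x \<le> 1"
    and G: "mono G" "continuous_on UNIV G" "(G \<longlongrightarrow> 0) at_bot" "(G \<longlongrightarrow> 1) at_top"
    and lim: "\<And>x. (\<lambda>j. F j x) \<longlonglongrightarrow> G x" and e: "e > 0"
  shows "\<forall>\<^sub>F j in sequentially. \<forall>x. \<bar>F j x - G x\<bar> \<le> e"
proof -
  obtain A where A: "\<And>x. x \<le> A \<Longrightarrow> G x < e / 2"
    using order_tendstoD(2)[OF G(3), of "e / 2"] e by (auto simp: eventually_at_bot_linorder)
  obtain B where B: "\<And>x. x \<ge> B \<Longrightarrow> 1 - e / 2 < G x"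
    using order_tendstoD(1)[OF G(4), of "1 - e / 2"] e by (auto simp: eventually_at_top_linorder)
  have "uniformly_continuous_on {A..B + 1} G"
    using G(2) by (intro compact_uniformly_continuous) (auto intro: continuous_on_subset)
  then obtain d where d: "d > 0"
    and G_d: "\<And>x y. x \<in> {A..B+1} \<Longrightarrow> y \<in> {A..B+1} \<Longrightarrow> dist y x < d \<Longrightarrow> dist (G y) (G x) < e / 2"
    unfolding uniformly_continuous_on_def using e by (metis half_gt_zero)
  \<comment> \<open>The mesh is below \<open>d\<close> for uniform continuity, and at most 1 so that
    the grid point to the right of some \<open>x < B\<close> still lies below
    \<open>B + 1\<close>.\<close>
  define q where "q = min 1 (d / 2)"
  have q: "q > 0" "q \<le> 1" "q < d" using d by (auto simp: q_def)
  \<comment> \<open>\<open>B\<close> is added by hand because it need not be a grid point.\<close>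
  define S where "S = insert B ((\<lambda>i::nat. A + q * real i) ` {..nat \<lceil>(B + 1 - A) / q\<rceil>})"
  have ev: "\<forall>\<^sub>F j in sequentially. \<forall>y\<in>S. \<bar>F j y - G y\<bar> < e / 2"
  proof (rule eventually_ball_finite)
    show "\<forall>y\<in>S. \<forall>\<^sub>F j in sequentially. \<bar>F j y - G y\<bar> < e / 2"
      using tendstoD[OF lim half_gt_zero[OF e]] by (simp add: dist_real_def)
  qed (simp add: S_def)
  show ?thesis using ev
  proof eventually_elim
    fix j assume S: "\<forall>y\<in>S. \<bar>F j y - G y\<bar> < e / 2"
    show "\<forall>x. \<bar>F j x - G x\<bar> \<le> e"
    proof
      fix x
      have AS: "A \<in> S" unfolding S_def by (intro insertI2 image_eqI[of _ _ 0]) auto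
      have G01: "0 \<le> G x" "G x \<le> 1" for x
        using F(2,3) LIMSEQ_le_const[OF lim] LIMSEQ_le_const2[OF lim] by blast+
      consider "x \<le> A" | "A \<le> x" "x < B" | "A \<le> x" "x \<ge> B" by linarith
      then show "\<bar>F j x - G x\<bar> \<le> e"
      proof cases
        case 1
        have "F j x \<le> F j A" using F(1) 1 by (rule monoD)
        moreover have "F j A < e" using S AS A[of A] by (smt (verit) field_sum_of_halves)
        moreover have "G x < e / 2" by (rule A[OF 1])
        ultimately show ?thesis using F(2)[of j x] G01[of x] by linarith
      next
        case 2
        define i where "i = nat \<lfloor>(x - A) / q\<rfloor>"
        have fl: "real i \<le> (x - A) / q" "(x - A) / q < real i + 1"
          unfolding i_def using 2 q by (auto simp: of_nat_nat)
        define y where "y = A + q * real i"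
        define z where "z = A + q * real (Suc i)"
        have yz: "y \<le> x" "x < z" "z = y + q" unfolding y_def z_def using fl q by (auto simp: field_simps)
        have i_le: "Suc i \<le> nat \<lceil>(B + 1 - A) / q\<rceil>"
        proof -
          have "real (Suc i) \<le> (x - A) / q + 1" using fl by simp
          also have "\<dots> = (x - A + q) / q" using q by (simp add: add_divide_distrib)
          also have "\<dots> \<le> (B + 1 - A) / q" using 2 q by (intro divide_right_mono) auto
          also have "\<dots> \<le> real_of_int \<lceil>(B + 1 - A) / q\<rceil>" by (rule le_of_int_ceiling)
          finally show ?thesis by linarith
        qed
        have yS: "y \<in> S" unfolding S_def y_def using i_le by (intro insertI2 imageI) auto
        have zS: "z \<in> S" unfolding S_def z_def using i_le by (intro insertI2 imageI) auto
        have "A \<le> y" unfolding y_def using q by simp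
        then have "dist (G y) (G x) < e / 2"
          using yz 2 q by (intro G_d) (auto simp: dist_real_def)
        moreover have "dist (G z) (G x) < e / 2"
          using yz 2 q by (intro G_d) (auto simp: dist_real_def)
        moreover have "F j y \<le> F j x" "F j x \<le> F j z" using yz by (auto intro: monoD[OF F(1)])
        moreover have "\<bar>F j y - G y\<bar> < e / 2" "\<bar>F j z - G z\<bar> < e / 2" using S yS zS by auto
        ultimately show ?thesis unfolding dist_real_def by linarith
      next
        case 3
        have "F j B \<le> F j x" using F(1) 3(2) by (rule monoD)
        moreover have "1 - e < F j B" using S B[of B] by (smt (verit) S_def field_sum_of_halves insertI1)
        moreover have "1 - e / 2 < G x" by (rule B[OF 3(2)])
        ultimately show ?thesis using F(3)[of j x] G01[of x] e by linarith
      qed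
    qed
  qed
qed


section \<open>The Gaussian approximation\<close>

interpretation std_normal: real_distribution std_normal_distribution
  by (rule real_dist_normal_dist)

lemma erf_has_real_derivative: "(erf has_real_derivative 2 / sqrt pi * exp (- x\<^sup>2)) (at x)"
proof -
  define a where "a = min 0 (x - 1)"
  define b where "b = max 0 (x + 1)"
  have ab: "a < x" "x < b" "a \<le> 0" "0 \<le> b" unfolding a_def b_def by auto
  have "((\<lambda>u. LBINT t=ereal 0..ereal u. exp (- t\<^sup>2)) has_vector_derivative exp (- x\<^sup>2)) (at x within {a..b})"
    using ab by (intro interval_integral_FTC2) (auto intro!: continuous_intros)
  then have "((\<lambda>u. LBINT t=ereal 0..ereal u. exp (- t\<^sup>2)) has_real_derivative exp (- x\<^sup>2)) (at x)"
    using ab by (simp add: has_real_derivative_iff_has_vector_derivative at_within_Icc_at)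
  then show ?thesis unfolding erf_def[abs_def] by (rule DERIV_cmult)
qed

lemma erf_chain [derivative_intros]:
  assumes "(f has_real_derivative f') (at x)"
  shows "((\<lambda>x. erf (f x)) has_real_derivative 2 / sqrt pi * exp (- (f x)\<^sup>2) * f') (at x)"
  using DERIV_chain2[OF erf_has_real_derivative assms] .

lemma erf_0 [simp]: "erf 0 = 0"
  by (simp add: erf_def)

lemma erf_minus: "erf (- x) = - erf x"
proof -
  have "\<forall>x. ((\<lambda>x. erf x + erf (- x)) has_real_derivative 0) (at x)"
    by (auto intro!: derivative_eq_intros erf_has_real_derivative)
  then have "erf x + erf (- x) = erf 0 + erf (- 0)" by (rule DERIV_isconst_all)
  then show ?thesis by simp
qed

text \<open>The constant is the slope at 0, where the derivative is largest. This is the source of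
  both the Gaussian concentration bound and the factor 6 / pi of the explicit bound.\<close>

lemma erf_diff_le:
  assumes "x \<le> y"
  shows "erf y - erf x \<le> 2 / sqrt pi * (y - x)"
proof -
  have "2 / sqrt pi * x - erf x \<le> 2 / sqrt pi * y - erf y"
    using assms
  proof (rule DERIV_nonneg_imp_nondecreasing)
    fix z
    have "((\<lambda>x. 2 / sqrt pi * x - erf x) has_real_derivative 2 / sqrt pi - 2 / sqrt pi * exp (- z\<^sup>2)) (at z)"
      by (rule DERIV_diff[OF DERIV_cmult_Id erf_has_real_derivative])
    moreover have "2 / sqrt pi * exp (- z\<^sup>2) \<le> 2 / sqrt pi * 1" by (intro mult_left_mono) auto
    ultimately show "\<exists>d. ((\<lambda>x. 2 / sqrt pi * x - erf x) has_real_derivative d) (at z) \<and> 0 \<le> d" by auto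
  qed
  then show ?thesis unfolding right_diff_distrib by linarith
qed

lemma measure_std_normal_Icc:
  assumes "x \<le> y"
  shows "measure std_normal_distribution {x..y} = (erf (y / sqrt 2) - erf (x / sqrt 2)) / 2"
proof -
  have der: "((\<lambda>x. erf (x / sqrt 2) / 2) has_real_derivative std_normal_density z) (at z)" for z
    by (auto intro!: derivative_eq_intros simp: std_normal_density_def power_divide real_sqrt_mult field_simps)
  have "emeasure std_normal_distribution {x..y} =
      (\<integral>\<^sup>+z. ennreal (std_normal_density z) * indicator {x..y} z \<partial>lborel)"
    by (subst emeasure_density) auto
  also have "\<dots> = ennreal (erf (y / sqrt 2) / 2 - erf (x / sqrt 2) / 2)"
    using assms der by (intro nn_integral_FTC_Icc) auto
  finally have e: "emeasure std_normal_distribution {x..y} = ennreal (erf (y / sqrt 2) / 2 - erf (x / sqrt 2) / 2)" .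
  have "erf (x / sqrt 2) / 2 \<le> erf (y / sqrt 2) / 2"
    using assms der by (intro DERIV_nonneg_imp_nondecreasing[of x y "\<lambda>x. erf (x / sqrt 2) / 2"]) 
      (blast intro: normal_density_nonneg)+
  then show ?thesis using e by (simp add: measure_def diff_divide_distrib)
qed

lemma std_normal_chebyshev:
  assumes "t > 0"
  shows "measure std_normal_distribution {x. t \<le> \<bar>x\<bar>} \<le> 1 / t\<^sup>2"
proof -
  have m: "std_normal.expectation (\<lambda>x. x) = 0"
    using integral_std_normal_distribution_moment_odd[of 1] by simp
  have v: "std_normal.expectation (\<lambda>x. x\<^sup>2) = 1" "integrable std_normal_distribution (\<lambda>x. x\<^sup>2)"
    using std_normal_distribution_even_moments[of 1] by (simp_all add: power2_eq_square)
  have "measure std_normal_distribution {x \<in> space std_normal_distribution. t \<le> \<bar>x - std_normal.expectation (\<lambda>x. x)\<bar>}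
     \<le> std_normal.variance (\<lambda>x. x) / t\<^sup>2"
    by (rule std_normal.Chebyshev_inequality) (use v assms in auto)
  then show ?thesis using m v by simp
qed

lemma measure_std_normal_symmetric: "y \<ge> 0 \<Longrightarrow> measure std_normal_distribution {-y..y} = erf (y / sqrt 2)"
  by (simp add: measure_std_normal_Icc erf_minus)

lemma erf_bounds: "\<bar>erf x\<bar> \<le> 1"
proof -
  have *: "0 \<le> erf x \<and> erf x \<le> 1" if "x \<ge> 0" for x
    using measure_std_normal_symmetric[of "x * sqrt 2"] that
      std_normal.prob_le_1[of "{- (x * sqrt 2)..x * sqrt 2}"]
      measure_nonneg[of std_normal_distribution "{- (x * sqrt 2)..x * sqrt 2}"] by simp
  show ?thesis using *[of x] *[of "- x"] by (cases "x \<ge> 0") (auto simp: erf_minus)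
qed

text \<open>The limit is read off from the total mass of the normal distribution:
  \<open>1 - erf x\<close> is the mass outside a symmetric interval, hence at most
  \<open>1 / (x * sqrt 2)\<^sup>2\<close> by Chebyshev's inequality.\<close>

lemma erf_at_top: "(erf \<longlongrightarrow> 1) at_top"
proof (rule tendsto_sandwich[of "\<lambda>x. 1 - 1 / (x * sqrt 2)\<^sup>2" _ _ "\<lambda>_. 1"])
  show "\<forall>\<^sub>F x in at_top. 1 - 1 / (x * sqrt 2)\<^sup>2 \<le> erf x"
    using eventually_gt_at_top[of 0]
  proof eventually_elim
    fix x :: real assume x: "x > 0"
    define t where "t = x * sqrt 2"
    have t: "t > 0" using x by (simp add: t_def)
    have "1 - measure std_normal_distribution {-t..t} = measure std_normal_distribution (UNIV - {-t..t})"
      by (subst std_normal.prob_compl[symmetric]) auto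
    also have "\<dots> \<le> measure std_normal_distribution {x. t \<le> \<bar>x\<bar>}"
      by (intro std_normal.finite_measure_mono) auto
    also have "\<dots> \<le> 1 / t\<^sup>2" using t by (rule std_normal_chebyshev)
    finally show "1 - 1 / (x * sqrt 2)\<^sup>2 \<le> erf x"
      using measure_std_normal_symmetric[of t] t by (simp add: t_def)
  qed
  show "\<forall>\<^sub>F x in at_top. erf x \<le> 1" using erf_bounds by (auto simp: abs_le_iff)
  have "((\<lambda>x::real. 1 / (x * sqrt 2)\<^sup>2) \<longlongrightarrow> 0) at_top"
    by (intro tendsto_divide_0[OF tendsto_const] filterlim_at_top_imp_at_infinity filterlim_pow_at_top
      filterlim_at_top_mult_tendsto_pos[OF tendsto_const] filterlim_ident) auto
  from tendsto_diff[OF tendsto_const[of 1] this]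
  show "((\<lambda>x::real. 1 - 1 / (x * sqrt 2)\<^sup>2) \<longlongrightarrow> 1) at_top" by simp
qed simp

text \<open>The case \<open>c = 0\<close> is kept because an endpoint of the Gaussian interval sits
  at 0 when \<gamma> is exactly \<open>1 / 2 ^ (k + 1)\<close>. Such a round has limit 1/2.\<close>

lemma erf_mult_tendsto_sgn:
  assumes "filterlim g at_top F"
  shows "((\<lambda>n. erf (c * g n)) \<longlongrightarrow> sgn c) F"
proof -
  have pos: "((\<lambda>n. erf (c * g n)) \<longlongrightarrow> 1) F" if "c > 0" for c :: real
    using filterlim_tendsto_pos_mult_at_top[OF tendsto_const that assms] erf_at_top
    by (rule filterlim_compose[rotated])
  consider "c > 0" | "c = 0" | "c < 0" by linarith
  then show ?thesis
  proof cases
    case 3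
    then have "((\<lambda>n. - erf (- c * g n)) \<longlongrightarrow> - 1) F" by (intro tendsto_minus pos) simp
    then show ?thesis using 3 by (simp add: erf_minus)
  qed (use pos in auto)
qed

lemma A_term_eq_measure:
  assumes n: "n > 0" and k: "k \<ge> 1"
  shows "A_term n k \<gamma> = measure std_normal_distribution
    {(\<gamma> - 1 / 2 ^ (k + 1)) * n / sigma n k .. (\<gamma> + 1 / 2 ^ (k + 1)) * n / sigma n k}"
proof -
  have "sigma n k > 0" using n k by (rule sigma_pos)
  then have "(\<gamma> - 1 / 2 ^ (k + 1)) * n / sigma n k \<le> (\<gamma> + 1 / 2 ^ (k + 1)) * n / sigma n k"
    by (intro divide_right_mono mult_right_mono) auto
  then show ?thesis unfolding A_term_def by (subst measure_std_normal_Icc) (auto simp: mult.commute)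
qed

lemma A_term_tendsto:
  assumes k: "k \<ge> 1"
  shows "(\<lambda>n. A_term n k \<gamma>) \<longlonglongrightarrow> (sgn (\<gamma> + 1 / 2 ^ (k + 1)) - sgn (\<gamma> - 1 / 2 ^ (k + 1))) / 2"
proof -
  \<comment> \<open>The standard deviation of one summand, so that
    \<open>sigma n k = sqrt n * v\<close> and the arguments of \<open>erf\<close> grow like
    \<open>sqrt n\<close>.\<close>
  define v where "v = sqrt ((1 - 1 / 4 ^ k) / 12 :: real)"
  have "(1::real) / 4 ^ k \<le> 1 / 4 ^ 1" using k by (intro divide_left_mono power_increasing) auto
  then have v: "v > 0" unfolding v_def by simp
  have s: "real n / (sqrt 2 * sigma n k) = (1 / (sqrt 2 * v)) * sqrt n" for n
  proof (cases "n = 0")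
    case False
    have "sigma n k = sqrt n * v" unfolding sigma_def v_def by (simp add: real_sqrt_mult[symmetric])
    then show ?thesis using False v by (simp add: field_simps)
  qed simp
  have g: "filterlim (\<lambda>n. real n / (sqrt 2 * sigma n k)) at_top sequentially"
    unfolding s using v
    by (intro filterlim_tendsto_pos_mult_at_top[OF tendsto_const] sqrt_at_top[THEN filterlim_compose]
      filterlim_real_sequentially) auto
  have "(\<lambda>n. 1 / 2 * (erf ((\<gamma> + 1 / 2 ^ (k + 1)) * (real n / (sqrt 2 * sigma n k)))
      - erf ((\<gamma> - 1 / 2 ^ (k + 1)) * (real n / (sqrt 2 * sigma n k)))))
     \<longlonglongrightarrow> 1 / 2 * (sgn (\<gamma> + 1 / 2 ^ (k + 1)) - sgn (\<gamma> - 1 / 2 ^ (k + 1)))"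
    by (intro tendsto_mult tendsto_diff tendsto_const erf_mult_tendsto_sgn g)
  then show ?thesis unfolding A_term_def by simp
qed

section \<open>Bounds shared by the protocol and its Gaussian approximation\<close>

text \<open>The interface between probability and summation: consequences are proved once and used
  for the protocol and for the Gaussian terms. The condition
  \<open>1 / 2 ^ k \<le> \<bar>\<gamma>\<bar>\<close> keeps the interval around
  \<open>\<gamma> * n\<close> at distance at least \<open>\<bar>\<gamma>\<bar> * n / 2\<close> from
  0. The constant 4 is dictated by the Gaussian side; the protocol gives 2.\<close>

definition spread_bounds :: "nat \<Rightarrow> real \<Rightarrow> (nat \<Rightarrow> real) \<Rightarrow> bool" where
  "spread_bounds n \<gamma> p \<longleftrightarrow> (\<forall>k\<ge>1. 0 \<le> p k \<and> p k \<le> 1 \<and> p k \<le> 4 * sqrt n / 2 ^ k \<and>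
     (\<gamma> = 0 \<longrightarrow> 1 - p k \<le> 4 ^ k / (3 * n)) \<and>
     (\<gamma> \<noteq> 0 \<and> 1 / 2 ^ k \<le> \<bar>\<gamma>\<bar> \<longrightarrow> p k \<le> 1 / (3 * \<gamma>\<^sup>2 * n)))"

text \<open>The event is only sandwiched between the open and the closed interval, which covers the
  strict inequalities of the protocol and the closed Gaussian interval alike.\<close>

lemma (in prob_space) interval_tail_bounds:
  fixes S :: "'a \<Rightarrow> real" and n :: nat and \<gamma> :: real
  assumes [measurable]: "S \<in> borel_measurable M" and n: "n > 0"
    and cheb: "\<And>t. t > 0 \<Longrightarrow> prob {\<omega> \<in> space M. t \<le> \<bar>S \<omega>\<bar>} \<le> n / (12 * t\<^sup>2)"
    and E [measurable]: "E \<in> sets M"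
    and sub: "E \<subseteq> {\<omega> \<in> space M. (\<gamma> - 1 / 2 ^ (k + 1)) * n \<le> S \<omega> \<and> S \<omega> \<le> (\<gamma> + 1 / 2 ^ (k + 1)) * n}"
    and sup: "{\<omega> \<in> space M. (\<gamma> - 1 / 2 ^ (k + 1)) * n < S \<omega> \<and> S \<omega> < (\<gamma> + 1 / 2 ^ (k + 1)) * n} \<subseteq> E"
  shows "\<gamma> = 0 \<Longrightarrow> 1 - prob E \<le> 4 ^ k / (3 * n)"
    and "\<gamma> \<noteq> 0 \<Longrightarrow> 1 / 2 ^ k \<le> \<bar>\<gamma>\<bar> \<Longrightarrow> prob E \<le> 1 / (3 * \<gamma>\<^sup>2 * n)"
proof -
  define s where "s = 1 / (2 ^ (k + 1) :: real)"
  have s: "s > 0" by (simp add: s_def)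
  assume g: "\<gamma> = 0"
  have "1 - prob E = prob (space M - E)" by (simp add: prob_compl)
  also have "\<dots> \<le> prob {\<omega> \<in> space M. s * n \<le> \<bar>S \<omega>\<bar>}"
    using sup unfolding g s_def[symmetric] by (intro finite_measure_mono) (auto simp: abs_le_iff not_le)
  also have "\<dots> \<le> n / (12 * (s * n)\<^sup>2)" using s n by (intro cheb) simp
  also have "\<dots> = 4 ^ k / (3 * n)"
  proof -
    have sq: "s\<^sup>2 = 1 / (4 * 4 ^ k)" unfolding s_def by (simp add: power_divide power2_eq_square power_mult_distrib[symmetric])
    have "(s * n)\<^sup>2 = n * n / (4 * 4 ^ k)" unfolding power_mult_distrib sq by (simp add: power2_eq_square)
    then show ?thesis using n by (simp only:) (simp add: field_simps)
  qed
  finally show "1 - prob E \<le> 4 ^ k / (3 * n)" .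
next
  define s where "s = 1 / (2 ^ (k + 1) :: real)"
  assume g: "\<gamma> \<noteq> 0" "1 / 2 ^ k \<le> \<bar>\<gamma>\<bar>"
  then have s: "2 * s \<le> \<bar>\<gamma>\<bar>" by (simp add: s_def)
  have "prob E \<le> prob {\<omega> \<in> space M. \<bar>\<gamma>\<bar> / 2 * n \<le> \<bar>S \<omega>\<bar>}"
  proof (rule finite_measure_mono)
    show "E \<subseteq> {\<omega> \<in> space M. \<bar>\<gamma>\<bar> / 2 * n \<le> \<bar>S \<omega>\<bar>}"
    proof
      fix \<omega> assume "\<omega> \<in> E"
      then have w: "\<omega> \<in> space M" "(\<gamma> - s) * n \<le> S \<omega>" "S \<omega> \<le> (\<gamma> + s) * n" using sub by (auto simp: s_def)
      have "\<bar>\<gamma>\<bar> / 2 * n \<le> \<bar>S \<omega>\<bar>"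
      proof (cases "\<gamma> > 0")
        case True
        then have "\<bar>\<gamma>\<bar> / 2 * n \<le> (\<gamma> - s) * n" using s n by (intro mult_right_mono) auto
        then show ?thesis using w by linarith
      next
        case False
        then have "(\<gamma> + s) * n \<le> - (\<bar>\<gamma>\<bar> / 2) * n" using s n by (intro mult_right_mono) auto
        then show ?thesis using w by linarith
      qed
      then show "\<omega> \<in> {\<omega> \<in> space M. \<bar>\<gamma>\<bar> / 2 * n \<le> \<bar>S \<omega>\<bar>}" using w by simp
    qed
  qed measurable
  also have "\<dots> \<le> n / (12 * (\<bar>\<gamma>\<bar> / 2 * n)\<^sup>2)" using g n by (intro cheb) simp
  also have "\<dots> = 1 / (3 * \<gamma>\<^sup>2 * n)" using n g by (simp add: power_mult_distrib power_divide field_simps power2_eq_square)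
  finally show "prob E \<le> 1 / (3 * \<gamma>\<^sup>2 * n)" .
qed

lemma (in bit_exchange) spread_bounds_prob_between:
  "spread_bounds n (offset a) (prob_between M n X h a)"
  unfolding spread_bounds_def
proof (intro allI impI)
  fix k :: nat assume k: "k \<ge> 1"
  define E where "E = {\<omega> \<in> space M. (offset a - 1 / 2 ^ (k + 1)) * n < noise k \<omega> \<and> noise k \<omega> < (offset a + 1 / 2 ^ (k + 1)) * n}"
  have E: "prob_between M n X h a k = prob E" unfolding E_def by (rule prob_between_eq)
  have E_meas: "E \<in> sets M" unfolding E_def by measurable
  have sub: "E \<subseteq> {\<omega> \<in> space M. (offset a - 1 / 2 ^ (k + 1)) * n \<le> noise k \<omega> \<and> noise k \<omega> \<le> (offset a + 1 / 2 ^ (k + 1)) * n}"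
    unfolding E_def by (auto simp del: power_Suc)
  have sup: "{\<omega> \<in> space M. (offset a - 1 / 2 ^ (k + 1)) * n < noise k \<omega> \<and> noise k \<omega> < (offset a + 1 / 2 ^ (k + 1)) * n} \<subseteq> E"
    unfolding E_def ..
  note tb = interval_tail_bounds[OF noise_measurable n_pos noise_chebyshev E_meas sub sup]
  have "prob_between M n X h a k \<le> sqrt n / 2 ^ (k - 1)"
    using prob_between_concentration[of a "k - 1"] k by simp
  also have "\<dots> = 2 * sqrt n / 2 ^ k" using k by (cases k) auto
  also have "\<dots> \<le> 4 * sqrt n / 2 ^ k" by (intro divide_right_mono) auto
  finally show "0 \<le> prob_between M n X h a k \<and> prob_between M n X h a k \<le> 1 \<and>
     prob_between M n X h a k \<le> 4 * sqrt n / 2 ^ k \<and>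
     (offset a = 0 \<longrightarrow> 1 - prob_between M n X h a k \<le> 4 ^ k / (3 * n)) \<and>
     (offset a \<noteq> 0 \<and> 1 / 2 ^ k \<le> \<bar>offset a\<bar> \<longrightarrow> prob_between M n X h a k \<le> 1 / (3 * (offset a)\<^sup>2 * n))"
    unfolding E using tb by simp
qed

lemma spread_bounds_A_term:
  assumes n: "n > 0"
  shows "spread_bounds n \<gamma> (\<lambda>k. A_term n k \<gamma>)"
  unfolding spread_bounds_def
proof (intro allI impI)
  fix k :: nat assume k: "k \<ge> 1"
  define s where "s = sigma n k"
  have s: "s > 0" "sqrt n / 4 \<le> s" unfolding s_def using sigma_pos[OF n k] sigma_ge[OF k] by auto
  define u where "u = (\<gamma> - 1 / 2 ^ (k + 1)) * n / s"
  define v where "v = (\<gamma> + 1 / 2 ^ (k + 1)) * n / s"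
  have A: "A_term n k \<gamma> = measure std_normal_distribution {u..v}"
    unfolding u_def v_def s_def by (rule A_term_eq_measure[OF n k])
  have uv: "u \<le> v" unfolding u_def v_def using s by (intro divide_right_mono mult_right_mono) auto
  \<comment> \<open>The variable \<open>s * x\<close> with \<open>x\<close> standard normal takes
    the role of the noise; it has the same variance.\<close>
  have cheb: "std_normal.prob {x \<in> space std_normal_distribution. t \<le> \<bar>s * x\<bar>} \<le> n / (12 * t\<^sup>2)" if t: "t > 0" for t
  proof -
    have "{x \<in> space std_normal_distribution. t \<le> \<bar>s * x\<bar>} = {x. t / s \<le> \<bar>x\<bar>}"
      using s by (auto simp: abs_mult field_simps)
    then have "std_normal.prob {x \<in> space std_normal_distribution. t \<le> \<bar>s * x\<bar>} \<le> 1 / (t / s)\<^sup>2"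
      using std_normal_chebyshev[of "t / s"] t s by simp
    also have "\<dots> = s\<^sup>2 / t\<^sup>2" by (simp add: power_divide)
    also have "\<dots> \<le> (n / 12) / t\<^sup>2" unfolding s_def using sigma_sq_le by (rule divide_right_mono) simp
    finally show ?thesis by simp
  qed
  note tb = std_normal.interval_tail_bounds[of "\<lambda>x. s * x" n "{u..v}" \<gamma> k]
  have bd: "{u..v} \<subseteq> {x \<in> space std_normal_distribution. (\<gamma> - 1 / 2 ^ (k + 1)) * n \<le> s * x \<and> s * x \<le> (\<gamma> + 1 / 2 ^ (k + 1)) * n}"
    "{x \<in> space std_normal_distribution. (\<gamma> - 1 / 2 ^ (k + 1)) * n < s * x \<and> s * x < (\<gamma> + 1 / 2 ^ (k + 1)) * n} \<subseteq> {u..v}"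
    unfolding u_def v_def using s by (auto simp: pos_divide_le_eq pos_le_divide_eq mult.commute simp del: power_Suc)
  have "A_term n k \<gamma> \<le> 2 / sqrt pi * (v / sqrt 2 - u / sqrt 2) / 2"
    unfolding A measure_std_normal_Icc[OF uv] using uv by (intro divide_right_mono erf_diff_le) auto
  also have "\<dots> = 1 / (sqrt pi * sqrt 2) * (v - u)" by (simp add: field_simps)
  also have "\<dots> \<le> 1 * (v - u)"
  proof (rule mult_right_mono)
    have "1 \<le> sqrt pi" using pi_gt3 by simp
    then have "1 * 1 \<le> sqrt pi * sqrt 2" by (intro mult_mono) auto
    then show "1 / (sqrt pi * sqrt 2) \<le> 1" by simp
  qed (use uv in simp)
  also have "v - u = (n / 2 ^ k) / s"
    unfolding u_def v_def by (simp add: diff_divide_distrib[symmetric] left_diff_distrib distrib_right)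
  also have "1 * ((n / 2 ^ k) / s) \<le> (n / 2 ^ k) / (sqrt n / 4)"
    unfolding mult_1 using s n by (intro divide_left_mono) auto
  also have "\<dots> = 4 * sqrt n / 2 ^ k" using n by (simp add: field_simps)
  finally have conc: "A_term n k \<gamma> \<le> 4 * sqrt n / 2 ^ k" .
  have "(\<gamma> = 0 \<longrightarrow> 1 - A_term n k \<gamma> \<le> 4 ^ k / (3 * n)) \<and>
     (\<gamma> \<noteq> 0 \<and> 1 / 2 ^ k \<le> \<bar>\<gamma>\<bar> \<longrightarrow> A_term n k \<gamma> \<le> 1 / (3 * \<gamma>\<^sup>2 * n))"
    unfolding A using tb[OF _ n cheb _ bd] by auto
  then show "0 \<le> A_term n k \<gamma> \<and> A_term n k \<gamma> \<le> 1 \<and> A_term n k \<gamma> \<le> 4 * sqrt n / 2 ^ k \<and>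
     (\<gamma> = 0 \<longrightarrow> 1 - A_term n k \<gamma> \<le> 4 ^ k / (3 * n)) \<and>
     (\<gamma> \<noteq> 0 \<and> 1 / 2 ^ k \<le> \<bar>\<gamma>\<bar> \<longrightarrow> A_term n k \<gamma> \<le> 1 / (3 * \<gamma>\<^sup>2 * n))"
    using conc unfolding A by simp
qed


section \<open>The error of a single round, uniformly in the round\<close>

lemma eventually_at_top_in:
  "eventually P (at_top_in N) \<longleftrightarrow> (\<exists>n0. \<forall>n\<ge>n0. n \<in> N \<longrightarrow> P n)"
  by (simp add: at_top_in_def eventually_inf_principal eventually_sequentially)

lemma std_normal_isCont_cdf: "isCont (cdf std_normal_distribution) x"
  using measure_std_normal_Icc[of x x] by (simp add: std_normal.isCont_cdf)

text \<open>\<open>D\<close> may have atoms, so the mass of an open interval involves the left limit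
  of its distribution function at \<open>v\<close>. Closeness passes to that limit because the
  Gaussian side is continuous. Each endpoint costs one \<open>e\<close>.\<close>

lemma cdf_close_interval:
  assumes "real_distribution D" and close: "\<And>x. \<bar>cdf D x - cdf std_normal_distribution x\<bar> \<le> e"
    and uv: "u < v"
  shows "\<bar>measure D {u<..<v} - measure std_normal_distribution {u..v}\<bar> \<le> 2 * e"
proof -
  interpret D: real_distribution D by fact
  let ?G = "cdf std_normal_distribution"
  have "((\<lambda>x. \<bar>cdf D x - ?G x\<bar>) \<longlongrightarrow> \<bar>measure D {..<v} - ?G v\<bar>) (at_left v)"
  proof (intro tendsto_rabs tendsto_diff D.cdf_at_left)
    show "(?G \<longlongrightarrow> ?G v) (at_left v)"
      using std_normal_isCont_cdf[of v] unfolding isCont_def by (rule tendsto_within_subset) simp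
  qed
  then have l: "\<bar>measure D {..<v} - ?G v\<bar> \<le> e"
    by (rule tendsto_upperbound) (use close in auto)
  have "measure D {..<v} = measure D ({..u} \<union> {u<..<v})" using uv by (intro arg_cong[where f="measure D"]) auto
  also have "\<dots> = cdf D u + measure D {u<..<v}"
    unfolding cdf_def by (intro D.finite_measure_Union) auto
  finally have 1: "measure D {u<..<v} = measure D {..<v} - cdf D u" by simp
  have "measure std_normal_distribution {u..v} = measure std_normal_distribution ({u<..v} \<union> {u..u})"
    using uv by (intro arg_cong[where f="measure std_normal_distribution"]) auto
  also have "\<dots> = measure std_normal_distribution {u<..v} + measure std_normal_distribution {u..u}"
    by (intro std_normal.finite_measure_Union) auto
  also have "measure std_normal_distribution {u..u} = 0" by (subst measure_std_normal_Icc) auto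
  also have "measure std_normal_distribution {u<..v} = ?G v - ?G u" using uv by (simp add: std_normal.cdf_diff_eq)
  finally show ?thesis using l close[of u] 1 by linarith
qed

text \<open>If uniformity failed, there would be offending pairs \<open>n j\<close>,
  \<open>k j\<close> with \<open>n j\<close> tending to infinity. Along them weak convergence still
  holds, however \<open>k j\<close> behaves, and it is uniform in \<open>x\<close> because the limit
  is continuous.\<close>

lemma scaled_noise_cdf_uniform:
  fixes M :: "nat \<Rightarrow> 'a measure"
  assumes be: "\<And>n. n \<in> N \<Longrightarrow> bit_exchange (M n) n (X n) (h n)" and e: "e > 0"
  shows "\<forall>\<^sub>F n in at_top_in N. \<forall>k\<ge>1. \<forall>x.
    \<bar>cdf (bit_exchange.scaled_noise (M n) n (X n) (h n) k) x - cdf std_normal_distribution x\<bar> \<le> e"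
proof (rule ccontr)
  let ?D = "\<lambda>n. bit_exchange.scaled_noise (M n) n (X n) (h n)"
  assume "\<not> ?thesis"
  then have "\<forall>j. \<exists>n k. j \<le> n \<and> n \<in> N \<and> k \<ge> 1 \<and> \<not> (\<forall>x. \<bar>cdf (?D n k) x - cdf std_normal_distribution x\<bar> \<le> e)"
    unfolding eventually_at_top_in by blast
  from choice[OF this] obtain n where
    "\<forall>j. \<exists>k. j \<le> n j \<and> n j \<in> N \<and> k \<ge> 1 \<and> \<not> (\<forall>x. \<bar>cdf (?D (n j) k) x - cdf std_normal_distribution x\<bar> \<le> e)" ..
  from choice[OF this] obtain k where
    "\<forall>j. j \<le> n j \<and> n j \<in> N \<and> k j \<ge> 1 \<and> \<not> (\<forall>x. \<bar>cdf (?D (n j) (k j)) x - cdf std_normal_distribution x\<bar> \<le> e)" ..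
  then have nk: "\<And>j. j \<le> n j" "\<And>j. n j \<in> N" "\<And>j. (k j :: nat) \<ge> 1"
    and far: "\<And>j. \<not> (\<forall>x. \<bar>cdf (?D (n j) (k j)) x - cdf std_normal_distribution x\<bar> \<le> e)"
    by blast+
  have be': "bit_exchange (M (n j)) (n j) (X (n j)) (h (n j))" for j using be nk by simp
  have lim: "filterlim n at_top sequentially"
    by (rule filterlim_at_top_mono[OF filterlim_ident]) (use nk in auto)
  have rd: "real_distribution (?D (n j) (k j))" for j
    by (rule bit_exchange.real_distribution_scaled_noise[OF be'])
  have wc: "weak_conv_m (\<lambda>j. ?D (n j) (k j)) std_normal_distribution"
    by (rule weak_conv_scaled_noise[where M="\<lambda>j. M (n j)" and n=n and X="\<lambda>j. X (n j)" and h="\<lambda>j. h (n j)" and k=k, OF be' nk(3) lim])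
  have "\<forall>\<^sub>F j in sequentially. \<forall>x. \<bar>cdf (?D (n j) (k j)) x - cdf std_normal_distribution x\<bar> \<le> e"
  proof (rule mono_tendsto_uniform)
    fix j
    interpret D: real_distribution "?D (n j) (k j)" by (rule rd)
    show "mono (cdf (?D (n j) (k j)))" using D.cdf_nondecreasing by (auto intro: monoI)
    show "0 \<le> cdf (?D (n j) (k j)) x" "cdf (?D (n j) (k j)) x \<le> 1" for x
      using D.cdf_nonneg D.cdf_bounded_prob by auto
  next
    show "mono (cdf std_normal_distribution)" using std_normal.cdf_nondecreasing by (auto intro: monoI)
    show "continuous_on UNIV (cdf std_normal_distribution)"
      using std_normal_isCont_cdf by (simp add: continuous_at_imp_continuous_on)
    show "(cdf std_normal_distribution \<longlongrightarrow> 0) at_bot" by (rule std_normal.cdf_lim_at_bot)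
    show "(cdf std_normal_distribution \<longlongrightarrow> 1) at_top" by (rule std_normal.cdf_lim_at_top_prob)
    show "(\<lambda>j. cdf (?D (n j) (k j)) x) \<longlonglongrightarrow> cdf std_normal_distribution x" for x
      using wc std_normal_isCont_cdf unfolding weak_conv_m_def weak_conv_def by simp
  qed (rule e)
  then obtain j where "\<forall>x. \<bar>cdf (?D (n j) (k j)) x - cdf std_normal_distribution x\<bar> \<le> e"
    unfolding eventually_sequentially by blast
  then show False using far by blast
qed

lemma (in bit_exchange) prob_between_scaled_noise:
  assumes k: "k \<ge> 1"
  shows "prob_between M n X h a k = measure (scaled_noise k)
    {(offset a - 1 / 2 ^ (k + 1)) * n / sigma n k <..< (offset a + 1 / 2 ^ (k + 1)) * n / sigma n k}"
proof -
  define s where "s = sigma n k"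
  have s: "s > 0" unfolding s_def using n_pos k by (rule sigma_pos)
  define u where "u = (offset a - 1 / 2 ^ (k + 1)) * n"
  define v where "v = (offset a + 1 / 2 ^ (k + 1)) * n"
  have "measure (scaled_noise k) {u / s<..<v / s} = prob ((\<lambda>\<omega>. noise k \<omega> / s) -` {u / s<..<v / s} \<inter> space M)"
    unfolding scaled_noise_def s_def by (rule measure_distr) auto
  also have "(\<lambda>\<omega>. noise k \<omega> / s) -` {u / s<..<v / s} \<inter> space M = {\<omega> \<in> space M. u < noise k \<omega> \<and> noise k \<omega> < v}"
    using s by (auto simp: divide_less_cancel)
  finally show ?thesis unfolding prob_between_eq u_def v_def s_def ..
qed

lemma error_uniform:
  fixes M :: "nat \<Rightarrow> 'a measure"
  assumes be: "\<And>n. n \<in> N \<Longrightarrow> bit_exchange (M n) n (X n) (h n)"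
    and off: "\<And>n. n \<in> N \<Longrightarrow> bit_exchange.offset n (h n) (a n) = \<gamma>" and e: "e > 0"
  shows "\<forall>\<^sub>F n in at_top_in N. n \<in> N \<longrightarrow> (\<forall>k\<ge>1. \<bar>prob_between (M n) n (X n) (h n) (a n) k - A_term n k \<gamma>\<bar> \<le> e)"
  using scaled_noise_cdf_uniform[where M=M and X=X and h=h, OF be half_gt_zero[OF e], of N, simplified]
proof eventually_elim
  case (elim n)
  show ?case
  proof (intro impI allI)
    fix k :: nat assume n: "n \<in> N" and k: "k \<ge> 1"
    interpret bit_exchange "M n" n "X n" "h n" by (rule be[OF n])
    have o: "offset (a n) = \<gamma>" by (rule off[OF n])
    have "(\<gamma> - 1 / 2 ^ (k + 1)) * n / sigma n k < (\<gamma> + 1 / 2 ^ (k + 1)) * n / sigma n k"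
      using sigma_pos[OF n_pos k] n_pos by (intro divide_strict_right_mono mult_strict_right_mono) auto
    then have "\<bar>prob_between (M n) n (X n) (h n) (a n) k - A_term n k \<gamma>\<bar> \<le> 2 * (e / 2)"
      unfolding prob_between_scaled_noise[OF k] A_term_eq_measure[OF n_pos k] o
      using elim k by (intro cdf_close_interval real_distribution_scaled_noise) auto
    then show "\<bar>prob_between (M n) n (X n) (h n) (a n) k - A_term n k \<gamma>\<bar> \<le> e" by simp
  qed
qed

section \<open>Summation over the rounds\<close>

text \<open>A two-sided geometric profile around the round \<open>c\<close>. The distance is taken
  in the integers because subtraction of naturals would truncate.\<close>

definition peak :: "real \<Rightarrow> nat \<Rightarrow> nat \<Rightarrow> real" where
  "peak r c k = r ^ nat \<bar>int k - int c\<bar>"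

text \<open>What matters is that the bound is free of \<open>c\<close>: either side of the centre is
  at most one full geometric series.\<close>

lemma peak_sums:
  assumes r: "0 < r" "r < 1"
  shows "summable (peak r c)" and "suminf (peak r c) \<le> 2 / (1 - r)"
proof -
  have tail: "peak r c (k + Suc c) = r * r ^ k" for k
    by (simp add: peak_def nat_add_distrib)
  have g: "summable (\<lambda>k. r ^ k)" "suminf (\<lambda>k. r ^ k) = 1 / (1 - r)"
    using r by (simp_all add: suminf_geometric)
  have s: "summable (\<lambda>k. peak r c (k + Suc c))" unfolding tail using g by (intro summable_mult)
  then show sm: "summable (peak r c)" by (rule summable_iff_shift[THEN iffD1])
  have "(\<Sum>k<Suc c. peak r c k) = (\<Sum>k<Suc c. r ^ (c - k))"
    by (intro sum.cong) (auto simp: peak_def intro!: arg_cong[where f="\<lambda>m. r ^ m"])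
  also have "\<dots> = (\<Sum>k<Suc c. r ^ k)" using sum.nat_diff_reindex[of "\<lambda>k. r ^ k" "Suc c"] by simp
  also have "\<dots> \<le> suminf (\<lambda>k. r ^ k)" using g r by (intro sum_le_suminf) auto
  finally have "(\<Sum>k<Suc c. peak r c k) \<le> 1 / (1 - r)" using g by simp
  moreover have "(\<Sum>k. peak r c (k + Suc c)) = r * (1 / (1 - r))"
    unfolding tail using g by (simp add: suminf_mult)
  moreover have "r * (1 / (1 - r)) \<le> 1 / (1 - r)" using r by (simp add: divide_right_mono)
  ultimately show "suminf (peak r c) \<le> 2 / (1 - r)"
    using suminf_split_initial_segment[OF sm, of "Suc c"] by simp
qed

lemma spread_bounds_summable:
  assumes "spread_bounds n \<gamma> p"
  shows "summable (\<lambda>k. p (Suc k))"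
proof (rule summable_comparison_test)
  have "\<bar>p (Suc k)\<bar> \<le> 2 * sqrt n * (1 / 2) ^ k" for k
    using assms[unfolded spread_bounds_def, rule_format, of "Suc k"] by (simp add: power_one_over)
  then show "\<exists>K. \<forall>k\<ge>K. norm (p (Suc k)) \<le> 2 * sqrt n * (1 / 2) ^ k" by simp
  show "summable (\<lambda>k. 2 * sqrt n * (1 / 2 :: real) ^ k)" by (intro summable_mult) simp
qed

text \<open>The two bounds on \<open>p k\<close> away from \<open>\<gamma> = 0\<close> are good for small and for large \<open>k\<close>
  respectively; their geometric mean is free of \<open>n\<close>.\<close>

lemma spread_bounds_decay:
  assumes g: "\<gamma> \<noteq> 0"
  shows "\<exists>C>0. \<forall>n p k. n > 0 \<longrightarrow> spread_bounds n \<gamma> p \<longrightarrow> k \<ge> 1 \<longrightarrow> p k \<le> C * sqrt (1 / 2) ^ k"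
proof -
  \<comment> \<open>The first summand serves the rounds with
    \<open>1 / 2 ^ k \<le> \<bar>\<gamma>\<bar>\<close>. The second serves the earlier ones, where
    \<open>p k \<le> 1\<close> is already of the required order.\<close>
  define C where "C = 4 / (3 * \<gamma>\<^sup>2) + 1 / \<bar>\<gamma>\<bar>"
  have C: "C > 0" using g unfolding C_def by (intro add_pos_pos) auto
  show ?thesis
  proof (intro exI[of _ "sqrt C"] conjI allI impI)
    show "sqrt C > 0" using C by simp
    fix n :: nat and p k assume n: "n > 0" and p: "spread_bounds n \<gamma> p" and k: "(k::nat) \<ge> 1"
    have b: "0 \<le> p k" "p k \<le> 1" "p k \<le> 4 * sqrt n / 2 ^ k" "1 / 2 ^ k \<le> \<bar>\<gamma>\<bar> \<Longrightarrow> p k \<le> 1 / (3 * \<gamma>\<^sup>2 * n)"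
      using p k g unfolding spread_bounds_def by blast+
    have "(p k)\<^sup>2 \<le> C * (1 / 2 ^ k)"
    proof (cases "1 / 2 ^ k \<le> \<bar>\<gamma>\<bar>")
      case True
      have "p k * p k \<le> (4 * sqrt n / 2 ^ k) * (1 / (3 * \<gamma>\<^sup>2 * n))"
        using b True by (intro mult_mono) auto
      also have "\<dots> = (sqrt n / n) * (4 / (3 * \<gamma>\<^sup>2) * (1 / 2 ^ k))" by (simp add: ac_simps)
      also have "\<dots> \<le> 1 * (4 / (3 * \<gamma>\<^sup>2) * (1 / 2 ^ k))"
      proof (rule mult_right_mono)
        have "1 \<le> sqrt (real n)" using n by simp
        then have "sqrt n * 1 \<le> sqrt n * sqrt n" by (intro mult_left_mono) auto
        then show "sqrt n / n \<le> 1" using n by simp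
      qed simp
      also have "\<dots> \<le> C * (1 / 2 ^ k)" unfolding C_def mult_1 by (intro mult_right_mono) auto
      finally show ?thesis by (simp add: power2_eq_square)
    next
      case False
      have "(p k)\<^sup>2 \<le> 1" using b by (simp add: power_le_one)
      also have "\<dots> \<le> 1 / \<bar>\<gamma>\<bar> * (1 / 2 ^ k)" using False g by (simp add: field_simps)
      also have "\<dots> \<le> C * (1 / 2 ^ k)" unfolding C_def by (intro mult_right_mono) auto
      finally show ?thesis .
    qed
    then have "p k \<le> sqrt (C * (1 / 2) ^ k)" by (simp add: real_le_rsqrt power_one_over)
    then show "p k \<le> sqrt C * sqrt (1 / 2) ^ k" by (simp only: real_sqrt_mult real_sqrt_power)
  qed
qed

lemma half_le_sqrt_half: "(1 / 2 :: real) ^ m \<le> sqrt (1 / 2) ^ m"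
proof (rule power_mono)
  show "(1 / 2 :: real) \<le> sqrt (1 / 2)" by (rule real_le_rsqrt) (simp add: power2_eq_square)
qed simp

text \<open>The centre is the round with \<open>2 ^ c\<close> of order \<open>sqrt n\<close>: there
  the width \<open>n / 2 ^ c\<close> of the interval is comparable to the standard
  deviation.\<close>

lemma obtain_center:
  assumes "n > 0"
  obtains c :: nat where "2 ^ c \<le> sqrt (real n)" "sqrt (real n) < 2 * 2 ^ c"
proof -
  have "1 \<le> sqrt (real n)" using assms by simp
  then have l: "0 \<le> log 2 (sqrt (real n))" by simp
  define c where "c = nat \<lfloor>log 2 (sqrt (real n))\<rfloor>"
  have "real c \<le> log 2 (sqrt (real n))" "log 2 (sqrt (real n)) < real c + 1"
    unfolding c_def using l by (auto simp: of_nat_nat)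
  then have "2 powr real c \<le> sqrt (real n)" "sqrt (real n) < 2 powr (real c + 1)"
    using assms by (auto simp: le_log_iff log_less_iff)
  then show ?thesis using that[of c] by (simp add: powr_realpow powr_add mult.commute)
qed

text \<open>Before the centre the Chebyshev bound even decays with ratio 1/4; it is weakened to 1/2
  to match the other side.\<close>

lemma spread_bounds_center:
  assumes p: "spread_bounds n 0 p" and k: "k \<ge> 1" and n: "n > 0"
    and c: "2 ^ c \<le> sqrt (real n)" "sqrt (real n) < 2 * 2 ^ c"
  shows "k \<le> c \<Longrightarrow> 1 - p k \<le> (1 / 2) ^ (c - k) / 3"
    and "k > c \<Longrightarrow> p k \<le> 8 * (1 / 2) ^ (k - c)"
proof -
  assume kc: "k \<le> c"
  have "(2 ^ c)\<^sup>2 \<le> (sqrt n)\<^sup>2" using c by (intro power_mono) auto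
  then have cn: "4 ^ c \<le> real n" by (simp add: power2_eq_square power_mult_distrib[symmetric])
  have "1 - p k \<le> 4 ^ k / (3 * n)" using p k unfolding spread_bounds_def by blast
  also have "\<dots> \<le> 4 ^ k / (3 * 4 ^ c)" using cn n by (intro divide_left_mono) auto
  also have "\<dots> = (1 / 4) ^ (c - k) / 3" using kc by (simp add: power_diff power_one_over field_simps)
  also have "\<dots> \<le> (1 / 2) ^ (c - k) / 3" by (intro divide_right_mono power_mono) auto
  finally show "1 - p k \<le> (1 / 2) ^ (c - k) / 3" .
next
  assume kc: "k > c"
  have "p k \<le> 4 * sqrt n / 2 ^ k" using p k unfolding spread_bounds_def by blast
  also have "\<dots> \<le> 4 * (2 * 2 ^ c) / 2 ^ k" using c by (intro divide_right_mono mult_left_mono) auto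
  also have "\<dots> = 8 * (1 / 2) ^ (k - c)" using kc by (simp add: power_diff power_one_over field_simps)
  finally show "p k \<le> 8 * (1 / 2) ^ (k - c)" .
qed

text \<open>At offset 0 both sequences are near 1 before the centre and near 0 after it, so their
  difference is small on either side. At other offsets both are small by themselves and the centre
  is 0. The ratio \<open>sqrt (1 / 2)\<close> is the slower of the two decay rates.\<close>

lemma spread_bounds_diff_peak:
  "\<exists>C>0. \<forall>n p q. n > 0 \<longrightarrow> spread_bounds n \<gamma> p \<longrightarrow> spread_bounds n \<gamma> q \<longrightarrow>
     (\<exists>c. \<forall>k. \<bar>p (Suc k) - q (Suc k)\<bar> \<le> C * peak (sqrt (1 / 2)) c k)"
proof (cases "\<gamma> = 0")
  case False
  obtain C where C: "C > 0"
    and dec: "\<And>n p k. n > 0 \<Longrightarrow> spread_bounds n \<gamma> p \<Longrightarrow> k \<ge> 1 \<Longrightarrow> p k \<le> C * sqrt (1 / 2) ^ k"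
    using spread_bounds_decay[OF False] by blast
  show ?thesis
  proof (intro exI[of _ C] conjI allI impI exI[of _ 0])
    fix n :: nat and p q k assume h: "n > 0" "spread_bounds n \<gamma> p" "spread_bounds n \<gamma> q"
    have "p (Suc k) \<ge> 0" "q (Suc k) \<ge> 0" using h unfolding spread_bounds_def by auto
    moreover have "p (Suc k) \<le> C * sqrt (1 / 2) ^ Suc k" "q (Suc k) \<le> C * sqrt (1 / 2) ^ Suc k"
      using h by (auto intro!: dec simp del: power_Suc)
    moreover have "C * sqrt (1 / 2) ^ Suc k \<le> C * sqrt (1 / 2) ^ k"
      using C by (intro mult_left_mono power_decreasing) auto
    ultimately show "\<bar>p (Suc k) - q (Suc k)\<bar> \<le> C * peak (sqrt (1 / 2)) 0 k"
      by (simp add: peak_def del: power_Suc)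
  qed (use C in auto)
next
  case True
  show ?thesis
  proof (intro exI[of _ "8::real"] conjI allI impI)
    fix n :: nat and p q assume n: "n > 0" and p: "spread_bounds n \<gamma> p" and q: "spread_bounds n \<gamma> q"
    obtain c where c: "2 ^ c \<le> sqrt (real n)" "sqrt (real n) < 2 * 2 ^ c" by (rule obtain_center[OF n])
    \<comment> \<open>The terms are indexed by \<open>Suc k\<close>, hence the centre
      \<open>c - 1\<close>. For \<open>c = 0\<close> the truncated subtraction only weakens the
      bound.\<close>
    have "\<bar>p (Suc k) - q (Suc k)\<bar> \<le> 8 * peak (sqrt (1 / 2)) (c - 1) k" for k
    proof -
      have pq: "0 \<le> p (Suc k)" "p (Suc k) \<le> 1" "0 \<le> q (Suc k)" "q (Suc k) \<le> 1"
        using p q unfolding spread_bounds_def by auto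
      note bp = spread_bounds_center[OF p[unfolded True] _ n c, of "Suc k"]
        and bq = spread_bounds_center[OF q[unfolded True] _ n c, of "Suc k"]
      have "\<bar>p (Suc k) - q (Suc k)\<bar> \<le> 8 * (1 / 2) ^ nat \<bar>int k - int (c - 1)\<bar>"
      proof (cases "Suc k \<le> c")
        case True
        then have e: "nat \<bar>int k - int (c - 1)\<bar> = c - Suc k" by linarith
        have "\<bar>p (Suc k) - q (Suc k)\<bar> \<le> (1 / 2) ^ (c - Suc k) / 3"
          using bp(1) bq(1) True pq by linarith
        also have "\<dots> \<le> 8 * (1 / 2) ^ (c - Suc k)" by simp
        finally show ?thesis unfolding e .
      next
        case False
        have "\<bar>p (Suc k) - q (Suc k)\<bar> \<le> 8 * (1 / 2) ^ (Suc k - c)"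
          using bp(2) bq(2) False pq by linarith
        also have "\<dots> \<le> 8 * (1 / 2) ^ nat \<bar>int k - int (c - 1)\<bar>"
          using False by (intro mult_left_mono power_decreasing) auto
        finally show ?thesis .
      qed
      also have "\<dots> \<le> 8 * peak (sqrt (1 / 2)) (c - 1) k"
        unfolding peak_def by (intro mult_left_mono half_le_sqrt_half) simp
      finally show ?thesis .
    qed
    then show "\<exists>c. \<forall>k. \<bar>p (Suc k) - q (Suc k)\<bar> \<le> (8::real) * peak (sqrt (1 / 2)) c k" by blast
  qed simp
qed

text \<open>Uniformly small terms with a common geometric profile have a small sum:
  \<open>\<bar>d k\<bar> = sqrt \<bar>d k\<bar> * sqrt \<bar>d k\<bar>\<close>, where one factor is small and the other one summable.\<close>

lemma suminf_small_of_peak: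
  fixes d :: "nat \<Rightarrow> real"
  assumes C: "C > 0" and \<rho>: "0 < \<rho>" "\<rho> < 1" and dom: "\<And>k. \<bar>d k\<bar> \<le> C * peak \<rho> c k"
    and small: "\<And>k. \<bar>d k\<bar> \<le> \<delta>"
  shows "\<bar>suminf d\<bar> \<le> sqrt \<delta> * (sqrt C * (2 / (1 - sqrt \<rho>)))"
proof -
  have r: "0 < sqrt \<rho>" "sqrt \<rho> < 1" using \<rho> by auto
  have \<delta>: "0 \<le> \<delta>" using small[of 0] by linarith
  have b: "\<bar>d k\<bar> \<le> sqrt \<delta> * sqrt C * peak (sqrt \<rho>) c k" for k
  proof -
    have "\<bar>d k\<bar> = sqrt \<bar>d k\<bar> * sqrt \<bar>d k\<bar>" by simp
    also have "\<dots> \<le> sqrt \<delta> * sqrt (C * peak \<rho> c k)"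
      using small dom \<delta> by (intro mult_mono real_sqrt_le_mono) auto
    also have "\<dots> = sqrt \<delta> * sqrt C * peak (sqrt \<rho>) c k"
      by (simp add: peak_def real_sqrt_mult real_sqrt_power)
    finally show ?thesis .
  qed
  have sm: "summable (\<lambda>k. sqrt \<delta> * sqrt C * peak (sqrt \<rho>) c k)"
    by (intro summable_mult peak_sums r)
  have sd: "summable (\<lambda>k. \<bar>d k\<bar>)"
    by (rule summable_comparison_test'[OF sm, of 0]) (use b in auto)
  have "\<bar>suminf d\<bar> \<le> (\<Sum>k. \<bar>d k\<bar>)" using sd by (rule summable_rabs)
  also have "\<dots> \<le> (\<Sum>k. sqrt \<delta> * sqrt C * peak (sqrt \<rho>) c k)" by (intro suminf_le b sd sm)
  also have "\<dots> = sqrt \<delta> * sqrt C * suminf (peak (sqrt \<rho>) c)" by (intro suminf_mult peak_sums r)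
  also have "\<dots> \<le> sqrt \<delta> * sqrt C * (2 / (1 - sqrt \<rho>))"
    using \<delta> C by (intro mult_left_mono peak_sums r) auto
  finally show ?thesis by (simp add: mult.assoc)
qed


section \<open>Explicit bound for the Gaussian sum\<close>

lemma A_term_zero_offset:
  "A_term n k 0 = erf (sqrt (real n) * sqrt (6 / (4 * 4 ^ k * (1 - 1 / 4 ^ k))))"
proof -
  have "1 / 2 ^ (k + 1) * real n / (sqrt 2 * sigma n k) = sqrt (real n) * sqrt (6 / (4 * 4 ^ k * (1 - 1 / 4 ^ k)))"
  proof -
    have "(1 / 2 ^ (k + 1) * real n) = sqrt ((1 / (4 * 4 ^ k)) * (real n * real n))"
    proof -
      have "sqrt (4 * 4 ^ k) = 2 ^ (k + 1)"
        by (rule real_sqrt_unique) (auto simp: power2_eq_square power_mult_distrib[symmetric])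
      then show ?thesis by (simp add: real_sqrt_mult real_sqrt_divide)
    qed
    moreover have "sqrt 2 * sigma n k = sqrt (2 * (real n * (1 - 1 / 4 ^ k) / 12))"
      unfolding sigma_def by (rule real_sqrt_mult[symmetric])
    ultimately have "1 / 2 ^ (k + 1) * real n / (sqrt 2 * sigma n k) =
       sqrt ((1 / (4 * 4 ^ k)) * (real n * real n) / (2 * (real n * (1 - 1 / 4 ^ k) / 12)))"
      by (simp only: real_sqrt_divide)
    also have "(1 / (4 * 4 ^ k)) * (real n * real n) / (2 * (real n * (1 - 1 / 4 ^ k) / 12)) =
        real n * (6 / (4 * 4 ^ k * (1 - 1 / 4 ^ k)))"
      by (cases "n = 0") simp_all
    finally show ?thesis unfolding real_sqrt_mult .
  qed
  then show ?thesis unfolding A_term_def by (simp add: erf_minus)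
qed

text \<open>The slope bound for \<open>erf\<close> gives \<open>sqrt (c / (4 ^ k - 1))\<close> with
  \<open>c = 6 * n / pi\<close>. Replacing this by \<open>sqrt ((c + 1) / 4 ^ k)\<close> is possible
  exactly when \<open>c + 1 \<le> 4 ^ k\<close>, which explains the number 6 n / pi + 1.\<close>

lemma A_term_zero_offset_le:
  assumes k: "k \<ge> 1" and c: "6 * real n / pi + 1 \<le> 4 ^ k"
  shows "A_term n k 0 \<le> sqrt (6 * real n / pi + 1) / 2 ^ k"
proof -
  define c where "c = 6 * real n / pi"
  have c0: "c \<ge> 0" by (simp add: c_def)
  have k1: "(4::real) ^ k - 1 > 0" using k by simp
  define x where "x = sqrt (real n) * sqrt (6 / (4 * 4 ^ k * (1 - 1 / 4 ^ k)))"
  have x: "x \<ge> 0" unfolding x_def using k1 by (intro mult_nonneg_nonneg real_sqrt_ge_zero) auto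
  have "A_term n k 0 \<le> 2 / sqrt pi * x"
    using erf_diff_le[OF x] unfolding A_term_zero_offset x_def[symmetric] by simp
  also have "\<dots> = sqrt (c / (4 ^ k - 1))"
  proof -
    have "2 / sqrt pi = sqrt (4 / pi)" by (simp add: real_sqrt_divide)
    moreover have "(4::real) * 4 ^ k * (1 - 1 / 4 ^ k) = 4 * (4 ^ k - 1)" by (simp add: field_simps)
    ultimately have "2 / sqrt pi * x = sqrt (4 / pi * (real n * (6 / (4 * (4 ^ k - 1)))))"
      unfolding x_def by (simp only: real_sqrt_mult)
    also have "4 / pi * (real n * (6 / (4 * q))) = c / q" for q unfolding c_def by simp
    finally show ?thesis .
  qed
  also have "\<dots> \<le> sqrt ((c + 1) / 4 ^ k)"
  proof (rule real_sqrt_le_mono)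
    have "c + 1 \<le> 4 ^ k" using c by (simp add: c_def)
    then have "c * 4 ^ k \<le> (c + 1) * (4 ^ k - 1)" by (simp add: algebra_simps)
    then show "c / (4 ^ k - 1) \<le> (c + 1) / 4 ^ k" using k1 by (simp add: divide_le_eq le_divide_eq mult.commute)
  qed
  also have "\<dots> = sqrt (c + 1) / 2 ^ k"
  proof -
    have "sqrt (4 ^ k) = 2 ^ k" by (rule real_sqrt_unique) (auto simp: power2_eq_square power_mult_distrib[symmetric])
    then show ?thesis by (simp add: real_sqrt_divide)
  qed
  finally show ?thesis unfolding c_def .
qed

text \<open>A convex function lies below its chord, here the one over the unit interval.\<close>

lemma two_powr_le:
  assumes "0 \<le> x" "x \<le> 1"
  shows "2 powr x \<le> 1 + (x::real)"
proof -
  have "convex_on UNIV (\<lambda>x::real. 2 powr x)"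
  proof (rule f''_ge0_imp_convex)
    show "((\<lambda>x. 2 powr x) has_real_derivative 2 powr x * ln 2) (at x)" for x :: real
      by (auto intro!: derivative_eq_intros)
    show "((\<lambda>x. 2 powr x * ln 2) has_real_derivative 2 powr x * ln 2 * ln 2) (at x)" for x :: real
      by (auto intro!: derivative_eq_intros)
  qed auto
  from convex_onD[OF this, of x 0 1] assms show ?thesis by simp
qed

text \<open>With \<open>4 powr L = 6 n / pi + 1\<close>, the terms with \<open>k \<le> L\<close> are bounded by 1, and the other ones
  by the geometric sequence \<open>2 powr (L - k)\<close>.\<close>

lemma A_sum_zero_offset:
  assumes n: "n \<ge> 2"
  shows "(\<Sum>k. A_term n (Suc k) 0) \<le> A_bound r n 0"
proof -
  define c where "c = 6 * real n / pi"
  define L where "L = 1 / 2 * log 2 (c + 1)"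
  define K where "K = nat \<lfloor>L\<rfloor>"
  have c1: "c \<ge> 1" unfolding c_def using n pi_less_4 by (simp add: le_divide_eq)
  then have L0: "L \<ge> 0" unfolding L_def by simp
  have KL: "real K \<le> L" "L < real K + 1" unfolding K_def using L0 by (auto simp: of_nat_nat)
  have "2 powr L = (2 powr log 2 (c + 1)) powr (1 / 2)" by (simp add: L_def powr_powr)
  then have sqc: "sqrt (c + 1) = 2 powr L" using c1 by (simp add: powr_half_sqrt)
  have sp: "spread_bounds n 0 (\<lambda>k. A_term n k 0)" using n by (intro spread_bounds_A_term) simp
  have sm: "summable (\<lambda>k. A_term n (Suc k) 0)" using spread_bounds_summable[OF sp] .
  have head: "(\<Sum>k<K. A_term n (Suc k) 0) \<le> real K"
    using sum_bounded_above[of "{..<K}" "\<lambda>k. A_term n (Suc k) 0" 1] sp unfolding spread_bounds_def by simp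
  have tail: "A_term n (Suc (k + K)) 0 \<le> 2 powr L / 2 ^ K * (1 / 2) ^ Suc k" for k
  proof -
    have "c + 1 = (2 powr L)\<^sup>2" unfolding sqc[symmetric] using c1 by simp
    also have "\<dots> = 4 powr L" by (simp add: power2_eq_square powr_mult[symmetric])
    also have "\<dots> \<le> 4 powr (real (Suc (k + K)))" using KL by (intro powr_mono) auto
    also have "\<dots> = 4 ^ Suc (k + K)" by (rule powr_realpow) simp
    finally have "A_term n (Suc (k + K)) 0 \<le> sqrt (c + 1) / 2 ^ Suc (k + K)"
      unfolding c_def by (intro A_term_zero_offset_le) auto
    also have "\<dots> = 2 powr L / 2 ^ K * (1 / 2) ^ Suc k" unfolding sqc by (simp add: power_add power_one_over)
    finally show ?thesis .
  qed
  have geo: "(\<lambda>k. 2 powr L / 2 ^ K * (1 / 2) ^ Suc k) sums (2 powr L / 2 ^ K * 1)"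
    by (intro sums_mult power_half_series)
  have "(\<Sum>k. A_term n (Suc (k + K)) 0) \<le> 2 powr L / 2 ^ K"
    using suminf_le[OF tail summable_iff_shift[of "\<lambda>k. A_term n (Suc k) 0" K, THEN iffD2, OF sm] sums_summable[OF geo]]
      sums_unique[OF geo] by simp
  also have "\<dots> = 2 powr (L - K)" by (simp add: powr_diff powr_realpow)
  \<comment> \<open>\<open>L - K\<close> is the fractional part of \<open>L\<close>. The chord bound
    makes the head \<open>K\<close> and the tail add up to \<open>L + 1\<close> without a rounding
    loss.\<close>
  also have "\<dots> \<le> 1 + (L - K)" using KL by (intro two_powr_le) auto
  finally have "(\<Sum>k. A_term n (Suc k) 0) \<le> L + 1"
    using head suminf_split_initial_segment[OF sm, of K] by simp
  \<comment> \<open>The square root is at least 1 as soon as \<open>1 / c \<le> 2\<close>, so the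
    stated bound is weaker than \<open>L + 1\<close>.\<close>
  also have "\<dots> \<le> L + sqrt (3 / (1 + pi / (6 * real n)))"
  proof -
    have "1 + pi / (6 * real n) = 1 + 1 / c" unfolding c_def by simp
    also have "1 / c \<le> 2" using c1 by (simp add: divide_le_eq)
    finally have "1 \<le> 3 / (1 + pi / (6 * real n))" by (simp add: le_divide_eq add_pos_nonneg)
    then show ?thesis by simp
  qed
  finally show ?thesis unfolding A_bound_def L_def c_def by simp
qed

section \<open>The Gaussian sum at positive offset\<close>

definition A_limit :: "nat \<Rightarrow> real \<Rightarrow> real" where
  "A_limit k \<gamma> = (sgn (\<gamma> + 1 / 2 ^ (k + 1)) - sgn (\<gamma> - 1 / 2 ^ (k + 1))) / 2"

text \<open>Tannery's theorem: the bound of \<open>spread_bounds_decay\<close> is a geometric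
  majorant free of \<open>n\<close>. At offset 0 none exists, since every term tends to 1.\<close>

lemma A_sum_tendsto:
  assumes g: "\<gamma> \<noteq> 0"
  shows "(\<lambda>n. \<Sum>k. A_term n (Suc k) \<gamma>) \<longlonglongrightarrow> (\<Sum>k. A_limit (Suc k) \<gamma>)"
proof -
  obtain C where C: "C > 0"
    and dec: "\<And>n p k. n > 0 \<Longrightarrow> spread_bounds n \<gamma> p \<Longrightarrow> k \<ge> 1 \<Longrightarrow> p k \<le> C * sqrt (1 / 2) ^ k"
    using spread_bounds_decay[OF g] by blast
  have bd: "norm (A_term n (Suc k) \<gamma>) \<le> C * sqrt (1 / 2) ^ Suc k" if "n > 0" for n k
  proof -
    have sb: "spread_bounds n \<gamma> (\<lambda>k. A_term n k \<gamma>)" using that by (rule spread_bounds_A_term)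
    then have "0 \<le> A_term n (Suc k) \<gamma>" unfolding spread_bounds_def by simp
    then show ?thesis using dec[OF that sb, of "Suc k"] by (simp del: power_Suc)
  qed
  have "\<forall>\<^sub>F (k, n) in at_top \<times>\<^sub>F sequentially. norm (A_term n (Suc k) \<gamma>) \<le> C * sqrt (1 / 2) ^ Suc k"
    unfolding case_prod_unfold
    by (rule eventually_prodI[where P="\<lambda>_. True" and Q="\<lambda>n. n > 0", THEN eventually_mono])
      (use bd in \<open>auto simp: eventually_gt_at_top\<close>)
  moreover have "summable (\<lambda>k. C * sqrt (1 / 2) ^ Suc k)"
    by (intro summable_mult summable_Suc_iff[THEN iffD2] summable_geometric) (simp add: real_sqrt_divide)
  moreover have "(\<lambda>n. A_term n (Suc k) \<gamma>) \<longlonglongrightarrow> A_limit (Suc k) \<gamma>" for k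
    unfolding A_limit_def by (rule A_term_tendsto) simp
  ultimately show ?thesis
    using tannerys_theorem[of "\<lambda>k n. A_term n (Suc k) \<gamma>" "\<lambda>k. A_limit (Suc k) \<gamma>" sequentially
      "\<lambda>k. C * sqrt (1 / 2) ^ Suc k"] by (auto simp del: power_Suc)
qed

text \<open>Rounds up to K contribute 1 each, round K + 1 contributes at most 1/2, attained when
  \<gamma> is the corresponding power of 1/2, and later rounds contribute 0. Staying below K + 1
  leaves room for the passage to finite \<open>n\<close>.\<close>

lemma A_limit_sum_le:
  assumes g: "0 < \<gamma>" "\<gamma> \<le> 1 / 2"
  shows "\<exists>K. (K \<ge> 1 \<longrightarrow> \<gamma> < 1 / 2 ^ (K + 1)) \<and> (\<gamma> > 1 / 4 \<longrightarrow> K = 0) \<and> (\<Sum>k. A_limit (Suc k) \<gamma>) \<le> real K + 1 / 2"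
proof -
  obtain m where m: "(1 / 2 :: real) ^ m < \<gamma>" using real_arch_pow_inv[of \<gamma> "1 / 2"] g by auto
  define Q where "Q k \<longleftrightarrow> k = 0 \<or> \<gamma> < 1 / 2 ^ (k + 1)" for k :: nat
  have Qm: "k \<le> m" if "Q k" for k
  proof (rule ccontr)
    assume "\<not> k \<le> m"
    then have "(1 / 2 :: real) ^ (k + 1) \<le> (1 / 2) ^ m" by (intro power_decreasing) auto
    then show False using m that \<open>\<not> k \<le> m\<close> unfolding Q_def by (simp add: power_one_over)
  qed
  define K where "K = (GREATEST k. Q k)"
  have QK: "Q K" unfolding K_def by (rule GreatestI_nat[of Q 0 m]) (use Qm in \<open>auto simp: Q_def\<close>)
  have maxK: "k \<le> K" if "Q k" for k unfolding K_def using that Qm by (rule Greatest_le_nat)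
  have A: "A_limit k \<gamma> = (if \<gamma> < 1 / 2 ^ (k + 1) then 1 else if \<gamma> = 1 / 2 ^ (k + 1) then 1 / 2 else 0)" for k
  proof -
    have "sgn (\<gamma> + 1 / 2 ^ (k + 1)) = 1" using g by (simp add: add_pos_pos)
    then show ?thesis unfolding A_limit_def by (simp add: sgn_if del: power_Suc power_add)
  qed
  have z: "A_limit (Suc k) \<gamma> = 0" if "k \<notin> {..K}" for k
  proof -
    have "\<not> Q k" using maxK[of k] that by auto
    then have "1 / 2 ^ (k + 1) \<le> \<gamma>" unfolding Q_def by auto
    moreover have "(1::real) / 2 ^ (Suc k + 1) < 1 / 2 ^ (k + 1)" by (simp add: field_simps)
    ultimately show ?thesis unfolding A by simp
  qed
  have "(\<Sum>k. A_limit (Suc k) \<gamma>) = (\<Sum>k\<in>{..K}. A_limit (Suc k) \<gamma>)"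
    by (rule suminf_finite) (use z in auto)
  also have "\<dots> = (\<Sum>k<K. A_limit (Suc k) \<gamma>) + A_limit (Suc K) \<gamma>"
    by (simp add: lessThan_Suc_atMost[symmetric])
  also have "(\<Sum>k<K. A_limit (Suc k) \<gamma>) \<le> real K"
    using sum_bounded_above[of "{..<K}" "\<lambda>k. A_limit (Suc k) \<gamma>" 1] unfolding A by auto
  also have "A_limit (Suc K) \<gamma> \<le> 1 / 2"
  proof -
    have "\<not> Q (Suc K)" using maxK[of "Suc K"] by auto
    then show ?thesis unfolding A Q_def by auto
  qed
  finally have "(\<Sum>k. A_limit (Suc k) \<gamma>) \<le> real K + 1 / 2" by simp
  moreover have "K = 0" if "\<gamma> > 1 / 4"
  proof (rule ccontr)
    assume "K \<noteq> 0"
    then have "\<gamma> < 1 / 2 ^ (K + 1)" using QK unfolding Q_def by simp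
    also have "\<dots> \<le> 1 / 2 ^ 2" using \<open>K \<noteq> 0\<close> by (intro divide_left_mono power_increasing) auto
    finally show False using that by simp
  qed
  ultimately show ?thesis using QK unfolding Q_def by auto
qed

text \<open>The gap \<open>1 / 2 ^ (K + 1) - \<gamma>\<close> is strictly positive and is multiplied
  by at least \<open>sqrt n\<close>, so it eventually exceeds the fixed threshold
  \<open>sqrt pi / 2\<close>. This gives K \<le> \<kappa> for large \<open>n\<close>.\<close>

lemma eventually_kappa_cond:
  assumes K: "K \<ge> 1 \<longrightarrow> \<gamma> < 1 / 2 ^ (K + 1)"
  shows "\<forall>\<^sub>F n in sequentially. kappa_cond n \<gamma> K"
proof (cases "K = 0")
  case False
  then have g: "1 / 2 ^ (K + 1) - \<gamma> > 0" using K by simp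
  have lim: "filterlim (\<lambda>n. (1 / 2 ^ (K + 1) - \<gamma>) * sqrt (real n)) at_top sequentially"
    by (intro filterlim_tendsto_pos_mult_at_top[OF tendsto_const g] sqrt_at_top[THEN filterlim_compose] filterlim_real_sequentially)
  have "\<forall>\<^sub>F n in sequentially. sqrt pi / 2 \<le> (1 / 2 ^ (K + 1) - \<gamma>) * sqrt (real n)"
    using lim unfolding filterlim_at_top by blast
  then show ?thesis
    using eventually_gt_at_top[of 0]
  proof eventually_elim
    case (elim n)
    have s: "sigma n K > 0" using elim False by (intro sigma_pos) auto
    have "2 * (sigma n K)\<^sup>2 \<le> real n" using sigma_sq_le[of n K] by simp
    then have "(sqrt 2 * sigma n K)\<^sup>2 \<le> (sqrt (real n))\<^sup>2" by (simp add: power_mult_distrib)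
    then have "sqrt 2 * sigma n K \<le> sqrt (real n)" by (rule power2_le_imp_le) simp
    then have "sqrt (real n) * (sqrt 2 * sigma n K) \<le> sqrt (real n) * sqrt (real n)" by (rule mult_left_mono) simp
    then have "sqrt (real n) \<le> real n / (sqrt 2 * sigma n K)" using s by (simp add: le_divide_eq)
    then have "sqrt pi / 2 \<le> (1 / 2 ^ (K + 1) - \<gamma>) * (real n / (sqrt 2 * sigma n K))"
      using elim(1) g by (meson mult_left_mono less_imp_le order_trans)
    also have "\<dots> = - ((\<gamma> - 1 / 2 ^ (K + 1)) * real n / (sqrt 2 * sigma n K))"
      by (simp add: algebra_simps diff_divide_distrib)
    finally show ?case unfolding kappa_cond_def by linarith
  qed
qed (simp add: kappa_cond_def)

lemma A_sum_bound:
  assumes g: "0 \<le> \<gamma>" "\<gamma> \<le> 1 / 2"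
  shows "\<exists>r :: nat \<Rightarrow> real. r \<longlonglongrightarrow> 0 \<and> (\<forall>n\<ge>2. (\<Sum>k. A_term n (Suc k) \<gamma>) \<le> A_bound (r n) n \<gamma>)"
proof (cases "\<gamma> = 0")
  case True
  then show ?thesis using A_sum_zero_offset by (intro exI[of _ "\<lambda>_. 0"]) auto
next
  case False
  then have g0: "0 < \<gamma>" using g by simp
  obtain K where K: "K \<ge> 1 \<longrightarrow> \<gamma> < 1 / 2 ^ (K + 1)" "\<gamma> > 1 / 4 \<longrightarrow> K = 0"
    and lim: "(\<Sum>k. A_limit (Suc k) \<gamma>) \<le> real K + 1 / 2"
    using A_limit_sum_le[OF g0 g(2)] by blast
  define B where "B n = (if \<gamma> \<le> 1 / 4 then 1 + real (kappa n \<gamma>) else 1)" for n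
  \<comment> \<open>The positive part of the excess makes the bound true for every \<open>n\<close>
    by construction. What remains is that it vanishes for large \<open>n\<close>.\<close>
  define r where "r n = max 0 ((\<Sum>k. A_term n (Suc k) \<gamma>) - B n)" for n
  have "\<forall>\<^sub>F n in sequentially. (\<Sum>k. A_term n (Suc k) \<gamma>) < real K + 1"
    using order_tendstoD(2)[OF A_sum_tendsto[OF False], of "real K + 1"] lim by simp
  then have "\<forall>\<^sub>F n in sequentially. r n = 0"
    using eventually_kappa_cond[OF K(1)]
  proof eventually_elim
    case (elim n)
    have "K \<le> kappa n \<gamma>" using elim(2) by (rule kappa_greatest(2)[OF g0])
    then have "real K + 1 \<le> B n" unfolding B_def using K(2) by auto
    then show ?case using elim(1) unfolding r_def by simp
  qed
  then have "r \<longlonglongrightarrow> 0" by (rule tendsto_eventually)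
  moreover have "(\<Sum>k. A_term n (Suc k) \<gamma>) \<le> A_bound (r n) n \<gamma>" for n
    using False unfolding A_bound_def r_def B_def by auto
  ultimately show ?thesis by blast
qed


section \<open>The mean stopping time\<close>

context bit_exchange
begin

lemma mean_T_eq_suminf:
  shows "summable (\<lambda>k. prob_between M n X h a (Suc k))"
    and "mean_T M n X h a = ennreal (1 + (\<Sum>k. prob_between M n X h a (Suc k)))"
    and "0 \<le> (\<Sum>k. prob_between M n X h a (Suc k))"
proof -
  have nn: "0 \<le> prob_between M n X h a k" for k by (simp add: prob_between_def)
  show sm: "summable (\<lambda>k. prob_between M n X h a (Suc k))"
    by (rule spread_bounds_summable[OF spread_bounds_prob_between])
  show s0: "0 \<le> (\<Sum>k. prob_between M n X h a (Suc k))" using sm nn by (rule suminf_nonneg)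
  show "mean_T M n X h a = ennreal (1 + (\<Sum>k. prob_between M n X h a (Suc k)))"
    unfolding mean_T_eq using suminf_ennreal2[OF nn sm] s0 by (simp add: ennreal_plus)
qed

text \<open>Each of the first \<open>c\<close> rounds is survived with probability at least 2/3, and
  \<open>c\<close> exceeds \<open>ln n / 2 - 1\<close> because \<open>ln 2 < 1\<close>.\<close>

lemma sum_prob_between_ge:
  assumes g: "offset a = 0"
  shows "ln (real n) / 3 \<le> 1 + (\<Sum>k. prob_between M n X h a (Suc k))"
proof -
  have sp: "spread_bounds n 0 (prob_between M n X h a)" using spread_bounds_prob_between[of a] g by simp
  obtain c where c: "2 ^ c \<le> sqrt (real n)" "sqrt (real n) < 2 * 2 ^ c" by (rule obtain_center[OF n_pos])
  have "(\<Sum>k<c. 2 / 3) \<le> (\<Sum>k<c. prob_between M n X h a (Suc k))"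
  proof (rule sum_mono)
    fix k assume "k \<in> {..<c}"
    then have "1 - prob_between M n X h a (Suc k) \<le> (1 / 2) ^ (c - Suc k) / 3"
      by (intro spread_bounds_center(1)[OF sp _ n_pos c]) auto
    also have "\<dots> \<le> 1 / 3" by (intro divide_right_mono power_le_one) auto
    finally show "2 / 3 \<le> prob_between M n X h a (Suc k)" by simp
  qed
  also have "\<dots> \<le> (\<Sum>k. prob_between M n X h a (Suc k))"
    using mean_T_eq_suminf(1) by (intro sum_le_suminf) (auto simp: prob_between_def)
  finally have 1: "2 / 3 * real c \<le> (\<Sum>k. prob_between M n X h a (Suc k))" by simp
  have "ln (sqrt (real n)) < ln (2 ^ Suc c)" using c n_pos by (subst ln_less_cancel_iff) auto
  also have "\<dots> = real (Suc c) * ln 2" by (rule ln_realpow) 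
  also have "\<dots> \<le> real (Suc c) * 1" using ln_2_less_1 by (intro mult_left_mono) auto
  finally have "ln (real n) / 2 < real c + 1" using n_pos by (simp add: ln_sqrt)
  then show ?thesis using 1 by simp
qed

lemma sum_prob_between_le:
  assumes g: "offset a = 0"
  shows "1 + (\<Sum>k. prob_between M n X h a (Suc k)) \<le> 10 / ln 2 * ln (real n)"
proof -
  let ?p = "\<lambda>k. prob_between M n X h a (Suc k)"
  have sp: "spread_bounds n 0 (prob_between M n X h a)" using spread_bounds_prob_between[of a] g by simp
  obtain c where c: "2 ^ c \<le> sqrt (real n)" "sqrt (real n) < 2 * 2 ^ c" by (rule obtain_center[OF n_pos])
  have sm: "summable ?p" by (rule mean_T_eq_suminf)
  have "(\<Sum>k<c. ?p k) \<le> real c"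
    using sum_bounded_above[of "{..<c}" ?p 1] sp unfolding spread_bounds_def by simp
  moreover have "(\<Sum>k. ?p (k + c)) \<le> 8"
  proof -
    have b: "?p (k + c) \<le> 8 * (1 / 2) ^ Suc k" for k
      using spread_bounds_center(2)[OF sp _ n_pos c, of "Suc (k + c)"] by simp
    have geo: "(\<lambda>k. 8 * (1 / 2 :: real) ^ Suc k) sums (8 * 1)" by (intro sums_mult power_half_series)
    show ?thesis
      using suminf_le[OF b summable_iff_shift[of ?p c, THEN iffD2, OF sm] sums_summable[OF geo]] sums_unique[OF geo] by simp
  qed
  ultimately have 1: "(\<Sum>k. ?p k) \<le> real c + 8"
    using suminf_split_initial_segment[OF sm, of c] by simp
  have "ln (2 ^ c) \<le> ln (sqrt (real n))" using c n_pos by (subst ln_le_cancel_iff) auto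
  then have "real c * ln 2 \<le> ln (real n) / 2" using n_pos by (simp add: ln_realpow ln_sqrt)
  then have c2: "real c \<le> ln (real n) / 2 / ln 2" by (simp add: le_divide_eq)
  \<comment> \<open>From \<open>n \<ge> 2\<close> the binary logarithm of \<open>n\<close> is at
    least 1, so it absorbs the additive constant 9 into the factor 10.\<close>
  have "ln 2 \<le> ln (real n)" using n_ge_2 by simp
  then have "1 \<le> ln (real n) / ln 2" by (simp add: le_divide_eq)
  moreover have "10 / ln 2 * ln (real n) = 10 * (ln (real n) / ln 2)" by simp
  moreover have "ln (real n) / 2 / ln 2 = (ln (real n) / ln 2) / 2" by simp
  ultimately show ?thesis using 1 c2 by linarith
qed

end

text \<open>The geometric majorant depends on \<gamma> alone, so one constant serves all numbers of
  nodes, weights and thresholds with this offset.\<close>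

lemma mean_T_bounded:
  assumes g: "\<gamma> \<noteq> 0"
  shows "\<exists>C. \<forall>(M :: 'a measure) n X h a. bit_exchange M n X h \<longrightarrow> bit_exchange.offset n h a = \<gamma> \<longrightarrow>
    mean_T M n X h a \<le> ennreal C"
proof -
  obtain C where C: "C > 0"
    and dec: "\<And>n p k. n > 0 \<Longrightarrow> spread_bounds n \<gamma> p \<Longrightarrow> k \<ge> 1 \<Longrightarrow> p k \<le> C * sqrt (1 / 2) ^ k"
    using spread_bounds_decay[OF g] by blast
  define q where "q = sqrt (1 / 2 :: real)"
  have sm: "summable (\<lambda>k. C * q ^ Suc k)"
    unfolding q_def
    by (intro summable_mult summable_Suc_iff[THEN iffD2] summable_geometric) (simp add: real_sqrt_divide)
  show ?thesis
  proof (intro exI[of _ "1 + (\<Sum>k. C * q ^ Suc k)"] allI impI)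
    fix M :: "'a measure" and n X h a
    assume be: "bit_exchange M n X h" and off: "bit_exchange.offset n h a = \<gamma>"
    interpret bit_exchange M n X h by fact
    have "prob_between M n X h a (Suc k) \<le> C * q ^ Suc k" for k
      unfolding q_def using dec[OF n_pos _, of "prob_between M n X h a" "Suc k"] spread_bounds_prob_between[of a] off by simp
    then have "(\<Sum>k. prob_between M n X h a (Suc k)) \<le> (\<Sum>k. C * q ^ Suc k)"
      by (intro suminf_le mean_T_eq_suminf(1) sm)
    then show "mean_T M n X h a \<le> ennreal (1 + (\<Sum>k. C * q ^ Suc k))"
      unfolding mean_T_eq_suminf(2) by (intro ennreal_leI) simp
  qed
qed

lemma error_sum_tendsto_0:
  fixes M :: "nat \<Rightarrow> 'a measure" and a :: "nat \<Rightarrow> real"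
  assumes be: "\<And>n. n \<in> N \<Longrightarrow> bit_exchange (M n) n (X n) (h n)"
    and off: "\<And>n. n \<in> N \<Longrightarrow> bit_exchange.offset n (h n) (a n) = \<gamma>"
  shows "((\<lambda>n. \<Sum>k. prob_between (M n) n (X n) (h n) (a n) (Suc k) - A_term n (Suc k) \<gamma>) \<longlongrightarrow> 0) (at_top_in N)"
proof -
  let ?P = "\<lambda>n. prob_between (M n) n (X n) (h n) (a n)"
  obtain C where C: "C > 0"
    and dom: "\<And>n p q. n > 0 \<Longrightarrow> spread_bounds n \<gamma> p \<Longrightarrow> spread_bounds n \<gamma> q \<Longrightarrow>
     \<exists>c. \<forall>k. \<bar>p (Suc k) - q (Suc k)\<bar> \<le> C * peak (sqrt (1 / 2)) c k"
    using spread_bounds_diff_peak[of \<gamma>] by blast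
  define D where "D = sqrt C * (2 / (1 - sqrt (sqrt (1 / 2))))"
  have q: "0 < sqrt (1 / 2 :: real)" "sqrt (1 / 2 :: real) < 1" by (simp_all add: real_sqrt_divide)
  have "sqrt (sqrt (1 / 2 :: real)) < 1" using q by simp
  then have D: "D > 0" unfolding D_def using C by simp
  show ?thesis
  proof (rule tendstoI)
    fix e :: real assume e: "e > 0"
    \<comment> \<open>Chosen so that the bound \<open>sqrt \<delta> * D\<close> obtained below
      equals \<open>e / 2\<close>.\<close>
    define \<delta> where "\<delta> = (e / (2 * D))\<^sup>2"
    have \<delta>: "\<delta> > 0" "sqrt \<delta> = e / (2 * D)" unfolding \<delta>_def using e D by auto
    have "\<forall>\<^sub>F n in at_top_in N. n \<in> N" unfolding eventually_at_top_in by auto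
    moreover have "\<forall>\<^sub>F n in at_top_in N. n \<in> N \<longrightarrow> (\<forall>k\<ge>1. \<bar>?P n k - A_term n k \<gamma>\<bar> \<le> \<delta>)"
      by (rule error_uniform) (use be off \<delta> in auto)
    ultimately show "\<forall>\<^sub>F n in at_top_in N. dist (\<Sum>k. ?P n (Suc k) - A_term n (Suc k) \<gamma>) 0 < e"
    proof eventually_elim
      case (elim n)
      interpret bit_exchange "M n" n "X n" "h n" by (rule be[OF elim(1)])
      obtain c where c: "\<And>k. \<bar>?P n (Suc k) - A_term n (Suc k) \<gamma>\<bar> \<le> C * peak (sqrt (1 / 2)) c k"
        using dom[OF n_pos spread_bounds_prob_between[of "a n", unfolded off[OF elim(1)]] spread_bounds_A_term[OF n_pos]]
        by blast
      have "\<bar>\<Sum>k. ?P n (Suc k) - A_term n (Suc k) \<gamma>\<bar> \<le> sqrt \<delta> * D"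
        unfolding D_def by (rule suminf_small_of_peak[OF C q c]) (use elim in auto)
      also have "\<dots> = e / 2" using \<delta>(2) D by simp
      finally show ?case using e by (simp add: dist_real_def)
    qed
  qed
qed

theorem mainTheorem1:
  fixes M :: "nat \<Rightarrow> 'a measure"
    and X :: "nat \<Rightarrow> nat \<Rightarrow> 'a \<Rightarrow> real"
    and h :: "nat \<Rightarrow> nat \<Rightarrow> int"
    and N :: "nat set"
    and \<alpha> \<beta> \<gamma> :: real
    and a :: "nat \<Rightarrow> real"
    and \<epsilon> :: "nat \<Rightarrow> nat \<Rightarrow> real"
  assumes "infinite N"
    and "\<And>n. n \<in> N \<Longrightarrow> bit_exchange (M n) n (X n) (h n)"
    and "\<And>n. n \<in> N \<Longrightarrow> real (num_pos n (h n)) / real n = \<beta>"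
    and "\<And>n. n \<in> N \<Longrightarrow> a n / real n = \<alpha>"
    and "\<gamma> = \<alpha> + (1 / 2 - \<beta>)"
    and "\<And>n k. n \<in> N \<Longrightarrow> k \<ge> 1 \<Longrightarrow>
           prob_between (M n) n (X n) (h n) (a n) k = A_term n k \<gamma> + \<epsilon> n k"
  shows
    "(\<forall>n\<in>N. summable (\<lambda>k. prob_between (M n) n (X n) (h n) (a n) (Suc k))
          \<and> summable (\<lambda>k. A_term n (Suc k) \<gamma>)
          \<and> summable (\<lambda>k. \<epsilon> n (Suc k)))
     \<and> (\<exists>lim_T lim_P lim_S :: ereal.
          ((\<lambda>n. enn2ereal (mean_T (M n) n (X n) (h n) (a n))) \<longlongrightarrow> lim_T) (at_top_in N)
        \<and> ((\<lambda>n. ereal (\<Sum>k. prob_between (M n) n (X n) (h n) (a n) (Suc k))) \<longlongrightarrow> lim_P)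
             (at_top_in N)
        \<and> ((\<lambda>n. ereal (\<Sum>k. A_term n (Suc k) \<gamma> + \<epsilon> n (Suc k))) \<longlongrightarrow> lim_S) (at_top_in N)
        \<and> lim_T \<le> 1 + lim_P
        \<and> 1 + lim_P = 1 + lim_S)
     \<and> ((\<lambda>n. \<Sum>k. \<epsilon> n (Suc k)) \<longlongrightarrow> 0) (at_top_in N)
     \<and> (0 \<le> \<gamma> \<and> \<gamma> \<le> 1 / 2 \<longrightarrow>
          (\<exists>r :: nat \<Rightarrow> real. r \<longlonglongrightarrow> 0 \<and>
             (\<forall>n\<ge>2. summable (\<lambda>k. A_term n (Suc k) \<gamma>)
                  \<and> (\<Sum>k. A_term n (Suc k) \<gamma>) \<le> A_bound (r n) n \<gamma>)))
     \<and> (0 < \<gamma> \<and> \<gamma> \<le> 1 / 4 \<longrightarrow> (\<exists>K. \<forall>n\<ge>2. kappa n \<gamma> \<le> K))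
     \<and> (\<gamma> = 0 \<longrightarrow>
          (\<exists>c C :: real. 0 < c \<and> 0 < C \<and>
             (\<forall>\<^sub>F n in at_top_in N.
                ennreal (c * ln (real n)) \<le> mean_T (M n) n (X n) (h n) (a n)
              \<and> mean_T (M n) n (X n) (h n) (a n) \<le> ennreal (C * ln (real n)))))
     \<and> (\<gamma> \<noteq> 0 \<longrightarrow>
          (\<exists>C :: real. \<forall>n\<in>N. mean_T (M n) n (X n) (h n) (a n) \<le> ennreal C))"
proof -
  let ?P = "\<lambda>n. prob_between (M n) n (X n) (h n) (a n)"
  let ?F = "at_top_in N"
  let ?T = "\<lambda>n. mean_T (M n) n (X n) (h n) (a n)"
  note be = assms(2)
  have off: "bit_exchange.offset n (h n) (a n) = \<gamma>" if "n \<in> N" for n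
    using assms(3-5) that by (simp add: bit_exchange.offset_def[OF be[OF that]])
  have pos: "n > 0" if "n \<in> N" for n using bit_exchange.n_pos[OF be[OF that]] .
  have \<epsilon>: "\<epsilon> n (Suc k) = ?P n (Suc k) - A_term n (Suc k) \<gamma>" if "n \<in> N" for n k
    using assms(6)[OF that, of "Suc k"] by simp
  have sP: "summable (\<lambda>k. ?P n (Suc k))" if "n \<in> N" for n
    by (rule bit_exchange.mean_T_eq_suminf(1)[OF be[OF that]])
  have sA: "summable (\<lambda>k. A_term n (Suc k) \<gamma>)" if "n > 0" for n
    by (rule spread_bounds_summable[OF spread_bounds_A_term[OF that]])
  have s\<epsilon>: "summable (\<lambda>k. \<epsilon> n (Suc k))" if "n \<in> N" for n
    using \<epsilon>[OF that] summable_diff[OF sP[OF that] sA[OF pos[OF that]]] by simp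
  have ev: "\<forall>\<^sub>F n in ?F. n \<in> N" unfolding eventually_at_top_in by auto
  have F_le: "?F \<le> sequentially" unfolding at_top_in_def by (rule inf_le1)
  have mean: "?T n = ennreal (1 + (\<Sum>k. ?P n (Suc k)))" "0 \<le> (\<Sum>k. ?P n (Suc k))" if "n \<in> N" for n
    by (rule bit_exchange.mean_T_eq_suminf[OF be[OF that]])+
  have mean_ereal: "enn2ereal (?T n) = 1 + ereal (\<Sum>k. ?P n (Suc k))" if "n \<in> N" for n
    unfolding mean(1)[OF that] using mean(2)[OF that] by (subst enn2ereal_ennreal) (simp_all add: one_ereal_def)
  have A1: "\<forall>n\<in>N. summable (\<lambda>k. ?P n (Suc k)) \<and> summable (\<lambda>k. A_term n (Suc k) \<gamma>) \<and> summable (\<lambda>k. \<epsilon> n (Suc k))"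
    using sP sA pos s\<epsilon> by blast
  have A3: "((\<lambda>n. \<Sum>k. \<epsilon> n (Suc k)) \<longlongrightarrow> 0) ?F"
  proof (rule Lim_transform_eventually)
    show "((\<lambda>n. \<Sum>k. ?P n (Suc k) - A_term n (Suc k) \<gamma>) \<longlongrightarrow> 0) ?F"
      by (rule error_sum_tendsto_0) (use be off in auto)
  qed (use ev in \<open>eventually_elim, simp add: \<epsilon>\<close>)
  have log_bounds: "ennreal (1 / 3 * ln (real n)) \<le> ?T n" "?T n \<le> ennreal (10 / ln 2 * ln (real n))"
    "ln (real n) / 3 \<le> 1 + (\<Sum>k. ?P n (Suc k))"
    if "\<gamma> = 0" "n \<in> N" for n
  proof -
    have o: "bit_exchange.offset n (h n) (a n) = 0" using off that by simp
    show l: "ln (real n) / 3 \<le> 1 + (\<Sum>k. ?P n (Suc k))"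
      by (rule bit_exchange.sum_prob_between_ge[OF be[OF that(2)] o])
    have u: "1 + (\<Sum>k. ?P n (Suc k)) \<le> 10 / ln 2 * ln (real n)"
      by (rule bit_exchange.sum_prob_between_le[OF be[OF that(2)] o])
    show "ennreal (1 / 3 * ln (real n)) \<le> ?T n" "?T n \<le> ennreal (10 / ln 2 * ln (real n))"
      unfolding mean(1)[OF that(2)] using l u by (intro ennreal_leI; simp)+
  qed
  \<comment> \<open>The limit exists in the extended reals. At offset 0 the logarithmic lower bound
    forces it to be infinite; otherwise the Gaussian sums converge and the errors vanish.\<close>
  have "\<exists>l :: ereal. ((\<lambda>n. ereal (\<Sum>k. ?P n (Suc k))) \<longlongrightarrow> l) ?F"
  proof (cases "\<gamma> = 0")
    case True
    have "filterlim (\<lambda>n. 1 / 3 * ln (real n)) at_top sequentially"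
      by (intro filterlim_tendsto_pos_mult_at_top[OF tendsto_const] filterlim_compose[OF ln_at_top] filterlim_real_sequentially) auto
    then have "filterlim (\<lambda>n. - 1 + 1 / 3 * ln (real n)) at_top ?F"
      using F_le by (intro filterlim_tendsto_add_at_top[OF tendsto_const]) (rule filterlim_mono[OF _ order_refl])
    then have "filterlim (\<lambda>n. \<Sum>k. ?P n (Suc k)) at_top ?F"
      by (rule filterlim_at_top_mono) (use ev in \<open>eventually_elim, use log_bounds(3)[OF True] in fastforce\<close>)
    then show ?thesis by (intro exI[of _ "\<infinity>"]) (simp only: tendsto_PInfty_eq_at_top)
  next
    case False
    have "((\<lambda>n. (\<Sum>k. A_term n (Suc k) \<gamma>) + (\<Sum>k. \<epsilon> n (Suc k))) \<longlongrightarrow> (\<Sum>k. A_limit (Suc k) \<gamma>) + 0) ?F"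
      by (intro tendsto_add A3 tendsto_mono[OF F_le] A_sum_tendsto False)
    then have "((\<lambda>n. \<Sum>k. ?P n (Suc k)) \<longlongrightarrow> (\<Sum>k. A_limit (Suc k) \<gamma>) + 0) ?F"
    proof (rule Lim_transform_eventually)
      show "\<forall>\<^sub>F n in ?F. (\<Sum>k. A_term n (Suc k) \<gamma>) + (\<Sum>k. \<epsilon> n (Suc k)) = (\<Sum>k. ?P n (Suc k))"
        using ev
      proof eventually_elim
        case (elim n)
        then show ?case using suminf_add[OF sA[OF pos] s\<epsilon>, of n n] \<epsilon> by simp
      qed
    qed
    then show ?thesis by (intro exI) (rule tendsto_ereal)
  qed
  then obtain l :: ereal where l: "((\<lambda>n. ereal (\<Sum>k. ?P n (Suc k))) \<longlongrightarrow> l) ?F" by blast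
  \<comment> \<open>The mean stopping time equals \<open>1 +\<close> the sum for every
    \<open>n\<close>, so the claimed inequality between the limits holds with equality.\<close>
  have "((\<lambda>n. 1 + ereal (\<Sum>k. ?P n (Suc k))) \<longlongrightarrow> 1 + l) ?F"
    by (rule tendsto_add_ereal_general[OF _ tendsto_const l]) (simp add: one_ereal_def)
  then have lT: "((\<lambda>n. enn2ereal (?T n)) \<longlongrightarrow> 1 + l) ?F"
    by (rule Lim_transform_eventually) (use ev in \<open>eventually_elim, simp add: mean_ereal\<close>)
  have lS: "((\<lambda>n. ereal (\<Sum>k. A_term n (Suc k) \<gamma> + \<epsilon> n (Suc k))) \<longlongrightarrow> l) ?F"
    using l by (rule Lim_transform_eventually) (use ev in \<open>eventually_elim, simp add: \<epsilon>\<close>)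
  have A2: "\<exists>lim_T lim_P lim_S :: ereal.
          ((\<lambda>n. enn2ereal (?T n)) \<longlongrightarrow> lim_T) ?F
        \<and> ((\<lambda>n. ereal (\<Sum>k. ?P n (Suc k))) \<longlongrightarrow> lim_P) ?F
        \<and> ((\<lambda>n. ereal (\<Sum>k. A_term n (Suc k) \<gamma> + \<epsilon> n (Suc k))) \<longlongrightarrow> lim_S) ?F
        \<and> lim_T \<le> 1 + lim_P
        \<and> 1 + lim_P = 1 + lim_S"
    using lT l lS by blast
  have A4: "0 \<le> \<gamma> \<and> \<gamma> \<le> 1 / 2 \<longrightarrow>
          (\<exists>r :: nat \<Rightarrow> real. r \<longlonglongrightarrow> 0 \<and>
             (\<forall>n\<ge>2. summable (\<lambda>k. A_term n (Suc k) \<gamma>)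
                  \<and> (\<Sum>k. A_term n (Suc k) \<gamma>) \<le> A_bound (r n) n \<gamma>))"
  proof
    assume "0 \<le> \<gamma> \<and> \<gamma> \<le> 1 / 2"
    then obtain r :: "nat \<Rightarrow> real" where r: "r \<longlonglongrightarrow> 0"
      and b: "\<And>n. n \<ge> 2 \<Longrightarrow> (\<Sum>k. A_term n (Suc k) \<gamma>) \<le> A_bound (r n) n \<gamma>"
      using A_sum_bound by blast
    then show "\<exists>r :: nat \<Rightarrow> real. r \<longlonglongrightarrow> 0 \<and>
             (\<forall>n\<ge>2. summable (\<lambda>k. A_term n (Suc k) \<gamma>)
                  \<and> (\<Sum>k. A_term n (Suc k) \<gamma>) \<le> A_bound (r n) n \<gamma>)"
      using sA by (intro exI[of _ r]) simp
  qed
  have A5: "0 < \<gamma> \<and> \<gamma> \<le> 1 / 4 \<longrightarrow> (\<exists>K. \<forall>n\<ge>2. kappa n \<gamma> \<le> K)"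
    using kappa_cond_bounded[of \<gamma>] kappa_greatest(1)[of \<gamma>] by blast
  have A6: "\<gamma> = 0 \<longrightarrow>
          (\<exists>c C :: real. 0 < c \<and> 0 < C \<and>
             (\<forall>\<^sub>F n in ?F. ennreal (c * ln (real n)) \<le> ?T n \<and> ?T n \<le> ennreal (C * ln (real n))))"
  proof
    assume g: "\<gamma> = 0"
    have "\<forall>\<^sub>F n in ?F. ennreal (1 / 3 * ln (real n)) \<le> ?T n \<and> ?T n \<le> ennreal (10 / ln 2 * ln (real n))"
      using ev by eventually_elim (use log_bounds[OF g] in blast)
    then show "\<exists>c C :: real. 0 < c \<and> 0 < C \<and>
             (\<forall>\<^sub>F n in ?F. ennreal (c * ln (real n)) \<le> ?T n \<and> ?T n \<le> ennreal (C * ln (real n)))"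
      by (intro exI[of _ "1 / 3"] exI[of _ "10 / ln 2"]) simp
  qed
  have A7: "\<gamma> \<noteq> 0 \<longrightarrow> (\<exists>C :: real. \<forall>n\<in>N. ?T n \<le> ennreal C)"
    using mean_T_bounded[of \<gamma>] be off by blast
  show ?thesis using A1 A2 A3 A4 A5 A6 A7 by (intro conjI)
qed

end
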